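(* Let $\omega\in\Lambda^2\mathbb{R}^6\cong\mathfrak{so}(6)^*$ be a nonzero 2-form, with stabilizer $G\subset SO(6)$, and let $\mathcal{O}\cong SO(6)/G$ be its $SO(6)$-orbit, endowed with the Kostant–Kirillov–Souriau symplectic form; $\mathcal{O}$ parametrizes pointwise the Riemannian $G$-structures of the type defined by $\omega$. Then the maximal torus $T$ of $SO(6)$ acts on $\mathcal{O}$ in a Hamiltonian way, with moment map $\mu_T:\mathcal{O}\to\mathfrak{t}^*\cong\mathbb{R}^3$ equal to the composition of the inclusion $\mathcal{O}\hookrightarrow\mathfrak{so}(6)^*$ with the orthogonal projection $\mathfrak{so}(6)^*\to\mathfrak{t}^*$, and the image $\mu_T(\mathcal{O})\subset\mathbb{R}^3$ is a convex polytope (the moment polytope associated to the structure).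
   Context: $\mathbb{R}^6$ carries its standard inner product and orthonormal basis $e^1,\dots,e^6$ (vectors and covectors identified); $e^{ij}=e^i\wedge e^j$. The isomorphism $\Lambda^2\mathbb{R}^6\cong\mathfrak{so}(6)\cong\mathfrak{so}(6)^*$ is given by associating to $\omega$ the skew endomorphism $F$ with $\omega(X,Y)=g(FX,Y)$ and by an invariant inner product on $\mathfrak{so}(6)$; it is $SO(6)$-equivariant. $T$ is the 3-torus of rotations in the planes $\langle e^1,e^2\rangle,\langle e^3,e^4\rangle,\langle e^5,e^6\rangle$, whose Lie algebra $\mathfrak{t}$ corresponds to $\langle e^{12},e^{34},e^{56}\rangle\cong\mathbb{R}^3$. The Kostant–Kirillov–Souriau form on the coadjoint orbit is $\omega_\lambda(\mathcal{X},\mathcal{Y})=(\lambda,[X,Y])$, where $\mathcal{X},\mathcal{Y}\in T_\lambda\mathcal{O}$ are the values at $\lambda$ of the vector fields generated by $X,Y\in\mathfrak{so}(6)$. *)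

theory Defs
  imports "HOL-Analysis.Analysis"
begin

section \<open>Smooth maps, embedded submanifolds and symplectic forms\<close>

fun C_k :: "nat \<Rightarrow> 'a::euclidean_space set \<Rightarrow> ('a \<Rightarrow> 'b::real_normed_vector) \<Rightarrow> bool" where
  "C_k 0 U f \<longleftrightarrow> continuous_on U f"
| "C_k (Suc k) U f \<longleftrightarrow>
     (\<exists>f'. (\<forall>x\<in>U. (f has_derivative f' x) (at x)) \<and> (\<forall>v. C_k k U (\<lambda>x. f' x v)))"

definition smooth_on :: "'a::euclidean_space set \<Rightarrow> ('a \<Rightarrow> 'b::real_normed_vector) \<Rightarrow> bool" where
  "smooth_on U f \<longleftrightarrow> open U \<and> (\<forall>k. C_k k U f)"

definition smooth_submanifold :: "'a::euclidean_space set \<Rightarrow> bool" where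
  "smooth_submanifold M \<longleftrightarrow>
     (\<exists>k. \<forall>p\<in>M. \<exists>U V f g S. p \<in> U \<and> smooth_on U f \<and> smooth_on V g \<and> homeomorphism U V f g \<and>
        subspace (S :: 'a set) \<and> dim S = k \<and> f ` (M \<inter> U) = S \<inter> V)"

definition smooth_map_into ::
  "'a::euclidean_space set \<Rightarrow> ('a \<Rightarrow> 'b::real_normed_vector) \<Rightarrow> 'b set \<Rightarrow> bool" where
  "smooth_map_into U \<phi> M \<longleftrightarrow> smooth_on U \<phi> \<and> \<phi> ` U \<subseteq> M"

definition curve_at :: "'a::euclidean_space set \<Rightarrow> 'a \<Rightarrow> 'a \<Rightarrow> (real \<Rightarrow> 'a) \<Rightarrow> bool" where
  "curve_at M p v c \<longleftrightarrow> (\<forall>t. c t \<in> M) \<and> c 0 = p \<and> (c has_vector_derivative v) (at 0)"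

definition tangent_space :: "'a::euclidean_space set \<Rightarrow> 'a \<Rightarrow> 'a set" where
  "tangent_space M p = {v. \<exists>c. curve_at M p v c}"

text \<open>
  A field of bilinear forms on \<open>M\<close> is a function \<open>\<Omega>\<close> of a point and two vectors; only its values at
  points \<open>p\<close> of \<open>M\<close> on vectors tangent to \<open>M\<close> at \<open>p\<close> are meaningful.  Smoothness and closedness
  are expressed through the pullbacks along all smooth maps from open sets of the ambient space
  into \<open>M\<close>.  These include local parametrizations of \<open>M\<close> precomposed with linear projections, so
  for an embedded submanifold this is smoothness and closedness in the usual sense.
\<close>

definition pullback ::
  "('a::euclidean_space \<Rightarrow> 'b::euclidean_space) \<Rightarrow> ('b \<Rightarrow> 'b \<Rightarrow> 'b \<Rightarrow> real) \<Rightarrow> 'a \<Rightarrow> 'a \<Rightarrow> 'a \<Rightarrow> real" where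
  "pullback \<phi> \<Omega> x v w =
     \<Omega> (\<phi> x) (frechet_derivative \<phi> (at x) v) (frechet_derivative \<phi> (at x) w)"

definition smooth_two_form :: "'a::euclidean_space set \<Rightarrow> ('a \<Rightarrow> 'a \<Rightarrow> 'a \<Rightarrow> real) \<Rightarrow> bool" where
  "smooth_two_form M \<Omega> \<longleftrightarrow>
     (\<forall>p\<in>M. \<forall>u\<in>tangent_space M p. \<forall>v\<in>tangent_space M p. \<forall>w\<in>tangent_space M p. \<forall>a b.
        \<Omega> p (a *\<^sub>R u + b *\<^sub>R v) w = a * \<Omega> p u w + b * \<Omega> p v w \<and>
        \<Omega> p w (a *\<^sub>R u + b *\<^sub>R v) = a * \<Omega> p w u + b * \<Omega> p w v \<and>
        \<Omega> p u u = 0) \<and>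
     (\<forall>U \<phi> v w. smooth_map_into U (\<phi> :: 'a \<Rightarrow> 'a) M \<longrightarrow> smooth_on U (\<lambda>x. pullback \<phi> \<Omega> x v w))"

text \<open>
  The left-hand side below is the exterior derivative of the pullback on constant vector fields.
\<close>

definition closed_two_form :: "'a::euclidean_space set \<Rightarrow> ('a \<Rightarrow> 'a \<Rightarrow> 'a \<Rightarrow> real) \<Rightarrow> bool" where
  "closed_two_form M \<Omega> \<longleftrightarrow>
     (\<forall>U \<phi>. smooth_map_into U (\<phi> :: 'a \<Rightarrow> 'a) M \<longrightarrow>
        (\<forall>x\<in>U. \<forall>u v w.
           frechet_derivative (\<lambda>y. pullback \<phi> \<Omega> y v w) (at x) u +
           frechet_derivative (\<lambda>y. pullback \<phi> \<Omega> y w u) (at x) v +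
           frechet_derivative (\<lambda>y. pullback \<phi> \<Omega> y u v) (at x) w = 0))"

definition symplectic_manifold :: "'a::euclidean_space set \<Rightarrow> ('a \<Rightarrow> 'a \<Rightarrow> 'a \<Rightarrow> real) \<Rightarrow> bool" where
  "symplectic_manifold M \<Omega> \<longleftrightarrow>
     smooth_submanifold M \<and> smooth_two_form M \<Omega> \<and> closed_two_form M \<Omega> \<and>
     (\<forall>p\<in>M. \<forall>v\<in>tangent_space M p. (\<forall>w\<in>tangent_space M p. \<Omega> p v w = 0) \<longrightarrow> v = 0)"

section \<open>Matrix groups and Hamiltonian actions\<close>

fun mat_pow :: "real^'n^'n \<Rightarrow> nat \<Rightarrow> real^'n^'n" where
  "mat_pow A 0 = mat 1"
| "mat_pow A (Suc k) = A ** mat_pow A k"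

text \<open>The type \<^typ>\<open>real^'n^'n\<close> carries the componentwise product, so \<^const>\<open>exp\<close> does not apply.\<close>

definition mat_exp :: "real^'n^'n \<Rightarrow> real^'n^'n" where
  "mat_exp A = (\<Sum>k. mat_pow A k /\<^sub>R fact k)"

definition matrix_lie_group :: "(real^'n^'n) set \<Rightarrow> bool" where
  "matrix_lie_group H \<longleftrightarrow>
     H \<subseteq> {A. invertible A} \<and> mat 1 \<in> H \<and> (\<forall>A\<in>H. \<forall>B\<in>H. A ** B \<in> H) \<and>
     (\<forall>A\<in>H. matrix_inv A \<in> H) \<and> closedin (top_of_set {A. invertible A}) H"

definition lie_algebra :: "(real^'n^'n) set \<Rightarrow> (real^'n^'n) set" where
  "lie_algebra H = {X. \<forall>t. mat_exp (t *\<^sub>R X) \<in> H}"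

definition bracket :: "real^'n^'n \<Rightarrow> real^'n^'n \<Rightarrow> real^'n^'n" where
  "bracket X Y = X ** Y - Y ** X"

definition Ad :: "real^'n^'n \<Rightarrow> real^'n^'n \<Rightarrow> real^'n^'n" where
  "Ad A X = A ** X ** matrix_inv A"

definition generated_field ::
  "(real^'n^'n \<Rightarrow> 'a \<Rightarrow> 'a::euclidean_space) \<Rightarrow> real^'n^'n \<Rightarrow> 'a \<Rightarrow> 'a" where
  "generated_field act X p = vector_derivative (\<lambda>t. act (mat_exp (t *\<^sub>R X)) p) (at 0)"

definition smooth_action ::
  "(real^'n^'n) set \<Rightarrow> (real^'n^'n \<Rightarrow> 'a \<Rightarrow> 'a::euclidean_space) \<Rightarrow> 'a set \<Rightarrow> bool" where
  "smooth_action H act M \<longleftrightarrow>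
     (\<forall>p\<in>M. act (mat 1) p = p) \<and>
     (\<forall>h\<in>H. \<forall>p\<in>M. act h p \<in> M) \<and>
     (\<forall>h\<in>H. \<forall>k\<in>H. \<forall>p\<in>M. act (h ** k) p = act h (act k p)) \<and>
     (\<forall>U \<alpha> \<phi>. smooth_map_into U (\<alpha> :: (real^'n^'n) \<times> 'a \<Rightarrow> _) H \<and> smooth_map_into U \<phi> M \<longrightarrow>
        smooth_on U (\<lambda>x. act (\<alpha> x) (\<phi> x)))"

text \<open>
  A moment map takes values in the dual of the Lie algebra of \<open>H\<close>: \<open>\<mu> p \<xi>\<close> is the value of the
  functional \<open>\<mu> p\<close> at \<open>\<xi>\<close>.  The sign convention is that the differential of \<open>\<lambda>p. \<mu> p \<xi>\<close> is the
  contraction of \<open>\<Omega>\<close> with the vector field generated by \<open>\<xi>\<close> in its first argument.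
\<close>

definition moment_map ::
  "(real^'n^'n) set \<Rightarrow> (real^'n^'n \<Rightarrow> 'a \<Rightarrow> 'a) \<Rightarrow> 'a::euclidean_space set \<Rightarrow>
   ('a \<Rightarrow> 'a \<Rightarrow> 'a \<Rightarrow> real) \<Rightarrow> ('a \<Rightarrow> real^'n^'n \<Rightarrow> real) \<Rightarrow> bool" where
  "moment_map H act M \<Omega> \<mu> \<longleftrightarrow>
     (\<forall>p\<in>M. \<forall>\<xi>\<in>lie_algebra H. \<forall>\<eta>\<in>lie_algebra H. \<forall>a b.
        \<mu> p (a *\<^sub>R \<xi> + b *\<^sub>R \<eta>) = a * \<mu> p \<xi> + b * \<mu> p \<eta>) \<and>
     (\<forall>\<xi>\<in>lie_algebra H. \<forall>U \<phi>. smooth_map_into U (\<phi> :: 'a \<Rightarrow> 'a) M \<longrightarrow> smooth_on U (\<lambda>x. \<mu> (\<phi> x) \<xi>)) \<and>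
     (\<forall>h\<in>H. \<forall>p\<in>M. \<forall>\<xi>\<in>lie_algebra H. \<mu> (act h p) \<xi> = \<mu> p (Ad (matrix_inv h) \<xi>)) \<and>
     (\<forall>\<xi>\<in>lie_algebra H. \<forall>p\<in>M. \<forall>v c. curve_at M p v c \<longrightarrow>
        ((\<lambda>t. \<mu> (c t) \<xi>) has_vector_derivative \<Omega> p (generated_field act \<xi> p) v) (at 0))"

definition hamiltonian_action ::
  "(real^'n^'n) set \<Rightarrow> (real^'n^'n \<Rightarrow> 'a \<Rightarrow> 'a) \<Rightarrow> 'a::euclidean_space set \<Rightarrow>
   ('a \<Rightarrow> 'a \<Rightarrow> 'a \<Rightarrow> real) \<Rightarrow> ('a \<Rightarrow> real^'n^'n \<Rightarrow> real) \<Rightarrow> bool" where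
  "hamiltonian_action H act M \<Omega> \<mu> \<longleftrightarrow>
     matrix_lie_group H \<and> symplectic_manifold M \<Omega> \<and> smooth_action H act M \<and>
     (\<forall>h\<in>H. \<forall>U \<phi>. smooth_map_into U (\<phi> :: 'a \<Rightarrow> 'a) M \<longrightarrow>
        (\<forall>x\<in>U. \<forall>v w. pullback (\<lambda>y. act h (\<phi> y)) \<Omega> x v w = pullback \<phi> \<Omega> x v w)) \<and>
     moment_map H act M \<Omega> \<mu>"

section \<open>Two-forms on six-dimensional Euclidean space\<close>

definition SO6 :: "(real^6^6) set" where
  "SO6 = {A. rotation_matrix A}"

definition so6 :: "(real^6^6) set" where
  "so6 = {X. transpose X = - X}"

definition two_forms :: "(real^6 \<Rightarrow> real^6 \<Rightarrow> real) set" where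
  "two_forms = {\<omega>. bilinear \<omega> \<and> (\<forall>X. \<omega> X X = 0)}"

definition wedge :: "real^6 \<Rightarrow> real^6 \<Rightarrow> real^6 \<Rightarrow> real^6 \<Rightarrow> real" where
  "wedge a b X Y = (a \<bullet> X) * (b \<bullet> Y) - (a \<bullet> Y) * (b \<bullet> X)"

definition rotate_form :: "real^6^6 \<Rightarrow> (real^6 \<Rightarrow> real^6 \<Rightarrow> real) \<Rightarrow> real^6 \<Rightarrow> real^6 \<Rightarrow> real" where
  "rotate_form A \<omega> X Y = \<omega> (matrix_inv A *v X) (matrix_inv A *v Y)"

definition endo :: "(real^6 \<Rightarrow> real^6 \<Rightarrow> real) \<Rightarrow> real^6^6" where
  "endo \<omega> = (THE F. \<forall>X Y. \<omega> X Y = (F *v X) \<bullet> Y)"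

definition form_orbit :: "(real^6 \<Rightarrow> real^6 \<Rightarrow> real) \<Rightarrow> (real^6 \<Rightarrow> real^6 \<Rightarrow> real) set" where
  "form_orbit \<omega> = (\<lambda>A. rotate_form A \<omega>) ` SO6"

definition stabilizer :: "(real^6 \<Rightarrow> real^6 \<Rightarrow> real) \<Rightarrow> (real^6^6) set" where
  "stabilizer \<omega> = {A \<in> SO6. rotate_form A \<omega> = \<omega>}"

text \<open>
  The Riemannian \<open>G\<close>-structures on an oriented six-dimensional Euclidean vector space: reductions to
  \<open>G\<close> of the set of oriented orthonormal frames, on which \<^term>\<open>SO6\<close> acts freely and transitively
  on the right.
\<close>

definition G_structures :: "(real^6^6) set \<Rightarrow> (real^6^6) set set" where
  "G_structures G = (\<lambda>A. (\<lambda>g. A ** g) ` G) ` SO6"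

text \<open>
  The orbit as a subset of the space of skew matrices, which is also identified with its dual by an
  invariant inner product.
\<close>

definition coadjoint_orbit :: "(real^6 \<Rightarrow> real^6 \<Rightarrow> real) \<Rightarrow> (real^6^6) set" where
  "coadjoint_orbit \<omega> = endo ` form_orbit \<omega>"

definition invariant_inner_product :: "(real^6^6 \<Rightarrow> real^6^6 \<Rightarrow> real) \<Rightarrow> bool" where
  "invariant_inner_product B \<longleftrightarrow>
     (\<forall>X\<in>so6. \<forall>Y\<in>so6. \<forall>Z\<in>so6. \<forall>a b. B (a *\<^sub>R X + b *\<^sub>R Y) Z = a * B X Z + b * B Y Z) \<and>
     (\<forall>X\<in>so6. \<forall>Y\<in>so6. B X Y = B Y X) \<and>
     (\<forall>X\<in>so6. X \<noteq> 0 \<longrightarrow> B X X > 0) \<and>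
     (\<forall>A\<in>SO6. \<forall>X\<in>so6. \<forall>Y\<in>so6. B (Ad A X) (Ad A Y) = B X Y)"

definition KKS :: "(real^6^6 \<Rightarrow> real^6^6 \<Rightarrow> real) \<Rightarrow> real^6^6 \<Rightarrow> real^6^6 \<Rightarrow> real^6^6 \<Rightarrow> real" where
  "KKS B F v w =
     (THE r. \<exists>X\<in>so6. \<exists>Y\<in>so6. v = generated_field Ad X F \<and> w = generated_field Ad Y F \<and>
        r = B F (bracket X Y))"

text \<open>In the index type \<^typ>\<open>6\<close> the numeral 6 denotes 0, so the six indices are 1, 2, 3, 4, 5, 6.\<close>

definition cov :: "6 \<Rightarrow> real^6" where
  "cov i = axis i 1"

definition plane_rotation :: "6 \<Rightarrow> 6 \<Rightarrow> real \<Rightarrow> real^6^6" where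
  "plane_rotation i j \<theta> =
     (\<chi> k l. if k = l then (if k = i \<or> k = j then cos \<theta> else 1)
             else if k = i \<and> l = j then - sin \<theta>
             else if k = j \<and> l = i then sin \<theta>
             else 0)"

definition torus :: "(real^6^6) set" where
  "torus = {plane_rotation 1 2 \<alpha> ** plane_rotation 3 4 \<beta> ** plane_rotation 5 6 \<gamma> | \<alpha> \<beta> \<gamma>. True}"

definition torus_element :: "real^3 \<Rightarrow> real^6^6" where
  "torus_element x =
     x $ 1 *\<^sub>R endo (wedge (cov 1) (cov 2)) + x $ 2 *\<^sub>R endo (wedge (cov 3) (cov 4)) +
     x $ 3 *\<^sub>R endo (wedge (cov 5) (cov 6))"

definition torus_projection :: "(real^6^6 \<Rightarrow> real^6^6 \<Rightarrow> real) \<Rightarrow> real^6^6 \<Rightarrow> real^6^6" where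
  "torus_projection B F =
     (THE \<nu>. \<nu> \<in> lie_algebra torus \<and> (\<forall>\<xi>\<in>lie_algebra torus. B (F - \<nu>) \<xi> = 0))"

definition torus_moment :: "(real^6^6 \<Rightarrow> real^6^6 \<Rightarrow> real) \<Rightarrow> real^6^6 \<Rightarrow> real^3" where
  "torus_moment B F = (THE x. torus_element x = torus_projection B F)"

text \<open>
  The identification of coordinate vectors with functionals on the Lie algebra of the torus, through
  the basis above and the inner product.
\<close>

definition torus_covector :: "(real^6^6 \<Rightarrow> real^6^6 \<Rightarrow> real) \<Rightarrow> real^3 \<Rightarrow> real^6^6 \<Rightarrow> real" where
  "torus_covector B x \<xi> = B (torus_element x) \<xi>"

end

theory Submission
  imports Defs "HOL-Computational_Algebra.Polynomial_Factorial" "HOL-Computational_Algebra.Field_as_Ring"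
begin

text \<open>
  Two-forms are skew matrices, and the orbit of \<open>\<omega>\<close> becomes the orbit \<open>M\<close> of one skew matrix under
  conjugation by rotations.  The statements on fibres, cosets and the quotient topology are then those
  of a transitive action of a compact group.

  The geometry of \<open>M\<close> comes from one spectral fact: a skew-adjoint operator \<open>T\<close> is annihilated by a
  polynomial \<open>p\<close> for which \<open>p'(T)\<close> is invertible (\<open>skew_separable_annihilator\<close>).  For a point \<open>F\<close> of
  \<open>M\<close>, such a \<open>p\<close> vanishes on all of \<open>M\<close>, so its derivative at \<open>F\<close> kills every tangent vector.  The
  skew matrices split into the brackets \<open>[X, F]\<close> and the commutant of \<open>F\<close>; the derivative of \<open>p\<close> is zero
  on the former and multiplication by the invertible \<open>p'(F)\<close> on the latter.  Hence the tangent vectors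
  are exactly the brackets (\<open>tangent_space_adjoint_orbit\<close>).  The same \<open>p\<close> shows that \<open>M\<close> meets the
  affine slice of matrices \<open>F + Z\<close>, \<open>Z\<close> orthogonal to the tangent space, only at \<open>F\<close> if \<open>Z\<close> is small, and
  the inverse function theorem turns this into charts (\<open>adjoint_orbit_chart\<close>).  Applied to \<open>ad F\<close>
  instead of \<open>F\<close>, the spectral fact gives a polynomial \<open>q\<close> such that \<open>q(ad G)\<close> is a pseudo-inverse of
  \<open>ad G\<close>, with one \<open>q\<close> for all \<open>G\<close> in \<open>M\<close> because these operators are conjugate.  So a tangent vector
  at \<open>G\<close> is generated by a Lie algebra element that is a polynomial in \<open>G\<close> and linear in the vector
  (\<open>orbit_lift_exists\<close>).  This makes the symplectic form smooth; its closedness is the Jacobi identity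
  combined with the symmetry of second derivatives (\<open>KKS_cocycle\<close>), and its nondegeneracy is the
  positivity of the inner product.

  An invariant inner product makes the Lie algebra of the torus orthogonal to the skew matrices that
  vanish on the three diagonal blocks, because sign changes from the torus reverse these
  (\<open>invariant_orthogonal_torus\<close>).  So the moment map reads off three matrix entries, and the moment map
  equation is the invariance of the inner product once more.

  The image \<open>K\<close> of the moment map is a polytope by the argument of Schur, Horn and Kostant.  A linear
  functional given by a regular element \<open>\<xi>\<close> of the torus algebra attains its maximum over \<open>M\<close> at a
  point that commutes with \<open>\<xi>\<close>; this point lies in the torus algebra, and it is dominant when \<open>\<xi>\<close> is
  (\<open>maximum_dominant\<close>).  There is only one dominant point \<open>l\<close> of \<open>M\<close> in the torus algebra: the norms of
  \<open>F\<close> and \<open>F\<^sup>2\<close> and the Pfaffian are invariants, and they determine it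
  (\<open>dominant_torus_element_unique\<close>).  This confines \<open>K\<close> to the polytope cut out by the Weyl group images
  of three inequalities (\<open>moment_image_subset\<close>).  Conversely, conjugation with the rotations attached to
  a simple root moves a point of \<open>K\<close> continuously along the segment to its mirror image, so \<open>K\<close> contains
  these segments (\<open>moment_image_segments\<close>), and minimising the norm among the points of \<open>K\<close> that dominate
  a given dominant point shows that it belongs to \<open>K\<close> (\<open>dominant_descent\<close>).
\<close>

section \<open>Calculus of repeatedly differentiable maps\<close>

lemma C_k_SucI:
  assumes "\<And>x. x \<in> U \<Longrightarrow> (f has_derivative f' x) (at x)" "\<And>v. C_k k U (\<lambda>x. f' x v)"
  shows "C_k (Suc k) U f"
  using assms by auto

lemma C_k_SucE:
  assumes "C_k (Suc k) U f"
  obtains f' where "\<And>x. x \<in> U \<Longrightarrow> (f has_derivative f' x) (at x)" "\<And>v. C_k k U (\<lambda>x. f' x v)"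
  using assms by auto

lemma C_k_continuous_on:
  assumes "C_k k U f"
  shows "continuous_on U f"
proof (cases k)
  case 0
  then show ?thesis using assms by simp
next
  case (Suc m)
  then obtain f' where "\<And>x. x \<in> U \<Longrightarrow> (f has_derivative f' x) (at x)"
    using assms by auto
  then show ?thesis
    by (metis has_derivative_at_withinI has_derivative_continuous_on)
qed

lemma C_k_Suc_lower:
  assumes "C_k (Suc k) U f"
  shows "C_k k U f"
  using assms
proof (induction k arbitrary: f)
  case 0
  then show ?case using C_k_continuous_on C_k.simps(1) by blast
next
  case (Suc k)
  from Suc.prems obtain f' where f': "\<And>x. x \<in> U \<Longrightarrow> (f has_derivative f' x) (at x)"
    "\<And>v. C_k (Suc k) U (\<lambda>x. f' x v)" by (rule C_k_SucE) blast
  show ?case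
    by (rule C_k_SucI[of U f f']) (use f' Suc.IH in auto)
qed

lemma C_k_subset:
  assumes "C_k k U f" "V \<subseteq> U"
  shows "C_k k V f"
  using assms
proof (induction k arbitrary: f)
  case 0
  then show ?case using continuous_on_subset by auto
next
  case (Suc k)
  from Suc.prems(1) obtain f' where f': "\<And>x. x \<in> U \<Longrightarrow> (f has_derivative f' x) (at x)"
    "\<And>v. C_k k U (\<lambda>x. f' x v)" by (rule C_k_SucE) blast
  show ?case
    by (rule C_k_SucI[of V f f']) (use f' Suc.IH Suc.prems(2) in auto)
qed

lemma C_k_cong:
  assumes "C_k k U f" "open U" "\<And>x. x \<in> U \<Longrightarrow> f x = g x"
  shows "C_k k U g"
proof (cases k)
  case 0
  then show ?thesis using assms by (simp cong: continuous_on_cong)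
next
  case (Suc m)
  with assms obtain f' where f': "\<And>x. x \<in> U \<Longrightarrow> (f has_derivative f' x) (at x)"
    "\<And>v. C_k m U (\<lambda>x. f' x v)" by auto
  have "(g has_derivative f' x) (at x)" if "x \<in> U" for x
    using has_derivative_transform_within_open[OF f'(1)[OF that] assms(2) that] assms(3) by auto
  then show ?thesis using f'(2) Suc by auto
qed

lemma C_k_const: "C_k k U (\<lambda>x. c)"
proof (induction k arbitrary: c)
  case (Suc k)
  show ?case by (rule C_k_SucI[of U _ "\<lambda>x v. 0"]) (use Suc in auto)
qed auto

lemma C_k_bounded_linear:
  assumes "bounded_linear L" "C_k k U f"
  shows "C_k k U (\<lambda>x. L (f x))"
  using assms(2)
proof (induction k arbitrary: f)
  case 0
  then show ?case using assms(1) by (simp add: bounded_linear.continuous_on)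
next
  case (Suc k)
  from Suc.prems obtain f' where f': "\<And>x. x \<in> U \<Longrightarrow> (f has_derivative f' x) (at x)"
    "\<And>v. C_k k U (\<lambda>x. f' x v)" by (rule C_k_SucE) blast
  show ?case
    by (rule C_k_SucI[of U _ "\<lambda>x v. L (f' x v)"])
      (auto intro: f' Suc.IH bounded_linear.has_derivative[OF assms(1)])
qed

lemma C_k_id: "C_k k U (\<lambda>x. x)"
proof (cases k)
  case (Suc m)
  then show ?thesis
    using C_k_SucI[of U "\<lambda>x. x" "\<lambda>x v. v" m] C_k_const by auto
qed auto

lemma C_k_add:
  assumes "C_k k U f" "C_k k U g"
  shows "C_k k U (\<lambda>x. f x + g x)"
  using assms
proof (induction k arbitrary: f g)
  case 0
  then show ?case by (simp add: continuous_on_add)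
next
  case (Suc k)
  from Suc.prems(1) obtain f' where f': "\<And>x. x \<in> U \<Longrightarrow> (f has_derivative f' x) (at x)"
    "\<And>v. C_k k U (\<lambda>x. f' x v)" by (rule C_k_SucE) blast
  from Suc.prems(2) obtain g' where g': "\<And>x. x \<in> U \<Longrightarrow> (g has_derivative g' x) (at x)"
    "\<And>v. C_k k U (\<lambda>x. g' x v)" by (rule C_k_SucE) blast
  show ?case
    by (rule C_k_SucI[of U _ "\<lambda>x v. f' x v + g' x v"])
      (use f' g' Suc.IH in \<open>auto intro: has_derivative_add\<close>)
qed

lemma C_k_sum:
  assumes "\<And>i. i \<in> I \<Longrightarrow> C_k k U (f i)"
  shows "C_k k U (\<lambda>x. \<Sum>i\<in>I. f i x)"
  using assms
  by (induction I rule: infinite_finite_induct) (auto simp: C_k_const C_k_add)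

lemma C_k_bilinear:
  assumes "bounded_bilinear h" "C_k k U f" "C_k k U g"
  shows "C_k k U (\<lambda>x. h (f x) (g x))"
  using assms(2,3)
proof (induction k arbitrary: f g)
  case 0
  then show ?case using assms(1) by (simp add: bounded_bilinear.continuous_on)
next
  case (Suc k)
  from Suc.prems(1) obtain f' where f': "\<And>x. x \<in> U \<Longrightarrow> (f has_derivative f' x) (at x)"
    "\<And>v. C_k k U (\<lambda>x. f' x v)" by (rule C_k_SucE) blast
  from Suc.prems(2) obtain g' where g': "\<And>x. x \<in> U \<Longrightarrow> (g has_derivative g' x) (at x)"
    "\<And>v. C_k k U (\<lambda>x. g' x v)" by (rule C_k_SucE) blast
  have lower: "C_k k U f" "C_k k U g" using Suc.prems C_k_Suc_lower by auto
  show ?case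
    by (rule C_k_SucI[of U _ "\<lambda>x v. h (f x) (g' x v) + h (f' x v) (g x)"])
      (auto intro!: C_k_add intro: f' g' lower Suc.IH bounded_bilinear.FDERIV[OF assms(1)])
qed

lemmas C_k_scaleR = C_k_bilinear[OF bounded_bilinear_scaleR]
lemmas C_k_inner = C_k_bilinear[OF bounded_bilinear_inner]

lemma C_k_compose:
  fixes g :: "'a::euclidean_space \<Rightarrow> 'b::euclidean_space"
  assumes "C_k k V f" "C_k k U g" "g ` U \<subseteq> V"
  shows "C_k k U (\<lambda>x. f (g x))"
  using assms
proof (induction k arbitrary: f g)
  case 0
  then show ?case using continuous_on_compose2 by auto
next
  case (Suc k)
  from Suc.prems(1) obtain f' where f': "\<And>x. x \<in> V \<Longrightarrow> (f has_derivative f' x) (at x)"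
    "\<And>v. C_k k V (\<lambda>x. f' x v)" by (rule C_k_SucE) blast
  from Suc.prems(2) obtain g' where g': "\<And>x. x \<in> U \<Longrightarrow> (g has_derivative g' x) (at x)"
    "\<And>v. C_k k U (\<lambda>x. g' x v)" by (rule C_k_SucE) blast
  have lower: "C_k k U g" by (rule C_k_Suc_lower) (rule Suc.prems)
  show ?case
  proof (rule C_k_SucI[of U _ "\<lambda>x v. \<Sum>b\<in>Basis. (g' x v \<bullet> b) *\<^sub>R f' (g x) b"])
    fix x assume x: "x \<in> U"
    then have gx: "g x \<in> V" using Suc.prems by auto
    have rep: "f' (g x) w = (\<Sum>b\<in>Basis. (w \<bullet> b) *\<^sub>R f' (g x) b)" for w
    proof -
      have lin: "linear (f' (g x))" using f'(1)[OF gx] has_derivative_linear by blast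
      show ?thesis
        by (subst euclidean_representation[of w, symmetric])
          (simp add: linear_sum[OF lin] linear_cmul[OF lin])
    qed
    show "((\<lambda>x. f (g x)) has_derivative
        (\<lambda>v. \<Sum>b\<in>Basis. (g' x v \<bullet> b) *\<^sub>R f' (g x) b)) (at x)"
      unfolding rep[symmetric] using diff_chain_at[OF g'(1)[OF x] f'(1)[OF gx]] by (simp add: o_def)
  next
    fix v
    have "C_k k U (\<lambda>x. f' (g x) b)" for b
      by (rule Suc.IH[OF f'(2) lower Suc.prems(3)])
    then show "C_k k U (\<lambda>x. \<Sum>b\<in>Basis. (g' x v \<bullet> b) *\<^sub>R f' (g x) b)"
      by (intro C_k_sum C_k_scaleR C_k_inner C_k_const g')
  qed
qed

lemma C_k_apply_linear:
  assumes "\<And>x. x \<in> U \<Longrightarrow> linear (J x)" "\<And>v. C_k k U (\<lambda>x. J x v)" "C_k k U u" "open U"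
  shows "C_k k U (\<lambda>x. J x (u x :: 'b::euclidean_space))"
proof -
  have "C_k k U (\<lambda>x. \<Sum>b\<in>Basis. (u x \<bullet> b) *\<^sub>R J x b)"
    by (intro C_k_sum C_k_scaleR C_k_inner C_k_const assms)
  moreover have "(\<Sum>b\<in>Basis. (u x \<bullet> b) *\<^sub>R J x b) = J x (u x)" if "x \<in> U" for x
    using linear_sum[OF assms(1)[OF that], of "\<lambda>b. (u x \<bullet> b) *\<^sub>R b" Basis]
    by (simp add: linear_cmul[OF assms(1)[OF that]] euclidean_representation)
  ultimately show ?thesis using C_k_cong[OF _ assms(4), of k _ "\<lambda>x. J x (u x)"] by presburger
qed

text \<open>
  A linear map is determined by its values on a basis, so differentiability of \<open>J\<close> at each fixed vector
  already gives the joint derivative in the point and the vector.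
\<close>

lemma linear_apply_has_derivative:
  fixes J :: "'a::euclidean_space \<Rightarrow> 'b::euclidean_space \<Rightarrow> 'c::real_normed_vector"
  assumes lin: "\<And>x. x \<in> U \<Longrightarrow> linear (J x)" and "open U" "x \<in> U"
    and der: "\<And>v. ((\<lambda>x. J x v) has_derivative (\<lambda>h. J' h v)) (at x)"
  shows "((\<lambda>p. J (fst p) (snd p)) has_derivative (\<lambda>(h, k). J' h u + J x k)) (at (x, u))"
proof -
  have rep: "J y w = (\<Sum>b\<in>Basis. (w \<bullet> b) *\<^sub>R J y b)" if "y \<in> U" for y w
    using linear_sum[OF lin[OF that], of "\<lambda>b. (w \<bullet> b) *\<^sub>R b" Basis]
    by (simp add: linear_cmul[OF lin[OF that]] euclidean_representation)
  have D: "((\<lambda>y. \<Sum>b\<in>Basis. (w \<bullet> b) *\<^sub>R J y b) has_derivative (\<lambda>h. \<Sum>b\<in>Basis. (w \<bullet> b) *\<^sub>R J' h b)) (at x)" for w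
    by (rule has_derivative_sum) (rule has_derivative_scaleR_right[OF der])
  have rep': "J' h w = (\<Sum>b\<in>Basis. (w \<bullet> b) *\<^sub>R J' h b)" for h w
  proof -
    have "((\<lambda>y. J y w) has_derivative (\<lambda>h. \<Sum>b\<in>Basis. (w \<bullet> b) *\<^sub>R J' h b)) (at x)"
      using has_derivative_transform_within_open[OF D \<open>open U\<close> \<open>x \<in> U\<close>, of w "\<lambda>y. J y w"] rep by simp
    from has_derivative_unique[OF this der] show ?thesis by metis
  qed
  have fstD: "((\<lambda>p. J (fst p) b) has_derivative (\<lambda>p. J' (fst p) b)) (at (x,u))" for b
    using diff_chain_at[of fst fst "(x, u)" "\<lambda>y. J y b" "\<lambda>h. J' h b"] der[of b]
      has_derivative_fst[OF has_derivative_ident, of "at (x, u)"] by (simp add: o_def)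
  have "((\<lambda>p. \<Sum>b\<in>Basis. (snd p \<bullet> b) *\<^sub>R J (fst p) b) has_derivative
     (\<lambda>p. \<Sum>b\<in>Basis. (u \<bullet> b) *\<^sub>R J' (fst p) b + (snd p \<bullet> b) *\<^sub>R J x b)) (at (x, u))"
    by (rule has_derivative_sum) (auto intro!: derivative_eq_intros fstD)
  moreover have "(\<Sum>b\<in>Basis. (u \<bullet> b) *\<^sub>R J' (fst p) b + (snd p \<bullet> b) *\<^sub>R J x b) = (\<lambda>(h, k). J' h u + J x k) p" for p
    using rep[OF \<open>x \<in> U\<close>, of "snd p"] rep'[of "fst p" u] by (simp add: sum.distrib case_prod_beta)
  ultimately have "((\<lambda>p. \<Sum>b\<in>Basis. (snd p \<bullet> b) *\<^sub>R J (fst p) b) has_derivative (\<lambda>(h, k). J' h u + J x k)) (at (x, u))"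
    by simp
  moreover have "open (U \<times> (UNIV::'b set))" using \<open>open U\<close> by (simp add: open_Times)
  ultimately show ?thesis
    by (rule has_derivative_transform_within_open) (use \<open>x \<in> U\<close> rep[symmetric] in auto)
qed

lemma linear_two_sided_inverse:
  assumes "linear f" "\<And>x. g (f x) = x" "\<And>y. f (g y) = y"
  shows "linear g"
proof (rule linearI)
  fix a b c
  show "g (a + b) = g a + g b"
    using linear_add[OF assms(1), of "g a" "g b"] assms(2,3) by metis
  show "g (c *\<^sub>R a) = c *\<^sub>R g a"
    using linear_cmul[OF assms(1), of c "g a"] assms(2,3) by metis
qed

text \<open>
  The map \<open>(x, u) \<mapsto> (x, J x u)\<close> has the inverse \<open>(x, w) \<mapsto> (x, K x w)\<close>.  Differentiating this single
  inverse map replaces all estimates on operator norms.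
\<close>

lemma inverse_operator_has_derivative:
  fixes J K :: "'a::euclidean_space \<Rightarrow> 'b::euclidean_space \<Rightarrow> 'b"
  assumes lin: "\<And>x. x \<in> U \<Longrightarrow> linear (J x)" and U: "open U" "x \<in> U"
    and inv: "\<And>x w. x \<in> U \<Longrightarrow> K x (J x w) = w" "\<And>x w. x \<in> U \<Longrightarrow> J x (K x w) = w"
    and der: "\<And>x v. x \<in> U \<Longrightarrow> ((\<lambda>x. J x v) has_derivative (\<lambda>h. J' x h v)) (at x)"
  shows "((\<lambda>x. K x w) has_derivative (\<lambda>h. - K x (J' x h (K x w)))) (at x)"
proof -
  let ?f = "\<lambda>p. (fst p, J (fst p) (snd p))"
  let ?g = "\<lambda>p. (fst p, K (fst p) (snd p))"
  let ?u = "K x w"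
  have d: "((\<lambda>p. J (fst p) (snd p)) has_derivative (\<lambda>(h, k). J' y h u + J y k)) (at (y, u))" if "y \<in> U" for y u
    using linear_apply_has_derivative[OF lin U(1) that der[OF that]] .
  have df: "(?f has_derivative (\<lambda>p. (fst p, J' y (fst p) u + J y (snd p)))) (at (y, u))" if "y \<in> U" for y u
    using has_derivative_Pair[OF has_derivative_fst[OF has_derivative_ident] d[OF that]]
    by (simp add: case_prod_beta)
  have linK: "linear (K x)"
    by (rule linear_two_sided_inverse[OF lin[OF U(2)]]) (use inv U in auto)
  have "(?g has_derivative (\<lambda>p. (fst p, K x (snd p - J' x (fst p) ?u)))) (at (?f (x, ?u)))"
  proof (rule has_derivative_inverse_strong[of "U \<times> UNIV" _ ?f])
    show "open (U \<times> (UNIV :: 'b set))" using U by (simp add: open_Times)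
    show "continuous_on (U \<times> UNIV) ?f"
    proof (rule has_derivative_continuous_on)
      fix p assume "p \<in> U \<times> (UNIV :: 'b set)"
      then show "(?f has_derivative (\<lambda>q. (fst q, J' (fst p) (fst q) (snd p) + J (fst p) (snd q)))) (at p within U \<times> UNIV)"
        using df[of "fst p" "snd p"] by (auto intro: has_derivative_at_withinI)
    qed
    show "(?f has_derivative (\<lambda>p. (fst p, J' x (fst p) ?u + J x (snd p)))) (at (x, ?u))"
      by (rule df[OF U(2)])
    show "(\<lambda>p. (fst p, J' x (fst p) ?u + J x (snd p))) \<circ> (\<lambda>p. (fst p, K x (snd p - J' x (fst p) ?u))) = id"
      using inv U by (auto simp: fun_eq_iff)
  qed (use U inv in auto)
  then have "((\<lambda>p. K (fst p) (snd p)) has_derivative (\<lambda>p. K x (snd p - J' x (fst p) ?u))) (at (x, w))"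
    using inv U by (auto dest: has_derivative_snd)
  then have "((\<lambda>p. K (fst p) (snd p)) \<circ> (\<lambda>y. (y, w)) has_derivative
      (\<lambda>p. K x (snd p - J' x (fst p) ?u)) \<circ> (\<lambda>h. (h, 0))) (at x)"
    by (intro diff_chain_at has_derivative_Pair has_derivative_ident has_derivative_const)
  then show ?thesis by (simp add: o_def linear_neg[OF linK])
qed

text \<open>
  The derivative of \<open>K\<close> is expressed by \<open>K\<close> itself and the derivative of \<open>J\<close>, so each degree of
  regularity of \<open>K\<close> yields the next one.
\<close>

lemma C_k_inverse_operator:
  fixes J K :: "'a::euclidean_space \<Rightarrow> 'b::euclidean_space \<Rightarrow> 'b"
  assumes lin: "\<And>x. x \<in> U \<Longrightarrow> linear (J x)" and U: "open U"
    and inv: "\<And>x w. x \<in> U \<Longrightarrow> K x (J x w) = w" "\<And>x w. x \<in> U \<Longrightarrow> J x (K x w) = w"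
    and sm: "\<And>v k. C_k k U (\<lambda>x. J x v)"
  shows "C_k k U (\<lambda>x. K x w)"
proof -
  have "\<exists>J'. \<forall>x\<in>U. ((\<lambda>x. J x v) has_derivative J' x) (at x)" for v
    using sm[of "Suc 0" v] by auto
  then obtain J0 where J0: "\<And>x v. x \<in> U \<Longrightarrow> ((\<lambda>x. J x v) has_derivative J0 v x) (at x)" by metis
  define J' where "J' x h v = J0 v x h" for x h v
  have J': "((\<lambda>x. J x v) has_derivative (\<lambda>h. J' x h v)) (at x)" if "x \<in> U" for x v
    using J0[OF that] by (simp add: J'_def eta_contract_eq)
  have smJ': "C_k k U (\<lambda>x. J' x h v)" for k h v
  proof -
    obtain f' where f': "\<And>x. x \<in> U \<Longrightarrow> ((\<lambda>x. J x v) has_derivative f' x) (at x)"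
      "\<And>h. C_k k U (\<lambda>x. f' x h)"
      using C_k_SucE[OF sm[of "Suc k" v]] by blast
    have eq: "f' x h = J' x h v" if "x \<in> U" for x
      using has_derivative_unique[OF f'(1)[OF that] J'[OF that]] by metis
    show ?thesis by (rule C_k_cong[OF f'(2)[of h] U eq])
  qed
  have linK: "linear (K x)" if "x \<in> U" for x
    by (rule linear_two_sided_inverse[OF lin[OF that]]) (use inv that in auto)
  have linJ': "linear (J' x h)" if x: "x \<in> U" for x h
  proof (rule linearI)
    fix a b c
    have "((\<lambda>x. J x (a + b)) has_derivative (\<lambda>h. J' x h a + J' x h b)) (at x)"
      by (rule has_derivative_transform_within_open[OF has_derivative_add[OF J'[OF x] J'[OF x]] U x])
         (use linear_add[OF lin, of _ a b] in auto)
    from has_derivative_unique[OF this J'[OF x]] show "J' x h (a + b) = J' x h a + J' x h b" by metis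
    have "((\<lambda>x. J x (c *\<^sub>R a)) has_derivative (\<lambda>h. c *\<^sub>R J' x h a)) (at x)"
      by (rule has_derivative_transform_within_open[OF has_derivative_scaleR_right[OF J'[OF x]] U x])
         (use linear_cmul[OF lin, of _ c a] in auto)
    from has_derivative_unique[OF this J'[OF x]] show "J' x h (c *\<^sub>R a) = c *\<^sub>R J' x h a" by metis
  qed
  have der: "((\<lambda>x. K x w) has_derivative (\<lambda>h. - K x (J' x h (K x w)))) (at x)" if "x \<in> U" for x w
    by (rule inverse_operator_has_derivative[OF lin U that inv J'])
  show ?thesis
  proof (induction k arbitrary: w)
    case 0
    show ?case unfolding C_k.simps
      by (rule has_derivative_continuous_on) (rule has_derivative_at_withinI[OF der])
  next
    case (Suc k)
    show ?case
    proof (rule C_k_SucI)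
      show "((\<lambda>x. K x w) has_derivative (\<lambda>h. - K x (J' x h (K x w)))) (at x)" if "x \<in> U" for x
        by (rule der[OF that])
      fix h
      have J'K: "C_k k U (\<lambda>x. J' x h (K x w))"
        by (rule C_k_apply_linear[where J = "\<lambda>x. J' x h", OF linJ' smJ' Suc U])
      have "C_k k U (\<lambda>x. K x (J' x h (K x w)))"
        by (rule C_k_apply_linear[where J = K, OF linK Suc J'K U])
      then show "C_k k U (\<lambda>x. - K x (J' x h (K x w)))"
        by (rule C_k_bounded_linear[OF bounded_linear_minus[OF bounded_linear_ident]])
    qed
  qed
qed

lemma smooth_on_C_k: "smooth_on U f \<Longrightarrow> C_k k U f"
  by (simp add: smooth_on_def)

lemma smooth_on_open: "smooth_on U f \<Longrightarrow> open U"
  by (simp add: smooth_on_def)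

lemma smooth_on_const: "open U \<Longrightarrow> smooth_on U (\<lambda>x. c)"
  by (simp add: smooth_on_def C_k_const)

lemma smooth_on_id: "open U \<Longrightarrow> smooth_on U (\<lambda>x. x)"
  by (simp add: smooth_on_def C_k_id)

lemma smooth_on_bounded_linear:
  "bounded_linear L \<Longrightarrow> smooth_on U f \<Longrightarrow> smooth_on U (\<lambda>x. L (f x))"
  by (simp add: smooth_on_def C_k_bounded_linear)

lemma smooth_on_add: "smooth_on U f \<Longrightarrow> smooth_on U g \<Longrightarrow> smooth_on U (\<lambda>x. f x + g x)"
  by (simp add: smooth_on_def C_k_add)

lemma smooth_on_bilinear:
  "bounded_bilinear h \<Longrightarrow> smooth_on U f \<Longrightarrow> smooth_on U g \<Longrightarrow> smooth_on U (\<lambda>x. h (f x) (g x))"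
  by (simp add: smooth_on_def C_k_bilinear)

lemma smooth_on_subset: "smooth_on U f \<Longrightarrow> open V \<Longrightarrow> V \<subseteq> U \<Longrightarrow> smooth_on V f"
  using C_k_subset unfolding smooth_on_def by blast

lemma smooth_on_cong:
  assumes "smooth_on U f" "\<And>x. x \<in> U \<Longrightarrow> f x = g x"
  shows "smooth_on U g"
  using assms C_k_cong[of _ U f g] unfolding smooth_on_def by blast

lemma smooth_on_has_derivative:
  assumes "smooth_on U f" "x \<in> U"
  shows "(f has_derivative frechet_derivative f (at x)) (at x)"
proof -
  have "f differentiable (at x)"
    using smooth_on_C_k[OF assms(1), of 1] assms(2) by (auto simp: differentiable_def)
  then show ?thesis by (simp add: frechet_derivative_works)
qed

lemma smooth_on_frechet_derivative:
  assumes "smooth_on U f"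
  shows "smooth_on U (\<lambda>x. frechet_derivative f (at x) v)"
  unfolding smooth_on_def
proof safe
  show U: "open U" using assms by (rule smooth_on_open)
  fix k
  obtain f' where f': "\<And>x. x \<in> U \<Longrightarrow> (f has_derivative f' x) (at x)" "\<And>v. C_k k U (\<lambda>x. f' x v)"
    using C_k_SucE[OF smooth_on_C_k[OF assms, of "Suc k"]] by blast
  have "f' x v = frechet_derivative f (at x) v" if "x \<in> U" for x
    using has_derivative_unique[OF f'(1)[OF that] smooth_on_has_derivative[OF assms that]] by metis
  then show "C_k k U (\<lambda>x. frechet_derivative f (at x) v)"
    by (rule C_k_cong[OF f'(2)[of v] U])
qed

text \<open>
  The derivative of the local inverse \<open>g\<close> at \<open>y\<close> is the inverse of the derivative of \<open>f\<close> at \<open>g y\<close>;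
  regularity of \<open>g\<close> therefore improves itself, by regularity of inverse operators.
\<close>

theorem smooth_inverse_function:
  fixes f :: "'a::euclidean_space \<Rightarrow> 'a"
  assumes f: "smooth_on W f" and x0: "x0 \<in> W"
    and f0: "(f has_derivative f0) (at x0)" "inj f0"
  obtains U V g where "open U" "x0 \<in> U" "U \<subseteq> W" "smooth_on U f" "smooth_on V g" "homeomorphism U V f g"
proof -
  let ?D = "\<lambda>x. frechet_derivative f (at x)"
  have W: "open W" using f by (rule smooth_on_open)
  have D: "(f has_derivative ?D x) (at x)" if "x \<in> W" for x
    by (rule smooth_on_has_derivative[OF f that])
  define f' where "f' x = Blinfun (?D x)" for x
  have f': "blinfun_apply (f' x) = ?D x" if "x \<in> W" for x
    unfolding f'_def by (rule bounded_linear_Blinfun_apply) (rule has_derivative_bounded_linear[OF D[OF that]])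
  have contf': "continuous_on W f'"
  proof (rule continuous_on_blinfun_componentwise)
    fix i :: 'a
    show "continuous_on W (\<lambda>x. blinfun_apply (f' x) i)"
      using smooth_on_frechet_derivative[OF f, of i, THEN smooth_on_C_k, of 0] f'
      by (simp cong: continuous_on_cong)
  qed
  have f0_lin: "linear f0" using f0(1) has_derivative_linear by blast
  have f0_eq: "?D x0 = f0" using has_derivative_unique[OF D[OF x0] f0(1)] .
  have surj: "surj f0" using linear_injective_imp_surjective[OF f0_lin f0(2)] by simp
  obtain g0 where g0: "linear g0" "\<And>x. g0 (f0 x) = x"
    using linear_injective_left_inverse[OF f0_lin f0(2)] by (metis comp_apply id_apply)
  have "Blinfun g0 o\<^sub>L f' x0 = id_blinfun"
    by (rule blinfun_eqI)
      (simp add: f'[OF x0] f0_eq bounded_linear_Blinfun_apply linear_conv_bounded_linear[symmetric] g0)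
  then obtain U V g g' where U: "open U" "U \<subseteq> W" "x0 \<in> U" and V: "open V" and h: "homeomorphism U V f g"
    and g: "\<And>y. y \<in> V \<Longrightarrow> (g has_derivative g' y) (at y)"
    and g': "\<And>y. y \<in> V \<Longrightarrow> g' y = inv (blinfun_apply (f' (g y)))"
    and bij: "\<And>y. y \<in> V \<Longrightarrow> bij (blinfun_apply (f' (g y)))"
    using inverse_function_theorem[OF W _ contf' x0, of f "Blinfun g0"] D f' by metis
  have gU: "g y \<in> U" if "y \<in> V" for y using h that by (auto simp: homeomorphism_def)
  have bijD: "bij (?D (g y))" if "y \<in> V" for y
    using bij[OF that] f' gU[OF that] U(2) by auto
  have "C_k k V g" for k
  proof (induction k)
    case 0
    show ?case using h by (simp add: homeomorphism_def)
  next
    case (Suc k)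
    show ?case
    proof (rule C_k_SucI[OF g])
      fix w
      have bijU: "bij (?D x)" if "x \<in> U" for x
        using bijD[of "f x"] h that by (auto simp: homeomorphism_def)
      have "C_k k U (\<lambda>x. inv (?D x) w)"
      proof (rule C_k_inverse_operator[where J = ?D])
        show "linear (?D x)" if "x \<in> U" for x using D U(2) that has_derivative_linear by blast
        show "inv (?D x) (?D x w) = w" if "x \<in> U" for x w
          using bijU[OF that] by (simp add: bij_is_inj)
        show "?D x (inv (?D x) w) = w" if "x \<in> U" for x w
          using bijU[OF that] by (simp add: bij_is_surj surj_f_inv_f)
        show "C_k k U (\<lambda>x. ?D x v)" for v k
          by (rule smooth_on_C_k[OF smooth_on_subset[OF smooth_on_frechet_derivative[OF f] U(1,2)]])
      qed (rule U(1))
      then have "C_k k V (\<lambda>y. inv (?D (g y)) w)"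
        by (rule C_k_compose[OF _ Suc]) (use gU in auto)
      then show "C_k k V (\<lambda>y. g' y w)"
        by (rule C_k_cong[OF _ V]) (use g' f' gU U(2) in \<open>auto simp: subset_iff\<close>)
    qed
  qed
  then show ?thesis
    using that[OF U(1) U(3) U(2) smooth_on_subset[OF f U(1,2)] _ h] V by (auto simp: smooth_on_def)
qed

text \<open>
  The second difference on the left is symmetric in \<open>u\<close> and \<open>v\<close>, while the mean value theorem, applied
  first along \<open>u\<close> and then along \<open>v\<close>, evaluates it as a mixed derivative in this order.  Comparing the
  two orders at small scale gives the symmetry of second derivatives.
\<close>

lemma second_difference_mean_value:
  fixes f :: "'a::euclidean_space \<Rightarrow> real"
  assumes f: "\<And>y. y \<in> ball x r \<Longrightarrow> (f has_derivative A y) (at y)"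
    and A: "\<And>y. y \<in> ball x r \<Longrightarrow> ((\<lambda>z. A z u) has_derivative B y) (at y)"
    and s: "0 < s" "s * (norm u + norm v) < r"
  obtains y where "dist x y \<le> s * (norm u + norm v)"
    "f (x + s *\<^sub>R u + s *\<^sub>R v) - f (x + s *\<^sub>R u) - (f (x + s *\<^sub>R v) - f x) = s * (s * B y v)"
proof -
  have bd: "dist x (x + a *\<^sub>R u + b *\<^sub>R v) \<le> s * (norm u + norm v)" if "0 \<le> a" "a \<le> s" "0 \<le> b" "b \<le> s" for a b
  proof -
    have "dist x (x + a *\<^sub>R u + b *\<^sub>R v) = norm (a *\<^sub>R u + b *\<^sub>R v)"
      by (simp add: dist_norm norm_minus_commute algebra_simps)
    also have "\<dots> \<le> a * norm u + b * norm v"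
      using norm_triangle_ineq[of "a *\<^sub>R u" "b *\<^sub>R v"] that by simp
    also have "\<dots> \<le> s * norm u + s * norm v"
      by (intro add_mono mult_right_mono that) auto
    finally show ?thesis by (simp add: algebra_simps)
  qed
  have inb: "x + a *\<^sub>R u + b *\<^sub>R v \<in> ball x r" if "0 \<le> a" "a \<le> s" "0 \<le> b" "b \<le> s" for a b
    using bd[OF that] s(2) by simp
  have line: "((\<lambda>a. g (p + a *\<^sub>R w)) has_real_derivative G w) (at a)"
    if "(g has_derivative G) (at (p + a *\<^sub>R w))" for g G and p w :: 'a and a
  proof -
    have "((\<lambda>a. p + a *\<^sub>R w) has_vector_derivative w) (at a)"
      by (auto intro!: derivative_eq_intros)
    then have "(g \<circ> (\<lambda>a. p + a *\<^sub>R w) has_derivative G \<circ> (\<lambda>h. h *\<^sub>R w)) (at a)"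
      unfolding has_vector_derivative_def by (rule diff_chain_at) (rule that)
    moreover have "G (h *\<^sub>R w) = G w * h" for h
      using linear_cmul[OF has_derivative_linear[OF that], of h w] by simp
    ultimately show ?thesis by (simp add: o_def has_field_derivative_def)
  qed
  define h where "h a = f (x + a *\<^sub>R u + s *\<^sub>R v) - f (x + a *\<^sub>R u)" for a
  have hd: "(h has_real_derivative A (x + a *\<^sub>R u + s *\<^sub>R v) u - A (x + a *\<^sub>R u) u) (at a)" if "0 \<le> a" "a \<le> s" for a
  proof -
    have 1: "x + s *\<^sub>R v + a *\<^sub>R u \<in> ball x r" using inb[OF that, of s] s by (simp add: algebra_simps)
    have 2: "x + a *\<^sub>R u \<in> ball x r" using inb[OF that, of 0] s by simp
    show ?thesis unfolding h_def
      using DERIV_diff[OF line[OF f[OF 1]] line[OF f[OF 2]]] by (simp add: algebra_simps)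
  qed
  then obtain a where a: "0 < a" "a < s" and
    h: "h s - h 0 = s * (A (x + a *\<^sub>R u + s *\<^sub>R v) u - A (x + a *\<^sub>R u) u)"
    using MVT2[OF s(1) hd] by auto
  have Ad: "((\<lambda>b. A (x + a *\<^sub>R u + b *\<^sub>R v) u) has_real_derivative B (x + a *\<^sub>R u + b *\<^sub>R v) v) (at b)"
    if "0 \<le> b" "b \<le> s" for b
    by (rule line[OF A[OF inb]]) (use that a in auto)
  then obtain b where b: "0 < b" "b < s" and
    "A (x + a *\<^sub>R u + s *\<^sub>R v) u - A (x + a *\<^sub>R u + 0 *\<^sub>R v) u = s * B (x + a *\<^sub>R u + b *\<^sub>R v) v"
    using MVT2[OF s(1) Ad] by auto
  then show ?thesis
    using that[OF bd[of a b]] a b h by (auto simp: h_def)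
qed

lemma second_derivative_symmetric_real:
  fixes f :: "'a::euclidean_space \<Rightarrow> real"
  assumes f: "smooth_on U f" and x: "x \<in> U"
  shows "frechet_derivative (\<lambda>y. frechet_derivative f (at y) v) (at x) u =
    frechet_derivative (\<lambda>y. frechet_derivative f (at y) u) (at x) v"
proof -
  define D2 where "D2 u v y = frechet_derivative (\<lambda>y. frechet_derivative f (at y) u) (at y) v" for u v y
  have U: "open U" using f by (rule smooth_on_open)
  have cont: "continuous_on U (D2 u v)" for u v
    unfolding D2_def
    using smooth_on_frechet_derivative[OF smooth_on_frechet_derivative[OF f], THEN smooth_on_C_k, of 0]
    by simp
  have "\<bar>D2 u v x - D2 v u x\<bar> \<le> 0 + e" if "e > 0" for e
  proof -
    have "\<exists>d>0. \<forall>y. dist x y < d \<longrightarrow> y \<in> U \<and> \<bar>D2 u v y - D2 u v x\<bar> < e / 2" for u v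
    proof -
      obtain d1 where d1: "d1 > 0" "ball x d1 \<subseteq> U" using U x openE by blast
      obtain d2 where d2: "d2 > 0" "\<And>y. y \<in> U \<Longrightarrow> dist y x < d2 \<Longrightarrow> dist (D2 u v y) (D2 u v x) < e / 2"
        using continuous_onE[OF cont x, of "e / 2"] \<open>e > 0\<close>
        by (metis half_gt_zero cont continuous_on_iff x)
      show ?thesis
        by (rule exI[of _ "min d1 d2"]) (use d1 d2 in \<open>auto simp: dist_commute dist_real_def subset_iff\<close>)
    qed
    then obtain d1 d2 where d: "d1 > 0" "d2 > 0" "\<And>y. dist x y < d1 \<Longrightarrow> y \<in> U \<and> \<bar>D2 u v y - D2 u v x\<bar> < e / 2"
      "\<And>y. dist x y < d2 \<Longrightarrow> y \<in> U \<and> \<bar>D2 v u y - D2 v u x\<bar> < e / 2" by metis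
    define r where "r = min d1 d2"
    \<comment> \<open>The summand 1 keeps the denominator positive when \<open>u\<close> and \<open>v\<close> vanish.\<close>
    define s where "s = r / (2 * (norm u + norm v + 1))"
    have n: "norm u + norm v + 1 > 0" using norm_ge_zero[of u] norm_ge_zero[of v] by linarith
    have r: "r > 0" using d by (simp add: r_def)
    have s: "s > 0" using r n by (simp add: s_def)
    have "s * (norm u + norm v) \<le> s * (norm u + norm v + 1)" using s by simp
    also have "\<dots> = r / 2" using n by (simp add: s_def field_simps)
    finally have sr: "s * (norm u + norm v) < r" using r by simp
    have ball: "y \<in> U" if "y \<in> ball x r" for y using that d(3)[of y] by (simp add: r_def)
    obtain y where y: "dist x y \<le> s * (norm u + norm v)"
      "f (x + s *\<^sub>R u + s *\<^sub>R v) - f (x + s *\<^sub>R u) - (f (x + s *\<^sub>R v) - f x) = s * (s * D2 u v y)"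
      unfolding D2_def
      by (rule second_difference_mean_value[OF smooth_on_has_derivative[OF f ball]
            smooth_on_has_derivative[OF smooth_on_frechet_derivative[OF f] ball] s sr]) auto
    have sr': "s * (norm v + norm u) < r" using sr by (simp add: add.commute)
    obtain z where z: "dist x z \<le> s * (norm v + norm u)"
      "f (x + s *\<^sub>R v + s *\<^sub>R u) - f (x + s *\<^sub>R v) - (f (x + s *\<^sub>R u) - f x) = s * (s * D2 v u z)"
      unfolding D2_def
      by (rule second_difference_mean_value[OF smooth_on_has_derivative[OF f ball]
            smooth_on_has_derivative[OF smooth_on_frechet_derivative[OF f] ball] s sr']) auto
    have "x + s *\<^sub>R v + s *\<^sub>R u = x + s *\<^sub>R u + s *\<^sub>R v" by simp
    from y(2) z(2)[unfolded this] have "s * (s * D2 u v y) = s * (s * D2 v u z)" by linarith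
    then have "D2 u v y = D2 v u z" using s by simp
    moreover have "\<bar>D2 u v y - D2 u v x\<bar> < e / 2" "\<bar>D2 v u z - D2 v u x\<bar> < e / 2"
      using d y(1) z(1) sr sr' by (auto simp: r_def)
    ultimately show ?thesis by linarith
  qed
  then have "\<bar>D2 u v x - D2 v u x\<bar> \<le> 0" by (rule field_le_epsilon)
  then show ?thesis by (simp add: D2_def)
qed

theorem second_derivative_symmetric:
  fixes f :: "'a::euclidean_space \<Rightarrow> 'b::euclidean_space"
  assumes f: "smooth_on U f" and x: "x \<in> U"
  shows "frechet_derivative (\<lambda>y. frechet_derivative f (at y) v) (at x) u =
    frechet_derivative (\<lambda>y. frechet_derivative f (at y) u) (at x) v"
proof (rule euclidean_eqI)
  fix b :: 'b
  have inner: "frechet_derivative (\<lambda>y. g y \<bullet> b) (at y) w = frechet_derivative g (at y) w \<bullet> b"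
    if "smooth_on U g" "y \<in> U" for g :: "'a \<Rightarrow> 'b" and y w
    using frechet_derivative_at[OF has_derivative_inner_left[OF smooth_on_has_derivative[OF that]]] by metis
  have fb: "smooth_on U (\<lambda>y. f y \<bullet> b)"
    by (rule smooth_on_bounded_linear[OF bounded_linear_inner_left f])
  have "frechet_derivative (\<lambda>y. frechet_derivative f (at y) w) (at x) w' \<bullet> b =
      frechet_derivative (\<lambda>y. frechet_derivative (\<lambda>y. f y \<bullet> b) (at y) w) (at x) w'" for w w'
  proof -
    have D: "((\<lambda>y. frechet_derivative f (at y) w \<bullet> b) has_derivative
        (\<lambda>h. frechet_derivative (\<lambda>y. frechet_derivative f (at y) w) (at x) h \<bullet> b)) (at x)"
      by (rule has_derivative_inner_left[OF smooth_on_has_derivative[OF smooth_on_frechet_derivative[OF f] x]])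
    have "((\<lambda>y. frechet_derivative (\<lambda>y. f y \<bullet> b) (at y) w) has_derivative
        (\<lambda>h. frechet_derivative (\<lambda>y. frechet_derivative f (at y) w) (at x) h \<bullet> b)) (at x)"
      by (rule has_derivative_transform_within_open[OF D smooth_on_open[OF f] x])
        (use inner[OF f] in auto)
    from frechet_derivative_at[OF this] show ?thesis by metis
  qed
  then show "frechet_derivative (\<lambda>y. frechet_derivative f (at y) v) (at x) u \<bullet> b =
    frechet_derivative (\<lambda>y. frechet_derivative f (at y) u) (at x) v \<bullet> b"
    using second_derivative_symmetric_real[OF fb x] by simp
qed

section \<open>Matrix multiplication and the Frobenius inner product\<close>

lemma bounded_bilinear_matrix_mul: "bounded_bilinear ((**) :: real^'n^'m \<Rightarrow> real^'k^'n \<Rightarrow> real^'k^'m)"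
proof -
  have "bilinear ((**) :: real^'n^'m \<Rightarrow> real^'k^'n \<Rightarrow> real^'k^'m)"
    unfolding bilinear_def
    by (auto intro!: linearI simp: matrix_matrix_mult_def vec_eq_iff sum_distrib_left algebra_simps sum.distrib)
  then show ?thesis by (simp add: bilinear_conv_bounded_bilinear)
qed

interpretation matrix_mul: bounded_bilinear "(**) :: real^'n^'m \<Rightarrow> real^'k^'n \<Rightarrow> real^'k^'m"
  by (rule bounded_bilinear_matrix_mul)

lemma bounded_linear_transpose: "bounded_linear (transpose :: real^'n^'m \<Rightarrow> real^'m^'n)"
  by (auto simp: linear_conv_bounded_linear[symmetric] transpose_def vec_eq_iff intro!: linearI)

lemmas transpose_has_vector_derivative = bounded_linear.has_vector_derivative[OF bounded_linear_transpose]

lemma matrix_inner: "(A :: real^'n^'m) \<bullet> B = (\<Sum>i\<in>UNIV. \<Sum>j\<in>UNIV. A $ i $ j * B $ i $ j)"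
  by (simp add: inner_vec_def)

lemma inner_transpose: "transpose A \<bullet> transpose B = (A :: real^'n^'m) \<bullet> B"
  unfolding matrix_inner transpose_def by simp (rule sum.swap)

lemma inner_matrix_mul_left: "(A ** B) \<bullet> C = (B :: real^'k^'n) \<bullet> (transpose A ** C)"
proof -
  have "(A ** B) \<bullet> C = (\<Sum>i\<in>UNIV. \<Sum>j\<in>UNIV. \<Sum>k\<in>UNIV. A $ i $ k * B $ k $ j * C $ i $ j)"
    by (simp add: matrix_inner matrix_matrix_mult_def sum_distrib_right)
  also have "\<dots> = (\<Sum>j\<in>UNIV. \<Sum>i\<in>UNIV. \<Sum>k\<in>UNIV. A $ i $ k * B $ k $ j * C $ i $ j)"
    by (rule sum.swap)
  also have "\<dots> = (\<Sum>j\<in>UNIV. \<Sum>k\<in>UNIV. \<Sum>i\<in>UNIV. A $ i $ k * B $ k $ j * C $ i $ j)"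
    by (rule sum.cong[OF refl], rule sum.swap)
  also have "\<dots> = (\<Sum>k\<in>UNIV. \<Sum>j\<in>UNIV. \<Sum>i\<in>UNIV. A $ i $ k * B $ k $ j * C $ i $ j)"
    by (rule sum.swap)
  also have "\<dots> = B \<bullet> (transpose A ** C)"
    by (simp add: matrix_inner matrix_matrix_mult_def transpose_def sum_distrib_left mult_ac)
  finally show ?thesis .
qed

lemma inner_matrix_mul_right: "(A ** B) \<bullet> C = (A :: real^'k^'n) \<bullet> (C ** transpose B)"
proof -
  have "(A ** B) \<bullet> C = (transpose B ** transpose A) \<bullet> transpose C"
    by (metis inner_transpose matrix_transpose_mul)
  also have "\<dots> = transpose A \<bullet> (B ** transpose C)"
    by (simp add: inner_matrix_mul_left)
  also have "\<dots> = A \<bullet> (C ** transpose B)"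
    by (metis inner_transpose matrix_transpose_mul transpose_transpose)
  finally show ?thesis .
qed

lemma has_vector_derivative_matrix:
  fixes f :: "real \<Rightarrow> real^'n^'m"
  assumes "\<And>i j. ((\<lambda>t. f t $ i $ j) has_real_derivative D $ i $ j) (at t)"
  shows "(f has_vector_derivative D) (at t)"
  unfolding has_vector_derivative_def
proof (subst has_derivative_componentwise_within, safe)
  fix b :: "real^'n^'m" assume "b \<in> Basis"
  then obtain i j where b: "b = axis i (axis j 1)" by (auto simp: Basis_vec_def)
  show "((\<lambda>x. f x \<bullet> b) has_derivative (\<lambda>x. (x *\<^sub>R D) \<bullet> b)) (at t)"
    using assms[of i j] by (simp add: b inner_axis has_field_derivative_def mult_commute_abs)
qed

section \<open>The matrix exponential\<close>

lemma mat_pow_scaleR: "mat_pow (t *\<^sub>R A) k = t ^ k *\<^sub>R mat_pow A k"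
  by (induction k) (auto simp: matrix_mul.scaleR_left matrix_mul.scaleR_right mult.commute)

lemma summable_mat_exp: "summable (\<lambda>k. mat_pow (A :: real^'n^'n) k /\<^sub>R fact k)"
proof -
  obtain K where K: "K > 0" "\<And>(A :: real^'n^'n) (B :: real^'n^'n). norm (A ** B) \<le> norm A * norm B * K"
    using matrix_mul.pos_bounded by blast
  let ?c = "norm (mat 1 :: real^'n^'n)"
  have pow: "norm (mat_pow A k) \<le> ?c * (norm A * K) ^ k" for k
  proof (induction k)
    case (Suc k)
    have "norm (mat_pow A (Suc k)) \<le> norm A * norm (mat_pow A k) * K"
      using K(2)[of A "mat_pow A k"] by simp
    also have "\<dots> \<le> norm A * (?c * (norm A * K) ^ k) * K"
      using Suc K(1) by (intro mult_right_mono mult_left_mono) auto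
    finally show ?case by (simp add: mult_ac)
  qed simp
  have "summable (\<lambda>k. ?c * (inverse (fact k) * (norm A * K) ^ k))"
    by (intro summable_mult summable_exp)
  then show ?thesis
  proof (rule summable_comparison_test'[where N = 0])
    fix k
    show "norm (mat_pow A k /\<^sub>R fact k) \<le> ?c * (inverse (fact k) * (norm A * K) ^ k)"
      using mult_left_mono[OF pow[of k], of "inverse (fact k)"] by (simp add: mult_ac)
  qed
qed

lemma mat_exp_sums: "(\<lambda>k. mat_pow A k /\<^sub>R fact k) sums mat_exp A"
  unfolding mat_exp_def by (rule summable_sums[OF summable_mat_exp])

text \<open>
  Each entry of \<open>mat_exp (t *\<^sub>R A)\<close> is an everywhere convergent power series in \<open>t\<close>, so it can be
  differentiated term by term.
\<close>

lemma mat_exp_has_vector_derivative: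
  fixes A :: "real^'n^'n"
  shows "((\<lambda>t. mat_exp (t *\<^sub>R A)) has_vector_derivative A ** mat_exp (t *\<^sub>R A)) (at t)"
proof (rule has_vector_derivative_matrix)
  fix i j
  have entry: "bounded_linear (\<lambda>M :: real^'n^'n. M $ i $ j)"
    by (rule bounded_linear_compose[OF bounded_linear_vec_nth bounded_linear_vec_nth])
  define c where "c k = mat_pow A k $ i $ j / fact k" for k
  have sums: "(\<lambda>k. c k * t ^ k) sums (mat_exp (t *\<^sub>R A) $ i $ j)" for t
    using bounded_linear.sums[OF entry mat_exp_sums[of "t *\<^sub>R A"]]
    by (simp add: mat_pow_scaleR c_def field_simps)
  have "((\<lambda>t. \<Sum>k. c k * t ^ k) has_field_derivative (\<Sum>k. diffs c k * t ^ k)) (at t)"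
    by (rule termdiffs_strong_converges_everywhere) (use sums in \<open>auto simp: sums_iff\<close>)
  moreover have "(\<lambda>k. diffs c k * t ^ k) sums ((A ** mat_exp (t *\<^sub>R A)) $ i $ j)"
  proof -
    have "(\<lambda>k. (A ** (mat_pow (t *\<^sub>R A) k /\<^sub>R fact k)) $ i $ j) sums ((A ** mat_exp (t *\<^sub>R A)) $ i $ j)"
      by (rule bounded_linear.sums[OF bounded_linear_compose[OF entry matrix_mul.bounded_linear_right] mat_exp_sums])
    moreover have "(A ** (mat_pow (t *\<^sub>R A) k /\<^sub>R fact k)) $ i $ j = diffs c k * t ^ k" for k
    proof -
      have "diffs c k = (A ** mat_pow A k) $ i $ j / fact k"
        by (simp add: diffs_def c_def del: of_nat_Suc)
      then show ?thesis by (simp add: matrix_mul.scaleR_right mat_pow_scaleR field_simps)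
    qed
    ultimately show ?thesis by simp
  qed
  ultimately show "((\<lambda>t. mat_exp (t *\<^sub>R A) $ i $ j) has_real_derivative (A ** mat_exp (t *\<^sub>R A)) $ i $ j) (at t)"
    using sums by (simp add: sums_iff)
qed

lemma mat_exp_0 [simp]: "mat_exp 0 = (mat 1 :: real^'n^'n)"
proof -
  have "mat_pow 0 k /\<^sub>R fact k = (if k = 0 then mat 1 else (0 :: real^'n^'n))" for k
    by (cases k) (auto simp: matrix_mul.zero_left)
  then have "(\<lambda>k. mat_pow 0 k /\<^sub>R fact k :: real^'n^'n) sums (mat 1)"
    using sums_single[of 0 "\<lambda>_. mat 1 :: real^'n^'n"] by (simp only:)
  then show ?thesis using mat_exp_sums sums_unique2 by blast
qed

lemma constant_if_zero_vector_derivative: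
  fixes f :: "real \<Rightarrow> 'a::real_normed_vector"
  assumes "\<And>t. (f has_vector_derivative 0) (at t)"
  shows "f t = f s"
proof -
  obtain c where "\<And>x. x \<in> UNIV \<Longrightarrow> f x = c"
    by (rule has_vector_derivative_zero_constant[of UNIV f]) (use assms in auto)
  then show ?thesis by simp
qed

lemma mat_exp_chain:
  fixes A :: "real^'n^'n"
  shows "((\<lambda>t. mat_exp ((c * t) *\<^sub>R A)) has_vector_derivative c *\<^sub>R (A ** mat_exp ((c * t) *\<^sub>R A))) (at t)"
  using mat_exp_has_vector_derivative[of "c *\<^sub>R A" t]
  by (simp add: mult.commute matrix_mul.scaleR_left)

text \<open>
  Two solutions \<open>Q\<close> of the linear equation \<open>Q' = A Q\<close> with the same initial value agree, because
  \<open>exp (- t A) Q(t)\<close> has derivative zero.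
\<close>

lemma mat_exp_unique:
  assumes R: "\<And>t. (R has_vector_derivative A ** R t) (at t)" and R0: "R 0 = mat 1"
    and comm: "\<And>t. mat_exp (t *\<^sub>R A) ** A = A ** mat_exp (t *\<^sub>R A)"
  shows "R t = mat_exp (t *\<^sub>R (A :: real^'n^'n))"
proof -
  have inv: "mat_exp ((- 1 * t) *\<^sub>R A) ** Q t = mat 1"
    if Q: "\<And>t. (Q has_vector_derivative A ** Q t) (at t)" "Q 0 = mat 1" for Q t
  proof -
    have "((\<lambda>t. mat_exp ((- 1 * t) *\<^sub>R A) ** Q t) has_vector_derivative 0) (at t)" for t
      by (rule has_vector_derivative_eq_rhs[OF
            bounded_bilinear.has_vector_derivative[OF bounded_bilinear_matrix_mul mat_exp_chain Q(1)]])
        (use comm[of "- t"] in \<open>simp add: matrix_mul.minus_left matrix_mul_assoc\<close>)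
    from constant_if_zero_vector_derivative[OF this, of t 0] show ?thesis by (simp add: Q(2))
  qed
  let ?E = "mat_exp (t *\<^sub>R A)"
  have "mat_exp ((- 1 * t) *\<^sub>R A) ** ?E = mat 1"
    by (rule inv) (use mat_exp_has_vector_derivative in auto)
  moreover have "mat_exp ((- 1 * t) *\<^sub>R A) ** R t = mat 1"
    by (rule inv) (use R R0 in auto)
  ultimately show ?thesis
    by (metis matrix_left_right_inverse matrix_mul_assoc matrix_mul_lid)
qed

lemma mat_pow_commute: "mat_pow A k ** A = A ** mat_pow A k"
  by (induction k) (auto simp: matrix_mul_assoc[symmetric])

lemma mat_exp_commute: "mat_exp (t *\<^sub>R A) ** A = A ** mat_exp (t *\<^sub>R (A :: real^'n^'n))"
proof -
  have 1: "(\<lambda>k. (mat_pow (t *\<^sub>R A) k /\<^sub>R fact k) ** A) sums (mat_exp (t *\<^sub>R A) ** A)"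
    by (rule bounded_linear.sums[OF matrix_mul.bounded_linear_left mat_exp_sums])
  have 2: "(\<lambda>k. A ** (mat_pow (t *\<^sub>R A) k /\<^sub>R fact k)) sums (A ** mat_exp (t *\<^sub>R A))"
    by (rule bounded_linear.sums[OF matrix_mul.bounded_linear_right mat_exp_sums])
  have "(mat_pow (t *\<^sub>R A) k /\<^sub>R fact k) ** A = A ** (mat_pow (t *\<^sub>R A) k /\<^sub>R fact k)" for k
    by (simp add: mat_pow_scaleR matrix_mul.scaleR_left matrix_mul.scaleR_right mat_pow_commute)
  with 1 2 show ?thesis using sums_unique2 by auto
qed

lemma continuous_on_mat_exp: "continuous_on S (\<lambda>t. mat_exp (t *\<^sub>R (A :: real^'n^'n)))"
  using mat_exp_has_vector_derivative
  by (metis continuous_at_imp_continuous_on has_vector_derivative_continuous)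

text \<open>
  The determinant of an orthogonal matrix is \<open>1\<close> or \<open>- 1\<close>, and it cannot jump along a continuous path.
\<close>

lemma rotation_matrix_path:
  fixes R :: "real \<Rightarrow> real^'n^'n"
  assumes "continuous_on UNIV R" "\<And>t. orthogonal_matrix (R t)" "R 0 = mat 1"
  shows "rotation_matrix (R t)"
proof -
  have cont: "continuous_on UNIV (\<lambda>t. det (R t))"
    unfolding det_def using assms(1)
    by (intro continuous_intros continuous_on_component) 
  have vals: "det (R t) = 1 \<or> det (R t) = - 1" for t
    using det_orthogonal_matrix[OF assms(2)] .
  have "det (R t) = 1"
  proof (rule ccontr)
    assume "det (R t) \<noteq> 1"
    then have neg: "det (R t) = - 1" using vals by blast
    have "connected (range (\<lambda>t. det (R t)))"
      by (rule connected_continuous_image[OF cont connected_UNIV])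
    then have "{det (R t)..det (R 0)} \<subseteq> range (\<lambda>t. det (R t))"
      by (rule connected_contains_Icc) auto
    then have "0 \<in> range (\<lambda>t. det (R t))" using neg assms(3) by (auto simp: subset_iff)
    then obtain s where "det (R s) = 0" by (metis (no_types) rangeE)
    then show False using vals[of s] by simp
  qed
  then show ?thesis using assms(2) by (simp add: rotation_matrix_def)
qed

lemma mat_exp_skew_orthogonal:
  assumes "transpose X = - (X :: real^'n^'n)"
  shows "orthogonal_matrix (mat_exp (t *\<^sub>R X))"
proof -
  let ?E = "\<lambda>t. mat_exp (t *\<^sub>R X)"
  have "((\<lambda>t. transpose (?E t) ** ?E t) has_vector_derivative 0) (at t)" for t
    by (rule has_vector_derivative_eq_rhs[OF bounded_bilinear.has_vector_derivative[OF bounded_bilinear_matrix_mul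
            transpose_has_vector_derivative[OF mat_exp_has_vector_derivative] mat_exp_has_vector_derivative]])
      (simp add: matrix_transpose_mul assms matrix_mul.minus_left matrix_mul.minus_right matrix_mul_assoc)
  from constant_if_zero_vector_derivative[OF this, of t 0]
  show ?thesis by (simp add: orthogonal_matrix)
qed

lemma mat_exp_skew_rotation:
  "transpose X = - (X :: real^'n^'n) \<Longrightarrow> rotation_matrix (mat_exp (t *\<^sub>R X))"
  by (rule rotation_matrix_path[of "\<lambda>t. mat_exp (t *\<^sub>R X)"])
    (auto simp: continuous_on_mat_exp mat_exp_skew_orthogonal)

section \<open>The adjoint action of rotations\<close>

lemma orthogonal_matrix_inv:
  assumes "orthogonal_matrix (A :: real^'n^'n)"
  shows "matrix_inv A = transpose A"
proof -
  have "\<exists>B. A ** B = mat 1 \<and> B ** A = mat 1"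
    using assms by (auto simp: orthogonal_matrix_def)
  then have "matrix_inv A ** A = mat 1"
    unfolding matrix_inv_def by (metis (mono_tags, lifting) someI_ex)
  then have "matrix_inv A ** (A ** transpose A) = transpose A"
    by (simp add: matrix_mul_assoc)
  then show ?thesis using assms by (simp add: orthogonal_matrix_def)
qed

lemma Ad_orthogonal: "orthogonal_matrix A \<Longrightarrow> Ad A X = A ** X ** transpose A"
  by (simp add: Ad_def orthogonal_matrix_inv)

lemma Ad_mul_orthogonal:
  "orthogonal_matrix A \<Longrightarrow> orthogonal_matrix B \<Longrightarrow> Ad (A ** B) X = Ad A (Ad B X)"
  by (simp add: Ad_orthogonal orthogonal_matrix_mul matrix_transpose_mul matrix_mul_assoc)

lemma Ad_exp_has_vector_derivative:
  assumes X: "transpose X = - (X :: real^'n^'n)"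
  shows "((\<lambda>t. Ad (mat_exp (t *\<^sub>R X)) F) has_vector_derivative bracket X F) (at 0)"
proof -
  let ?E = "\<lambda>t. mat_exp (t *\<^sub>R X)"
  have "((\<lambda>t. ?E t ** F ** transpose (?E t)) has_vector_derivative
      (?E 0 ** F ** transpose (X ** ?E 0)) + (X ** ?E 0 ** F) ** transpose (?E 0)) (at 0)"
    by (intro bounded_bilinear.has_vector_derivative[OF bounded_bilinear_matrix_mul]
        transpose_has_vector_derivative bounded_linear.has_vector_derivative[OF matrix_mul.bounded_linear_left]
        mat_exp_has_vector_derivative)
  then show ?thesis
    by (simp add: Ad_orthogonal[OF mat_exp_skew_orthogonal[OF X]] bracket_def matrix_transpose_mul X
        matrix_mul.minus_right)
qed

lemma generated_field_Ad:
  "transpose X = - (X :: real^'n^'n) \<Longrightarrow> generated_field Ad X F = bracket X F"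
  unfolding generated_field_def by (rule vector_derivative_at[OF Ad_exp_has_vector_derivative])

section \<open>Polynomials in a skew-adjoint operator\<close>

text \<open>
  The value of the operator \<open>p(T)\<close> at a vector, by Horner's scheme, so that induction on the polynomial
  follows the evaluation.
\<close>

definition op_poly :: "('a::real_vector \<Rightarrow> 'a) \<Rightarrow> real poly \<Rightarrow> 'a \<Rightarrow> 'a" where
  "op_poly T p = fold_coeffs (\<lambda>a f v. a *\<^sub>R v + T (f v)) p (\<lambda>_. 0)"

lemma op_poly_0 [simp]: "op_poly T 0 v = 0"
  by (simp add: op_poly_def)

lemma op_poly_pCons [simp]:
  assumes "linear T"
  shows "op_poly T (pCons a p) v = a *\<^sub>R v + T (op_poly T p v)"
  using assms by (cases "p = 0"; cases "a = 0") (auto simp: op_poly_def linear_0)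

lemma op_poly_add:
  assumes "linear T"
  shows "op_poly T (p + q) v = op_poly T p v + op_poly T q v"
  by (induction p q rule: poly_induct2) (auto simp: assms linear_add[OF assms] algebra_simps)

lemma op_poly_smult:
  assumes "linear T"
  shows "op_poly T (smult c p) v = c *\<^sub>R op_poly T p v"
  by (induction p) (auto simp: assms linear_cmul[OF assms] algebra_simps)

lemma op_poly_diff:
  assumes "linear T"
  shows "op_poly T (p - q) v = op_poly T p v - op_poly T q v"
  using op_poly_add[OF assms, of "p - q" q v] by simp

lemma op_poly_minus:
  assumes "linear T"
  shows "op_poly T (- p) v = - op_poly T p v"
  using op_poly_diff[OF assms, of 0 p v] by simp

lemma op_poly_mult:
  assumes "linear T"
  shows "op_poly T (p * q) v = op_poly T p (op_poly T q v)"
  by (induction p) (auto simp: assms op_poly_add[OF assms] op_poly_smult[OF assms])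

lemma op_poly_sum:
  assumes "linear T"
  shows "op_poly T (\<Sum>i\<in>I. f i) v = (\<Sum>i\<in>I. op_poly T (f i) v)"
  by (induction I rule: infinite_finite_induct) (auto simp: op_poly_add[OF assms])

lemma op_poly_monom:
  assumes "linear T"
  shows "op_poly T (monom c i) v = c *\<^sub>R (T ^^ i) v"
  by (induction i) (auto simp: assms monom_Suc monom_0 linear_0[OF assms] linear_cmul[OF assms])

lemma linear_op_poly:
  assumes "linear T"
  shows "linear (op_poly T p)"
proof (induction p)
  case 0
  show ?case by (rule linearI) auto
next
  case (pCons a p)
  show ?case
    by (rule linearI) (auto simp: assms linear_add[OF assms] linear_cmul[OF assms] linear_add[OF pCons.IH]
        linear_cmul[OF pCons.IH] algebra_simps)
qed

lemma op_poly_commute: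
  assumes "linear T"
  shows "op_poly T p (op_poly T q v) = op_poly T q (op_poly T p v)"
  by (metis assms mult.commute op_poly_mult)

lemma op_poly_commute_op:
  assumes "linear T"
  shows "T (op_poly T p v) = op_poly T p (T v)"
  using op_poly_commute[OF assms, of "[:0, 1:]" p v] by (simp add: assms linear_0[OF assms])

lemma op_poly_intertwine:
  assumes "linear T" "linear T'" "linear S" "\<And>v. S (T v) = T' (S v)"
  shows "S (op_poly T p v) = op_poly T' p (S v)"
  by (induction p) (auto simp: assms linear_0[OF assms(3)] linear_add[OF assms(3)] linear_cmul[OF assms(3)])

text \<open>
  The vectors \<open>v, T v, T\<^sup>2 v, \<dots>\<close> are linearly dependent, and a linear relation between them is a
  polynomial that kills \<open>v\<close>.
\<close>

lemma op_poly_vector_annihilator: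
  fixes T :: "'a::euclidean_space \<Rightarrow> 'a"
  assumes T: "linear T"
  obtains p where "p \<noteq> 0" "op_poly T p v = 0"
proof (cases "inj_on (\<lambda>i. (T ^^ i) v) {..DIM('a)}")
  case False
  then obtain i j where ij: "i \<noteq> j" "(T ^^ i) v = (T ^^ j) v" by (auto simp: inj_on_def)
  have "coeff (monom 1 i - monom (1::real) j) i = 1" using ij by simp
  then have "monom 1 i - monom (1::real) j \<noteq> 0" by (metis coeff_0 zero_neq_one)
  then show thesis
    using that[of "monom 1 i - monom 1 j"] ij by (simp add: op_poly_diff[OF T] op_poly_monom[OF T])
next
  case True
  let ?g = "\<lambda>i. (T ^^ i) v"
  have "dependent (?g ` {..DIM('a)})"
    by (rule dependent_biggerset) (use True in \<open>auto simp: card_image\<close>)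
  then obtain u k where u: "(\<Sum>w\<in>?g ` {..DIM('a)}. u w *\<^sub>R w) = 0" "k \<le> DIM('a)" "u (?g k) \<noteq> 0"
    by (auto simp: dependent_finite)
  define p where "p = (\<Sum>i\<le>DIM('a). monom (u (?g i)) i)"
  have "coeff p k = u (?g k)" using u(2) by (simp add: p_def coeff_sum)
  then have "p \<noteq> 0" using u(3) by auto
  moreover have "op_poly T p v = 0"
    using u(1) by (simp add: p_def op_poly_sum[OF T] op_poly_monom[OF T] sum.reindex[OF True])
  ultimately show thesis by (rule that)
qed

text \<open>
  The product of the polynomials that kill the basis vectors kills everything.
\<close>

lemma op_poly_annihilator:
  fixes T :: "'a::euclidean_space \<Rightarrow> 'a"
  assumes T: "linear T"
  obtains p where "p \<noteq> 0" "\<And>v. op_poly T p v = 0"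
proof -
  have "\<exists>p. p \<noteq> 0 \<and> op_poly T p v = 0" for v
    by (rule op_poly_vector_annihilator[OF T]) blast
  then obtain f where f: "\<And>v. f v \<noteq> 0" "\<And>v. op_poly T (f v) v = 0" by metis
  let ?p = "\<Prod>b\<in>Basis. f (b :: 'a)"
  have "op_poly T ?p b = 0" if "b \<in> Basis" for b
  proof -
    have "?p = (\<Prod>b\<in>Basis - {b}. f b) * f b" using that by (simp add: prod.remove mult.commute)
    then show ?thesis using f(2)[of b] by (simp add: op_poly_mult[OF T] linear_0[OF linear_op_poly[OF T]])
  qed
  then have "op_poly T ?p v = 0" for v
    using linear_eq_stdbasis[OF linear_op_poly[OF T], of "\<lambda>_. 0" ?p] by (simp add: fun_eq_iff linear_zero)
  moreover have "?p \<noteq> 0" using f(1) by simp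
  ultimately show thesis using that by blast
qed

lemma op_poly_adjoint:
  fixes T :: "'a::real_inner \<Rightarrow> 'a"
  assumes T: "linear T" and skew: "\<And>x y. T x \<bullet> y = - (x \<bullet> T y)"
  shows "op_poly T p x \<bullet> y = x \<bullet> op_poly T (pcompose p [:0, - 1:]) y"
proof (induction p arbitrary: x)
  case (pCons a p)
  have "T (op_poly T p x) \<bullet> y = - (x \<bullet> T (op_poly T (pcompose p [:0, - 1:]) y))"
    by (simp add: op_poly_commute_op[OF T] pCons.IH skew)
  then show ?case
    by (simp add: T pcompose_pCons op_poly_add[OF T] op_poly_mult[OF T] linear_0[OF T]
        inner_add_left inner_diff_right linear_neg[OF T] op_poly_minus[OF T])
qed simp

text \<open>
  A polynomial \<open>N\<close> in \<open>T\<close> commutes with its adjoint \<open>N\<^sup>*\<close>, which is a polynomial in \<open>- T\<close>.  From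
  \<open>N\<^sup>2 = 0\<close> one gets \<open>\<parallel>N\<^sup>* N v\<parallel>\<^sup>2 = 0\<close> and then \<open>\<parallel>N v\<parallel>\<^sup>2 = 0\<close>.
\<close>

lemma skew_op_poly_square_zero:
  fixes T :: "'a::real_inner \<Rightarrow> 'a"
  assumes T: "linear T" and skew: "\<And>x y. T x \<bullet> y = - (x \<bullet> T y)"
    and sq: "\<And>v. op_poly T (p * p) v = 0"
  shows "op_poly T p v = 0"
proof -
  let ?N = "op_poly T p" and ?M = "op_poly T (pcompose p [:0, - 1:])"
  have adj: "?N x \<bullet> y = x \<bullet> ?M y" for x y by (rule op_poly_adjoint[OF T skew])
  have "?M (?N v) \<bullet> ?M (?N v) = ?N (?M (?N v)) \<bullet> ?N v"
    by (rule adj[symmetric])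
  also have "?N (?M (?N v)) = ?M (?N (?N v))" by (rule op_poly_commute[OF T])
  also have "?N (?N v) = 0" using sq[of v] by (simp add: op_poly_mult[OF T])
  finally have "?M (?N v) = 0" by (simp add: linear_0[OF linear_op_poly[OF T]])
  then have "?N v \<bullet> ?N v = 0" by (simp add: adj)
  then show ?thesis by simp
qed

text \<open>
  An annihilator \<open>p\<close> of least degree is coprime to its derivative.  Otherwise let \<open>d\<close> be their greatest
  common divisor and \<open>p = d e\<close>.  Then \<open>p\<close> divides \<open>(d' e)\<^sup>2\<close>, so \<open>d' e\<close> annihilates too, by normality of
  \<open>T\<close>, and its degree is smaller by one.  A Bezout identity provides the inverse \<open>r(T)\<close> of \<open>p'(T)\<close>.
\<close>

theorem skew_separable_annihilator:
  fixes T :: "'a::euclidean_space \<Rightarrow> 'a"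
  assumes T: "linear T" and skew: "\<And>x y. T x \<bullet> y = - (x \<bullet> T y)"
  obtains p r where "\<And>v. op_poly T p v = 0" "\<And>v. op_poly T r (op_poly T (pderiv p) v) = v"
proof -
  define ann where "ann p \<longleftrightarrow> p \<noteq> 0 \<and> (\<forall>v. op_poly T p v = 0)" for p
  have "\<exists>p0. ann p0" unfolding ann_def by (rule op_poly_annihilator[OF T]) blast
  then obtain p0 where "ann p0" ..
  then obtain p where p: "ann p" and least: "\<And>q. ann q \<Longrightarrow> degree p \<le> degree q"
    using ex_has_least_nat[of ann p0 degree] by blast
  obtain u w where uw: "u * p + w * pderiv p = gcd p (pderiv p)"
    using bezout_coefficients_fst_snd[of p "pderiv p"] by metis
  define d where "d = gcd p (pderiv p)"
  obtain e where e: "p = d * e" by (metis d_def dvdE gcd_dvd1)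
  obtain f where f: "pderiv p = d * f" by (metis d_def dvdE gcd_dvd2)
  have nz: "d \<noteq> 0" "e \<noteq> 0" using p e by (auto simp: ann_def)
  have "degree d = 0"
  proof (rule ccontr)
    assume deg: "degree d \<noteq> 0"
    have "pderiv d * e = d * (f - pderiv e)"
      using f unfolding e pderiv_mult by (simp add: algebra_simps)
    then have "pderiv d * e * (pderiv d * e) = pderiv d * e * (d * (f - pderiv e))" by simp
    also have "\<dots> = (pderiv d * (f - pderiv e)) * p" by (simp add: e algebra_simps)
    finally have "pderiv d * e * (pderiv d * e) = (pderiv d * (f - pderiv e)) * p" .
    then have "op_poly T (pderiv d * e * (pderiv d * e)) v = op_poly T ((pderiv d * (f - pderiv e)) * p) v" for v
      by (rule arg_cong)
    then have "op_poly T (pderiv d * e * (pderiv d * e)) v = 0" for v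
      using p unfolding op_poly_mult[OF T, of "pderiv d * (f - pderiv e)" p]
      by (simp only: ann_def linear_0[OF linear_op_poly[OF T]])
    then have "op_poly T (pderiv d * e) v = 0" for v
      by (rule skew_op_poly_square_zero[OF T skew])
    moreover have "pderiv d \<noteq> 0" using deg by (simp add: pderiv_eq_0_iff)
    ultimately have "ann (pderiv d * e)" using nz by (simp add: ann_def)
    then have "degree p \<le> degree (pderiv d * e)" by (rule least)
    also have "\<dots> = degree d - 1 + degree e"
      using \<open>pderiv d \<noteq> 0\<close> nz by (simp add: degree_mult_eq degree_pderiv)
    finally show False using deg nz by (simp add: e degree_mult_eq)
  qed
  then obtain c where c: "d = [:c:]" "c \<noteq> 0" using nz by (metis degree_eq_zeroE pCons_0_0)
  have "op_poly T w (op_poly T (pderiv p) v) = c *\<^sub>R v" for v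
  proof -
    have "op_poly T (u * p + w * pderiv p) v = c *\<^sub>R v"
      using uw c by (simp add: d_def T linear_0[OF T])
    then show ?thesis
      using p by (simp add: op_poly_add[OF T] op_poly_mult[OF T] ann_def linear_0[OF linear_op_poly[OF T]])
  qed
  then have "op_poly T (smult (1 / c) w) (op_poly T (pderiv p) v) = v" for v
    using c(2) by (simp add: op_poly_smult[OF T])
  then show thesis using p that by (auto simp: ann_def)
qed

text \<open>
  A separable annihilator has \<open>0\<close> as a root at most once, unless \<open>T\<close> is invertible, so \<open>T\<close> can be
  recovered from \<open>T\<^sup>2\<close> by a polynomial in \<open>T\<close>.  The cases are the two lowest coefficients of the
  annihilator; if both vanish, then \<open>T\<close> divides the invertible \<open>p'(T)\<close>.
\<close>

theorem skew_pseudo_inverse: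
  fixes T :: "'a::euclidean_space \<Rightarrow> 'a"
  assumes T: "linear T" and skew: "\<And>x y. T x \<bullet> y = - (x \<bullet> T y)"
  obtains q where "\<And>v. op_poly T q (T (T v)) = T v"
proof -
  obtain p r where p: "\<And>v. op_poly T p v = 0" and r: "\<And>v. op_poly T r (op_poly T (pderiv p) v) = v"
    by (rule skew_separable_annihilator[OF T skew]) blast
  obtain a p1 where p1: "p = pCons a p1" by (cases p)
  obtain b p2 where p2: "p1 = pCons b p2" by (cases p1)
  have zero: "op_poly T s 0 = 0" for s by (rule linear_0[OF linear_op_poly[OF T]])
  consider "a \<noteq> 0" | "a = 0" "b \<noteq> 0" | "a = 0" "b = 0" by blast
  then show thesis
  proof cases
    case 1
    have "op_poly T (smult (- 1 / a) p1) (T (T v)) = T v" for v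
    proof -
      have "a *\<^sub>R T v + op_poly T p1 (T (T v)) = 0"
        using p[of "T v"] by (simp add: p1 T op_poly_commute_op[OF T])
      then have "op_poly T p1 (T (T v)) = - (a *\<^sub>R T v)" by (simp add: eq_neg_iff_add_eq_0 add.commute)
      then show ?thesis using 1 by (simp add: op_poly_smult[OF T] op_poly_minus[OF T])
    qed
    then show thesis by (rule that)
  next
    case 2
    have "op_poly T (smult (- 1 / b) p2) (T (T v)) = T v" for v
    proof -
      have "b *\<^sub>R T v + op_poly T p2 (T (T v)) = 0"
        using p[of v] 2 by (simp add: p1 p2 T op_poly_commute_op[OF T] linear_add[OF T] linear_cmul[OF T])
      then have "op_poly T p2 (T (T v)) = - (b *\<^sub>R T v)" by (simp add: eq_neg_iff_add_eq_0 add.commute)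
      then show ?thesis using 2 by (simp add: op_poly_smult[OF T] op_poly_minus[OF T])
    qed
    then show thesis by (rule that)
  next
    case 3
    define s where "s = p2 + (p2 + pCons 0 (pderiv p2))"
    have "pderiv p = pCons 0 s"
      using 3 by (simp add: p1 p2 s_def pderiv_pCons)
    then have "op_poly T r (T (op_poly T s (T v))) = T v" for v
      using r[of "T v"] by (simp add: T)
    then have "op_poly T (r * s) (T (T v)) = T v" for v
      by (simp add: op_poly_mult[OF T] op_poly_commute_op[OF T])
    then show thesis by (rule that)
  qed
qed

section \<open>Polynomials in a matrix\<close>

definition mat_poly :: "real poly \<Rightarrow> real^'n^'n \<Rightarrow> real^'n^'n" where
  "mat_poly p A = op_poly ((**) A) p (mat 1)"

lemma linear_matrix_mul: "linear ((**) (A :: real^'n^'n) :: real^'n^'n \<Rightarrow> _)"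
  by (rule bounded_linear.linear[OF matrix_mul.bounded_linear_right])

lemma mat_poly_0 [simp]: "mat_poly 0 A = 0"
  by (simp add: mat_poly_def)

lemma mat_poly_pCons [simp]: "mat_poly (pCons a p) A = a *\<^sub>R mat 1 + A ** mat_poly p A"
  by (simp add: mat_poly_def linear_matrix_mul)

lemma mat_poly_add: "mat_poly (p + q) A = mat_poly p A + mat_poly q A"
  by (simp add: mat_poly_def op_poly_add linear_matrix_mul)

lemma op_poly_matrix_mul: "op_poly ((**) A) p X = mat_poly p A ** (X :: real^'n^'n)"
  by (induction p) (auto simp: linear_matrix_mul matrix_mul.zero_left matrix_mul.add_left matrix_mul.scaleR_left matrix_mul_assoc)

lemma mat_poly_commute:
  assumes "Z ** F = F ** Z"
  shows "mat_poly p F ** Z = Z ** (mat_poly p F :: real^'n^'n)"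
proof (induction p)
  case 0
  then show ?case by (simp add: matrix_mul.zero_left matrix_mul.zero_right)
next
  case (pCons a p)
  have "F ** mat_poly p F ** Z = F ** (Z ** mat_poly p F)"
    by (simp add: matrix_mul_assoc[symmetric] pCons.IH)
  then show ?case
    by (simp add: matrix_mul.add_left matrix_mul.add_right matrix_mul.scaleR_left matrix_mul.scaleR_right
        matrix_mul_assoc assms)
qed

lemmas linear_transpose = bounded_linear.linear[OF bounded_linear_transpose]
lemmas transpose_add = linear_add[OF linear_transpose]
lemmas transpose_diff = linear_diff[OF linear_transpose]
lemmas transpose_minus = linear_neg[OF linear_transpose]
lemmas transpose_zero = linear_0[OF linear_transpose]
lemmas transpose_scaleR = linear_cmul[OF linear_transpose]

lemma bounded_bilinear_bracket: "bounded_bilinear (bracket :: real^'n^'n \<Rightarrow> _)"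
proof -
  have "bilinear (bracket :: real^'n^'n \<Rightarrow> _)"
    unfolding bilinear_def bracket_def
    by (auto intro!: linearI simp: matrix_mul.add_left matrix_mul.add_right matrix_mul.scaleR_left
        matrix_mul.scaleR_right scaleR_diff_right)
  then show ?thesis by (simp add: bilinear_conv_bounded_bilinear)
qed

interpretation bracket: bounded_bilinear "bracket :: real^'n^'n \<Rightarrow> _"
  by (rule bounded_bilinear_bracket)

lemma linear_bracket: "linear (bracket (F :: real^'n^'n))"
  by (rule bounded_linear.linear[OF bracket.bounded_linear_right])

lemma bracket_eq_0_iff: "bracket X Y = 0 \<longleftrightarrow> X ** Y = Y ** X"
  by (simp add: bracket_def)

lemma bracket_swap: "bracket Y X = - bracket X Y"
  by (simp add: bracket_def)

lemma bracket_jacobi: "bracket X (bracket Y Z) + bracket Y (bracket Z X) + bracket Z (bracket X Y) = 0"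
  by (simp add: bracket_def matrix_mul.diff_left matrix_mul.diff_right matrix_mul_assoc)

lemma transpose_bracket:
  assumes "transpose X = - X" "transpose Y = - (Y :: real^'n^'n)"
  shows "transpose (bracket X Y) = - bracket X Y"
  using assms by (simp add: bracket_def transpose_diff matrix_transpose_mul
      matrix_mul.minus_left matrix_mul.minus_right)

lemma bracket_inner_skew:
  assumes "transpose F = - (F :: real^'n^'n)"
  shows "bracket F X \<bullet> Y = - (X \<bullet> bracket F Y)"
  by (simp add: bracket_def inner_diff_left inner_diff_right inner_matrix_mul_left[of F X]
      inner_matrix_mul_right[of X F] assms matrix_mul.minus_left matrix_mul.minus_right)

text \<open>
  For commuting \<open>E\<close> and \<open>F\<close>, the difference \<open>p(E) - p(F)\<close> is divisible by \<open>E - F\<close>, and the quotient tends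
  to \<open>p'(F)\<close>.
\<close>

lemma mat_poly_difference_quotient:
  fixes F :: "real^'n^'n"
  obtains Q where "continuous_on UNIV Q" "Q F = mat_poly (pderiv p) F"
    "\<And>E. E ** F = F ** E \<Longrightarrow> mat_poly p E - mat_poly p F = (E - F) ** Q E"
proof -
  have "\<exists>Q. continuous_on UNIV Q \<and> Q F = mat_poly (pderiv p) F \<and>
    (\<forall>E. E ** F = F ** E \<longrightarrow> mat_poly p E - mat_poly p F = (E - F) ** Q E)"
  proof (induction p)
    case 0
    show ?case by (rule exI[of _ "\<lambda>_. 0"]) (auto simp: matrix_mul.zero_right)
  next
    case (pCons a p)
    then obtain Q where Q: "continuous_on UNIV Q" "Q F = mat_poly (pderiv p) F"
      "\<And>E. E ** F = F ** E \<Longrightarrow> mat_poly p E - mat_poly p F = (E - F) ** Q E" by blast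
    show ?case
    proof (intro exI conjI allI impI)
      let ?Q = "\<lambda>E. E ** Q E + mat_poly p F"
      show "continuous_on UNIV ?Q"
        by (intro continuous_intros matrix_mul.continuous_on Q)
      show "?Q F = mat_poly (pderiv (pCons a p)) F"
        by (simp add: pderiv_pCons mat_poly_add Q)
      fix E assume E: "E ** F = F ** E"
      have "mat_poly (pCons a p) E - mat_poly (pCons a p) F
          = E ** (mat_poly p E - mat_poly p F) + (E - F) ** mat_poly p F"
        by (simp add: matrix_mul.diff_left matrix_mul.diff_right)
      also have "E ** (mat_poly p E - mat_poly p F) = (E - F) ** (E ** Q E)"
        unfolding Q(3)[OF E] using E by (simp add: matrix_mul_assoc matrix_mul.diff_left matrix_mul.diff_right)
      finally show "mat_poly (pCons a p) E - mat_poly (pCons a p) F = (E - F) ** ?Q E"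
        by (simp add: matrix_mul.add_right)
    qed
  qed
  then show thesis using that by blast
qed

text \<open>
  The derivative \<open>D\<close> of a matrix polynomial is known on two kinds of vectors: on brackets, where it is
  the infinitesimal form of invariance under conjugation, and on the commutant of \<open>F\<close>, where the calculus
  is commutative.
\<close>

lemma mat_poly_derivative:
  fixes F :: "real^'n^'n"
  obtains D where "linear D"
    "\<And>c v. c (0::real) = F \<Longrightarrow> (c has_vector_derivative v) (at 0) \<Longrightarrow>
       ((\<lambda>t. mat_poly p (c t)) has_vector_derivative D v) (at 0)"
    "\<And>X. D (bracket X F) = bracket X (mat_poly p F)"
    "\<And>Z. Z ** F = F ** Z \<Longrightarrow> D Z = mat_poly (pderiv p) F ** Z"
proof -
  have "\<exists>D. linear D \<and>
    (\<forall>c v. c (0::real) = F \<longrightarrow> (c has_vector_derivative v) (at 0) \<longrightarrow>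
       ((\<lambda>t. mat_poly p (c t)) has_vector_derivative D v) (at 0)) \<and>
    (\<forall>X. D (bracket X F) = bracket X (mat_poly p F)) \<and>
    (\<forall>Z. Z ** F = F ** Z \<longrightarrow> D Z = mat_poly (pderiv p) F ** Z)"
  proof (induction p)
    case 0
    show ?case
      by (rule exI[of _ "\<lambda>_. 0"]) (auto simp: matrix_mul.zero_left bracket.zero_right linear_zero)
  next
    case (pCons a p)
    then obtain D where D: "linear D"
      "\<And>c v. c (0::real) = F \<Longrightarrow> (c has_vector_derivative v) (at 0) \<Longrightarrow>
       ((\<lambda>t. mat_poly p (c t)) has_vector_derivative D v) (at 0)"
      "\<And>X. D (bracket X F) = bracket X (mat_poly p F)"
      "\<And>Z. Z ** F = F ** Z \<Longrightarrow> D Z = mat_poly (pderiv p) F ** Z" by blast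
    let ?D = "\<lambda>v. F ** D v + v ** mat_poly p F"
    show ?case
    proof (intro exI conjI allI impI)
      show "linear ?D"
        by (rule linearI) (simp_all add: linear_add[OF D(1)] linear_cmul[OF D(1)] matrix_mul.add_left
            matrix_mul.add_right matrix_mul.scaleR_left matrix_mul.scaleR_right algebra_simps)
    next
      fix c v assume c: "c (0::real) = F" "(c has_vector_derivative v) (at 0)"
      show "((\<lambda>t. mat_poly (pCons a p) (c t)) has_vector_derivative ?D v) (at 0)"
        using bounded_bilinear.has_vector_derivative[OF bounded_bilinear_matrix_mul c(2) D(2)[OF c]] c(1)
        by (auto intro!: derivative_eq_intros)
    next
      fix X
      show "?D (bracket X F) = bracket X (mat_poly (pCons a p) F)"
        unfolding D(3)
        by (simp add: bracket_def matrix_mul.diff_left matrix_mul.diff_right matrix_mul.add_left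
            matrix_mul.add_right matrix_mul.scaleR_left matrix_mul.scaleR_right matrix_mul_assoc)
    next
      fix Z assume Z: "Z ** F = F ** Z"
      show "?D Z = mat_poly (pderiv (pCons a p)) F ** Z"
        by (simp add: D(4)[OF Z] pderiv_pCons mat_poly_add matrix_mul.add_left mat_poly_commute[OF Z, symmetric] matrix_mul_assoc)
    qed
  qed
  then show thesis using that by blast
qed

lemma bracket_op_poly_skew:
  assumes "transpose F = - F" "transpose v = - (v :: real^'n^'n)"
  shows "transpose (op_poly (bracket F) q v) = - op_poly (bracket F) q v"
proof (induction q)
  case (pCons a q)
  then show ?case
    using transpose_bracket[OF assms(1) pCons.IH] assms(2)
    by (simp add: linear_bracket transpose_add
        transpose_scaleR)
qed (simp add: transpose_zero)

lemma skew_matrix_separable: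
  assumes "transpose F = - (F :: real^'n^'n)"
  obtains p r where "mat_poly p F = 0" "mat_poly r F ** mat_poly (pderiv p) F = mat 1"
proof -
  have skew: "(F ** X) \<bullet> Y = - (X \<bullet> (F ** Y))" for X Y :: "real^'n^'n"
    by (simp add: inner_matrix_mul_left[of F X] assms matrix_mul.minus_left)
  obtain p r where "\<And>v. op_poly ((**) F) p (v :: real^'n^'n) = 0" "\<And>v. op_poly ((**) F) r (op_poly ((**) F) (pderiv p) v) = (v :: real^'n^'n)"
    by (rule skew_separable_annihilator[OF linear_matrix_mul skew]) blast
  then have "mat_poly p F ** mat 1 = 0" "mat_poly r F ** (mat_poly (pderiv p) F ** mat 1) = mat 1"
    by (metis op_poly_matrix_mul)+
  then show thesis using that by simp
qed

section \<open>Adjoint orbits of skew matrices\<close>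

definition adjoint_orbit :: "real^'n^'n \<Rightarrow> (real^'n^'n) set" where
  "adjoint_orbit F = (\<lambda>A. Ad A F) ` {A. rotation_matrix A}"

definition skew_matrices :: "(real^'n^'n) set" where
  "skew_matrices = {X. transpose X = - X}"

lemma skew_matricesD: "X \<in> skew_matrices \<Longrightarrow> transpose X = - X"
  by (simp add: skew_matrices_def)

lemma subspace_skew_matrices: "subspace (skew_matrices :: (real^'n^'n) set)"
  by (auto simp: subspace_def skew_matrices_def transpose_zero transpose_add transpose_scaleR)

lemma bracket_in_skew: "X \<in> skew_matrices \<Longrightarrow> Y \<in> skew_matrices \<Longrightarrow> bracket X Y \<in> skew_matrices"
  by (simp add: skew_matrices_def transpose_bracket)

lemma rotation_matrix_orthogonal: "rotation_matrix A \<Longrightarrow> orthogonal_matrix A"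
  by (simp add: rotation_matrix_def)

lemma rotation_matrix_mat_1: "rotation_matrix (mat 1 :: real^'n^'n)"
  by (simp add: rotation_matrix_def orthogonal_matrix_id)

lemma rotation_matrix_mul:
  "rotation_matrix A \<Longrightarrow> rotation_matrix B \<Longrightarrow> rotation_matrix (A ** (B :: real^'n^'n))"
  by (simp add: rotation_matrix_def orthogonal_matrix_mul det_mul)

lemma rotation_matrix_transpose:
  "rotation_matrix A \<Longrightarrow> rotation_matrix (transpose (A :: real^'n^'n))"
  by (simp add: rotation_matrix_def)

lemma Ad_mat_1: "Ad (mat 1) X = (X :: real^'n^'n)"
  by (simp add: Ad_orthogonal orthogonal_matrix_id)

lemma Ad_transpose_cancel:
  assumes "orthogonal_matrix (A :: real^'n^'n)"
  shows "Ad (transpose A) (Ad A X) = X" "Ad A (Ad (transpose A) X) = X"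
  using assms by (simp_all add: Ad_mul_orthogonal[symmetric] orthogonal_matrix_def Ad_mat_1)

lemma linear_Ad: "orthogonal_matrix (A :: real^'n^'n) \<Longrightarrow> linear (Ad A)"
  by (rule linearI) (simp_all add: Ad_orthogonal matrix_mul.add_left matrix_mul.add_right
      matrix_mul.scaleR_left matrix_mul.scaleR_right)

lemma Ad_mul:
  assumes "orthogonal_matrix (A :: real^'n^'n)"
  shows "Ad A (X ** Y) = Ad A X ** Ad A Y"
proof -
  have id: "transpose A ** A = mat 1" using assms by (simp add: orthogonal_matrix)
  have "Ad A X ** Ad A Y = A ** X ** (transpose A ** A) ** Y ** transpose A"
    by (simp add: Ad_orthogonal[OF assms] matrix_mul_assoc)
  also have "\<dots> = Ad A (X ** Y)"
    unfolding id by (simp add: Ad_orthogonal[OF assms] matrix_mul_assoc)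
  finally show ?thesis by simp
qed

lemma Ad_bracket:
  assumes "orthogonal_matrix (A :: real^'n^'n)"
  shows "Ad A (bracket X Y) = bracket (Ad A X) (Ad A Y)"
  by (simp add: bracket_def linear_diff[OF linear_Ad[OF assms]] Ad_mul[OF assms])

lemma Ad_skew:
  assumes "orthogonal_matrix (A :: real^'n^'n)" "X \<in> skew_matrices"
  shows "Ad A X \<in> skew_matrices"
  using assms by (simp add: skew_matrices_def Ad_orthogonal matrix_transpose_mul matrix_mul.minus_left
      matrix_mul.minus_right matrix_mul_assoc)

lemma mat_poly_Ad:
  assumes "orthogonal_matrix (A :: real^'n^'n)"
  shows "mat_poly p (Ad A F) = Ad A (mat_poly p F)"
proof (induction p)
  case 0
  show ?case by (simp add: linear_0[OF linear_Ad[OF assms]])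
next
  case (pCons a p)
  have "Ad A (mat 1) = mat 1"
    using assms by (simp add: Ad_orthogonal orthogonal_matrix_def)
  then show ?case
    by (simp add: pCons.IH Ad_mul[OF assms] linear_add[OF linear_Ad[OF assms]] linear_cmul[OF linear_Ad[OF assms]])
qed

lemma adjoint_orbit_refl: "F \<in> adjoint_orbit F"
  unfolding adjoint_orbit_def by (rule image_eqI[of _ _ "mat 1"]) (auto simp: Ad_mat_1 rotation_matrix_mat_1)

lemma adjoint_orbit_Ad:
  "G \<in> adjoint_orbit F \<Longrightarrow> rotation_matrix A \<Longrightarrow> Ad A G \<in> adjoint_orbit F"
  by (auto simp: adjoint_orbit_def Ad_mul_orthogonal[symmetric] rotation_matrix_orthogonal intro!: imageI rotation_matrix_mul)

lemma adjoint_orbit_subset: "G \<in> adjoint_orbit F \<Longrightarrow> adjoint_orbit G \<subseteq> adjoint_orbit F"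
  using adjoint_orbit_Ad[of G F] by (auto simp: adjoint_orbit_def[of G])

lemma adjoint_orbit_eq:
  fixes F :: "real^'n^'n"
  assumes "G \<in> adjoint_orbit F"
  shows "adjoint_orbit G = adjoint_orbit F"
proof
  obtain A where A: "rotation_matrix A" "G = Ad A F" using assms by (auto simp: adjoint_orbit_def)
  then have "F = Ad (transpose A) G" by (simp add: Ad_transpose_cancel rotation_matrix_orthogonal)
  then have "F \<in> adjoint_orbit G"
    using adjoint_orbit_Ad[OF adjoint_orbit_refl rotation_matrix_transpose[OF A(1)]] by metis
  then show "adjoint_orbit F \<subseteq> adjoint_orbit G" by (rule adjoint_orbit_subset)
  show "adjoint_orbit G \<subseteq> adjoint_orbit F" using assms by (rule adjoint_orbit_subset)
qed

lemma adjoint_orbit_skew: "F \<in> skew_matrices \<Longrightarrow> G \<in> adjoint_orbit F \<Longrightarrow> G \<in> skew_matrices"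
  by (auto simp: adjoint_orbit_def Ad_skew rotation_matrix_orthogonal)

lemma continuous_on_det: "continuous_on S f \<Longrightarrow> continuous_on S (\<lambda>x. det (f x :: real^'n^'n))"
  unfolding det_def by (intro continuous_intros continuous_on_component)

lemma compact_rotation_matrices: "compact {A :: real^'n^'n. rotation_matrix A}"
proof -
  have "norm A = sqrt (real CARD('n))" if "orthogonal_matrix A" for A :: "real^'n^'n"
  proof -
    have "A \<bullet> A = (mat 1 :: real^'n^'n) \<bullet> mat 1"
      using inner_matrix_mul_right[of "mat 1" A A] that by (simp add: orthogonal_matrix_def)
    also have "\<dots> = real CARD('n)"
      by (simp add: matrix_inner mat_def if_distrib[of "\<lambda>x. x * _"] sum.delta cong: if_cong)
    finally show ?thesis by (simp add: norm_eq_sqrt_inner)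
  qed
  then have "bounded {A :: real^'n^'n. rotation_matrix A}"
    by (auto simp: bounded_iff rotation_matrix_def intro!: exI[of _ "sqrt (real CARD('n))"])
  moreover have "closed ({A :: real^'n^'n. transpose A ** A = mat 1} \<inter> {A. det A = 1})"
    by (intro closed_Int closed_Collect_eq continuous_on_det matrix_mul.continuous_on
        bounded_linear.continuous_on[OF bounded_linear_transpose] continuous_intros)
  then have "closed {A :: real^'n^'n. rotation_matrix A}"
    by (simp add: rotation_matrix_def orthogonal_matrix Collect_conj_eq)
  ultimately show ?thesis by (simp add: compact_eq_bounded_closed)
qed

lemma continuous_on_Ad: "continuous_on {A. rotation_matrix A} (\<lambda>A. Ad A (F :: real^'n^'n))"
proof -
  have "continuous_on {A. rotation_matrix A} (\<lambda>A. A ** F ** transpose A)"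
    by (intro matrix_mul.continuous_on bounded_linear.continuous_on[OF bounded_linear_transpose] continuous_intros)
  then show ?thesis
    by (rule continuous_on_eq) (simp add: Ad_orthogonal rotation_matrix_orthogonal)
qed

lemma compact_adjoint_orbit: "compact (adjoint_orbit (F :: real^'n^'n))"
  unfolding adjoint_orbit_def by (rule compact_continuous_image[OF continuous_on_Ad compact_rotation_matrices])

lemma adjoint_orbit_mat_poly:
  assumes "G \<in> adjoint_orbit F" "mat_poly p F = 0"
  shows "mat_poly p (G :: real^'n^'n) = 0"
  using assms by (auto simp: adjoint_orbit_def mat_poly_Ad rotation_matrix_orthogonal linear_0 linear_Ad)

text \<open>
  A Lie algebra element that generates the tangent vector \<open>w\<close> at \<open>G\<close>, provided that \<open>q(ad G)\<close> is a
  pseudo-inverse of \<open>ad G\<close>.  The sign comes from \<open>ad G X = - [X, G]\<close>.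
\<close>

definition orbit_lift :: "real poly \<Rightarrow> real^'n^'n \<Rightarrow> real^'n^'n \<Rightarrow> real^'n^'n" where
  "orbit_lift q G w = - op_poly (bracket G) q w"

text \<open>
  The operators \<open>ad G\<close> for \<open>G\<close> in the orbit are conjugate to \<open>ad F\<close>, so a pseudo-inverse polynomial for
  \<open>ad F\<close> serves all of them.
\<close>

lemma orbit_lift_exists:
  fixes F :: "real^'n^'n"
  assumes F: "F \<in> skew_matrices"
  obtains q where
    "\<And>G X. G \<in> adjoint_orbit F \<Longrightarrow> bracket (orbit_lift q G (bracket X G)) G = bracket X G"
proof -
  have skew: "bracket F X \<bullet> Y = - (X \<bullet> bracket F Y)" for X Y
    by (rule bracket_inner_skew[OF skew_matricesD[OF F]])
  obtain q where q: "\<And>v. op_poly (bracket F) q (bracket F (bracket F v)) = bracket F v"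
    using skew_pseudo_inverse[OF linear_bracket skew] by blast
  have "bracket (orbit_lift q G (bracket X G)) G = bracket X G" if "G \<in> adjoint_orbit F" for G X
  proof -
    obtain A where A: "orthogonal_matrix A" "G = Ad A F"
      using \<open>G \<in> adjoint_orbit F\<close> rotation_matrix_orthogonal unfolding adjoint_orbit_def by blast
    define Y where "Y = Ad (transpose A) X"
    have X: "X = Ad A Y" by (simp add: Y_def Ad_transpose_cancel A)
    have int: "Ad A (op_poly (bracket F) q v) = op_poly (bracket G) q (Ad A v)" for v
      by (rule op_poly_intertwine[OF linear_bracket linear_bracket linear_Ad[OF A(1)]])
        (simp add: A(2) Ad_bracket[OF A(1)])
    have "op_poly (bracket G) q (bracket G (bracket G X)) = op_poly (bracket G) q (Ad A (bracket F (bracket F Y)))"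
      by (simp add: A(2) X Ad_bracket[OF A(1)])
    also have "\<dots> = Ad A (bracket F Y)" by (simp add: int[symmetric] q)
    also have "\<dots> = bracket G X" by (simp add: A(2) X Ad_bracket[OF A(1)])
    finally have "op_poly (bracket G) q (bracket G (bracket G X)) = bracket G X" .
    then show ?thesis
      by (simp add: orbit_lift_def bracket_swap[of G X] bracket_swap[of "op_poly _ _ _" G]
          op_poly_commute_op[OF linear_bracket] linear_neg[OF linear_op_poly[OF linear_bracket]]
          bracket.minus_left bracket.minus_right)
  qed
  then show thesis by (rule that)
qed

lemma orbit_lift_skew:
  fixes G :: "real^'n^'n"
  assumes "G \<in> skew_matrices" "w \<in> skew_matrices"
  shows "orbit_lift q G w \<in> skew_matrices"
  using bracket_op_poly_skew[of G w q] assms by (simp add: orbit_lift_def skew_matrices_def transpose_minus)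

lemma smooth_on_orbit_lift:
  fixes \<phi> w :: "'a::euclidean_space \<Rightarrow> real^'n^'n"
  assumes "smooth_on U \<phi>" "smooth_on U w"
  shows "smooth_on U (\<lambda>x. orbit_lift q (\<phi> x) (w x))"
proof -
  have "smooth_on U (\<lambda>x. op_poly (bracket (\<phi> x)) q (w x))"
  proof (induction q)
    case 0
    show ?case using smooth_on_open[OF assms(1)] by (simp add: smooth_on_const)
  next
    case (pCons a q)
    then show ?case
      using assms by (simp add: linear_bracket smooth_on_add smooth_on_bilinear[OF bounded_bilinear_bracket]
          smooth_on_bounded_linear[OF bounded_linear_scaleR_right])
  qed
  then show ?thesis
    unfolding orbit_lift_def by (rule smooth_on_bounded_linear[OF bounded_linear_minus[OF bounded_linear_ident]])
qed

text \<open>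
  A velocity \<open>v\<close> of a curve in the orbit is skew and is killed by the derivative of an annihilating
  polynomial \<open>p\<close> of \<open>F\<close>, since \<open>p\<close> annihilates the whole curve.  Write \<open>v = [X, F] + Z\<close> with \<open>Z\<close> in the
  commutant of \<open>F\<close>.  The derivative is zero on \<open>[X, F]\<close> and multiplication by \<open>p'(F)\<close> on \<open>Z\<close>; choosing \<open>p\<close>
  separable forces \<open>Z = 0\<close>.
\<close>

lemma tangent_space_adjoint_orbit:
  fixes F0 :: "real^'n^'n"
  assumes F0: "F0 \<in> skew_matrices" and F: "F \<in> adjoint_orbit F0"
  shows "tangent_space (adjoint_orbit F0) F = (\<lambda>X. bracket X F) ` skew_matrices"
proof
  have Fs: "F \<in> skew_matrices" using adjoint_orbit_skew[OF F0 F] .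
  show "(\<lambda>X. bracket X F) ` skew_matrices \<subseteq> tangent_space (adjoint_orbit F0) F"
  proof safe
    fix X :: "real^'n^'n" assume X: "X \<in> skew_matrices"
    have "curve_at (adjoint_orbit F0) F (bracket X F) (\<lambda>t. Ad (mat_exp (t *\<^sub>R X)) F)"
      unfolding curve_at_def
      using X F by (auto simp: skew_matrices_def Ad_mat_1 Ad_exp_has_vector_derivative mat_exp_skew_rotation
          intro!: adjoint_orbit_Ad)
    then show "bracket X F \<in> tangent_space (adjoint_orbit F0) F" by (auto simp: tangent_space_def)
  qed
  show "tangent_space (adjoint_orbit F0) F \<subseteq> (\<lambda>X. bracket X F) ` skew_matrices"
  proof
    fix v assume "v \<in> tangent_space (adjoint_orbit F0) F"
    then obtain c where c: "\<And>t. c t \<in> adjoint_orbit F0" "c 0 = F" "(c has_vector_derivative v) (at 0)"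
      by (auto simp: tangent_space_def curve_at_def)
    have "((\<lambda>t. transpose (c t)) has_vector_derivative transpose v) (at 0)"
      by (rule transpose_has_vector_derivative[OF c(3)])
    moreover have "(\<lambda>t. transpose (c t)) = (\<lambda>t. - c t)"
      using adjoint_orbit_skew[OF F0 c(1)] by (simp add: skew_matrices_def)
    ultimately have v: "v \<in> skew_matrices"
      using vector_derivative_unique_at[OF _ has_vector_derivative_minus[OF c(3)]]
      by (auto simp: skew_matrices_def)
    obtain p r where p: "mat_poly p F = 0" and r: "mat_poly r F ** mat_poly (pderiv p) F = mat 1"
      using skew_matrix_separable[OF skew_matricesD[OF Fs]] by metis
    obtain D where D: "linear D"
      "((\<lambda>t. mat_poly p (c t)) has_vector_derivative D v) (at 0)"
      "\<And>X. D (bracket X F) = bracket X (mat_poly p F)"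
      "\<And>Z. Z ** F = F ** Z \<Longrightarrow> D Z = mat_poly (pderiv p) F ** Z"
      using mat_poly_derivative[of F p] c(2,3) by metis
    have "mat_poly p (c t) = 0" for t
      using adjoint_orbit_mat_poly[of "c t" F p] c(1) p adjoint_orbit_eq[OF F] by simp
    then have "D v = 0"
      using D(2) vector_derivative_unique_at[OF _ has_vector_derivative_const] by fastforce
    have skew: "bracket F X \<bullet> Y = - (X \<bullet> bracket F Y)" for X Y
      by (rule bracket_inner_skew[OF skew_matricesD[OF Fs]])
    obtain q where q: "\<And>v. op_poly (bracket F) q (bracket F (bracket F v)) = bracket F v"
      using skew_pseudo_inverse[OF linear_bracket skew] by blast
    define X where "X = - op_poly (bracket F) q v"
    have X: "X \<in> skew_matrices"
      using orbit_lift_skew[OF Fs v, of q] by (simp add: X_def orbit_lift_def)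
    define Z where "Z = v - bracket X F"
    have "bracket F Z = 0"
      using q[of v]
      by (simp add: Z_def X_def bracket_swap[of "op_poly _ _ _" F] bracket.diff_right bracket.minus_left
          op_poly_commute_op[OF linear_bracket])
    then have "D Z = mat_poly (pderiv p) F ** Z"
      by (intro D(4)) (simp add: bracket_eq_0_iff)
    moreover have "D Z = 0"
      using \<open>D v = 0\<close> by (simp add: Z_def linear_diff[OF D(1)] D(3) p bracket.zero_right)
    ultimately have "mat_poly r F ** (mat_poly (pderiv p) F ** Z) = 0"
      by (simp add: matrix_mul.zero_right)
    then have "Z = 0" by (simp add: matrix_mul_assoc r)
    then show "v \<in> (\<lambda>X. bracket X F) ` skew_matrices" using X by (auto simp: Z_def)
  qed
qed

text \<open>
  Canonical coordinates of the second kind: the factors are one-parameter groups, each depending on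
  one linear coordinate of \<open>Y\<close> only.  Their smoothness follows from the differential equation of the
  exponential in one real variable.
\<close>

primrec exp_product :: "(real^'n^'n \<Rightarrow> real^'n^'n) \<Rightarrow> (real^'n^'n) list \<Rightarrow> real^'n^'n \<Rightarrow> real^'n^'n" where
  "exp_product \<sigma> [] Y = mat 1"
| "exp_product \<sigma> (b # bs) Y = mat_exp ((Y \<bullet> b) *\<^sub>R \<sigma> b) ** exp_product \<sigma> bs Y"

lemma exp_product_0: "exp_product \<sigma> bs 0 = mat 1"
  by (induction bs) auto

lemma exp_product_rotation:
  "(\<And>b. b \<in> set bs \<Longrightarrow> \<sigma> b \<in> skew_matrices) \<Longrightarrow> rotation_matrix (exp_product \<sigma> bs Y)"
  by (induction bs) (auto simp: rotation_matrix_mat_1 skew_matrices_def intro!: rotation_matrix_mul mat_exp_skew_rotation)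

lemma mat_exp_linear_has_derivative:
  fixes X :: "real^'n^'n" and b :: "'a::euclidean_space"
  shows "((\<lambda>Y. mat_exp ((Y \<bullet> b) *\<^sub>R X)) has_derivative
    (\<lambda>h. (h \<bullet> b) *\<^sub>R (X ** mat_exp ((Y \<bullet> b) *\<^sub>R X)))) (at Y)"
proof -
  have "((\<lambda>Y. Y \<bullet> b) has_derivative (\<lambda>h. h \<bullet> b)) (at Y)"
    by (auto intro!: derivative_eq_intros)
  from diff_chain_at[OF this mat_exp_has_vector_derivative[of X, unfolded has_vector_derivative_def]]
  show ?thesis by (simp add: o_def)
qed

lemma smooth_on_mat_exp_linear:
  fixes X :: "real^'n^'n" and b :: "'a::euclidean_space"
  shows "smooth_on UNIV (\<lambda>Y. mat_exp ((Y \<bullet> b) *\<^sub>R X))"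
proof -
  have "C_k k UNIV (\<lambda>Y. mat_exp ((Y \<bullet> b) *\<^sub>R X))" for k
  proof (induction k)
    case 0
    show ?case unfolding C_k.simps
      by (rule has_derivative_continuous_on) (rule has_derivative_at_withinI[OF mat_exp_linear_has_derivative])
  next
    case (Suc k)
    show ?case
      by (rule C_k_SucI[OF mat_exp_linear_has_derivative])
        (intro C_k_bounded_linear[OF bounded_linear_scaleR_right] C_k_bounded_linear[OF matrix_mul.bounded_linear_right] Suc)
  qed
  then show ?thesis by (simp add: smooth_on_def)
qed

lemma smooth_on_exp_product: "smooth_on UNIV (exp_product \<sigma> bs)"
  by (induction bs) (auto intro!: smooth_on_const smooth_on_bilinear[OF bounded_bilinear_matrix_mul]
      smooth_on_mat_exp_linear simp: exp_product.simps[abs_def] eta_contract_eq)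

lemma exp_product_has_derivative_0:
  "distinct bs \<Longrightarrow> (exp_product \<sigma> bs has_derivative (\<lambda>h. \<Sum>b\<in>set bs. (h \<bullet> b) *\<^sub>R \<sigma> b)) (at 0)"
proof (induction bs)
  case Nil
  show ?case by (simp add: exp_product.simps[abs_def])
next
  case (Cons b bs)
  have "((\<lambda>Y. mat_exp ((Y \<bullet> b) *\<^sub>R \<sigma> b) ** exp_product \<sigma> bs Y) has_derivative
      (\<lambda>h. mat_exp ((0 \<bullet> b) *\<^sub>R \<sigma> b) ** (\<Sum>b\<in>set bs. (h \<bullet> b) *\<^sub>R \<sigma> b) +
        ((h \<bullet> b) *\<^sub>R (\<sigma> b ** mat_exp ((0 \<bullet> b) *\<^sub>R \<sigma> b))) ** exp_product \<sigma> bs 0)) (at 0)"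
    by (rule bounded_bilinear.FDERIV[OF bounded_bilinear_matrix_mul mat_exp_linear_has_derivative])
      (use Cons in auto)
  then show ?case
    using Cons.prems by (simp add: exp_product.simps[abs_def] exp_product_0 add.commute)
qed

text \<open>
  Let \<open>L\<close> be the space of brackets \<open>[X, F]\<close>.  The map \<open>\<Phi>\<close> translates \<open>F\<close> by the component of \<open>Y\<close> orthogonal
  to \<open>L\<close> and then conjugates by a rotation that moves \<open>F\<close> in the direction of the component in \<open>L\<close>.  Its
  derivative at \<open>0\<close> is the identity, so it is a local diffeomorphism; it sends \<open>L\<close> into the orbit, and
  the separable annihilator shows that it sends nothing else there.
\<close>

lemma adjoint_orbit_chart:
  fixes F :: "real^'n^'n"
  assumes F: "F \<in> skew_matrices"
  obtains U V f g where "F \<in> U" "smooth_on U f" "smooth_on V g" "homeomorphism U V f g"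
    "f ` (adjoint_orbit F \<inter> U) = (\<lambda>X. bracket X F) ` skew_matrices \<inter> V"
proof -
  define L where "L = (\<lambda>X. bracket X F) ` skew_matrices"
  have linF: "linear (\<lambda>X. bracket X F)"
    by (rule bounded_linear.linear[OF bracket.bounded_linear_left])
  have L: "subspace L" unfolding L_def
    by (rule linear_subspace_image[OF linF subspace_skew_matrices])
  obtain Bs where Bs: "Bs \<subseteq> L" "pairwise orthogonal Bs" "\<And>x. x \<in> Bs \<Longrightarrow> norm x = 1"
    "independent Bs" "span Bs = L"
    using orthonormal_basis_subspace[OF L] by metis
  have fin: "finite Bs" using Bs(4) independent_imp_finite by blast
  obtain bs where bs: "set bs = Bs" "distinct bs" using finite_distinct_list[OF fin] by blast
  have "\<exists>X\<in>skew_matrices. bracket X F = b" if "b \<in> Bs" for b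
    using Bs(1) that by (auto simp: L_def)
  then obtain \<sigma> where \<sigma>: "\<And>b. b \<in> Bs \<Longrightarrow> \<sigma> b \<in> skew_matrices" "\<And>b. b \<in> Bs \<Longrightarrow> bracket (\<sigma> b) F = b"
    by metis
  define P where "P Y = (\<Sum>b\<in>Bs. (Y \<bullet> b) *\<^sub>R b)" for Y
  have P_inner: "P Y \<bullet> b = Y \<bullet> b" if "b \<in> Bs" for Y b
  proof -
    have "P Y \<bullet> b = (\<Sum>c\<in>Bs. (Y \<bullet> c) * (c \<bullet> b))" by (simp add: P_def inner_sum_left)
    also have "\<dots> = (\<Sum>c\<in>Bs. if c = b then Y \<bullet> b else 0)"
      using Bs(2,3) that by (intro sum.cong) (auto simp: pairwise_def orthogonal_def norm_eq_1)
    finally show ?thesis using fin that by simp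
  qed
  have orthL: "(Y - P Y) \<bullet> l = 0" if "l \<in> L" for Y l
  proof -
    have "l \<in> span Bs" using that Bs(5) by simp
    then show ?thesis
    proof (induction rule: span_induct_alt)
      case (step c x y)
      then show ?case by (simp add: inner_add_right inner_diff_left P_inner)
    qed simp
  qed
  have PL: "P Y \<in> L" for Y
    unfolding P_def using Bs(1) L by (auto intro!: subspace_sum subspace_scale)
  have P_id: "P Y = Y" if "Y \<in> L" for Y
  proof -
    have "(Y - P Y) \<bullet> (Y - P Y) = 0" by (rule orthL) (use that PL L subspace_diff in blast)
    then show ?thesis by simp
  qed
  have linP: "linear P"
    by (rule linearI) (simp_all add: P_def inner_add_left scaleR_add_left sum.distrib scaleR_sum_right)
  define g where "g = exp_product \<sigma> bs"
  define \<Phi> where "\<Phi> Y = g Y ** (F + (Y - P Y)) ** transpose (g Y)" for Y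
  have g_rot: "rotation_matrix (g Y)" for Y
    unfolding g_def by (rule exp_product_rotation) (use bs \<sigma> in auto)
  have \<Phi>_Ad: "\<Phi> Y = Ad (g Y) (F + (Y - P Y))" for Y
    by (simp add: \<Phi>_def Ad_orthogonal rotation_matrix_orthogonal[OF g_rot])
  obtain p r where p: "mat_poly p F = 0" and r: "mat_poly r F ** mat_poly (pderiv p) F = mat 1"
    using skew_matrix_separable[OF skew_matricesD[OF F]] by metis
  obtain Q where Q: "continuous_on UNIV Q" "Q F = mat_poly (pderiv p) F"
    "\<And>E. E ** F = F ** E \<Longrightarrow> mat_poly p E - mat_poly p F = (E - F) ** Q E"
    using mat_poly_difference_quotient by blast
  \<comment> \<open>On \<open>W\<close> the difference quotient of \<open>p\<close> at \<open>F\<close> is invertible, which is what forces the normal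
    component of a point of the orbit to vanish.\<close>
  define W where "W = {Y. det (Q (F + (Y - P Y))) \<noteq> 0}"
  have "continuous_on UNIV (\<lambda>Y. F + (Y - P Y))"
    by (intro continuous_intros linear_continuous_on) (use linP linear_conv_bounded_linear in blast)
  then have "continuous_on UNIV (\<lambda>Y. Q (F + (Y - P Y)))"
    by (rule continuous_on_compose2[OF Q(1)]) auto
  then have W: "open W" unfolding W_def
    by (intro open_Collect_neq continuous_on_det) auto
  have "det (mat_poly r F) * det (Q F) = 1"
    by (metis Q(2) r det_mul det_I)
  then have W0: "0 \<in> W" by (auto simp: W_def linear_0[OF linP])
  have sm_g: "smooth_on UNIV g" unfolding g_def by (rule smooth_on_exp_product)
  have sm_N: "smooth_on UNIV (\<lambda>Y. F + (Y - P Y))"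
  proof -
    have "bounded_linear (\<lambda>Y. Y - P Y)"
      using linP by (intro bounded_linear_sub bounded_linear_ident) (simp add: linear_conv_bounded_linear)
    then show ?thesis
      by (intro smooth_on_add smooth_on_const) (auto intro: smooth_on_bounded_linear[OF _ smooth_on_id])
  qed
  have "smooth_on UNIV \<Phi>"
    unfolding \<Phi>_def
    by (intro smooth_on_bilinear[OF bounded_bilinear_matrix_mul] sm_g sm_N smooth_on_bounded_linear[OF bounded_linear_transpose])
  then have smW: "smooth_on W \<Phi>" using W smooth_on_subset by blast
  define S where "S h = (\<Sum>b\<in>Bs. (h \<bullet> b) *\<^sub>R \<sigma> b)" for h
  have dg: "(g has_derivative S) (at 0)"
    unfolding g_def S_def[abs_def] using exp_product_has_derivative_0[OF bs(2), of \<sigma>] bs(1) by simp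
  have dN: "((\<lambda>Y. F + (Y - P Y)) has_derivative (\<lambda>h. h - P h)) (at 0)"
    using linP by (auto intro!: derivative_eq_intros linear_imp_has_derivative)
  have g0: "g 0 = mat 1" by (simp add: g_def exp_product_0)
  have "(\<Phi> has_derivative (\<lambda>h. g 0 ** (F + (0 - P 0)) ** transpose (S h) +
      (g 0 ** (h - P h) + S h ** (F + (0 - P 0))) ** transpose (g 0))) (at 0)"
    unfolding \<Phi>_def[abs_def]
    by (intro bounded_bilinear.FDERIV[OF bounded_bilinear_matrix_mul] dg dN
        bounded_linear.has_derivative[OF bounded_linear_transpose])
  moreover have "g 0 ** (F + (0 - P 0)) ** transpose (S h) +
      (g 0 ** (h - P h) + S h ** (F + (0 - P 0))) ** transpose (g 0) = h" for h
  proof -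
    have "S h \<in> skew_matrices"
      unfolding S_def using \<sigma>(1) subspace_skew_matrices by (auto intro!: subspace_sum subspace_scale)
    then have "transpose (S h) = - S h" by (rule skew_matricesD)
    moreover have "bracket (S h) F = P h"
      unfolding S_def P_def by (simp add: linear_sum[OF linF] linear_cmul[OF linF] \<sigma>(2))
    ultimately show ?thesis
      by (simp add: g0 linear_0[OF linP] bracket_def matrix_mul.minus_right matrix_mul.add_left algebra_simps)
  qed
  ultimately have d\<Phi>: "(\<Phi> has_derivative (\<lambda>h. h)) (at 0)" by simp
  obtain U V f where U: "open U" "0 \<in> U" "U \<subseteq> W" "smooth_on U \<Phi>" "smooth_on V f" "homeomorphism U V \<Phi> f"
    by (rule smooth_inverse_function[OF smW W0 d\<Phi>]) auto
  have UV: "\<And>Y. Y \<in> U \<Longrightarrow> \<Phi> Y \<in> V \<and> f (\<Phi> Y) = Y" "\<And>G. G \<in> V \<Longrightarrow> f G \<in> U \<and> \<Phi> (f G) = G"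
    using U(6) by (auto simp: homeomorphism_def)
  have \<Phi>0: "\<Phi> 0 = F" by (simp add: \<Phi>_def g0 linear_0[OF linP])
  have normal: "Y \<in> L" if Y: "Y \<in> U" "\<Phi> Y \<in> adjoint_orbit F" for Y
  proof -
    define Z where "Z = Y - P Y"
    have "Ad (transpose (g Y)) (\<Phi> Y) = F + Z"
      by (simp add: \<Phi>_Ad Z_def Ad_transpose_cancel rotation_matrix_orthogonal[OF g_rot])
    then have FZ: "F + Z \<in> adjoint_orbit F"
      using adjoint_orbit_Ad[OF Y(2) rotation_matrix_transpose[OF g_rot]] by metis
    have "Z \<in> skew_matrices"
      using adjoint_orbit_skew[OF F FZ] F by (simp add: skew_matrices_def transpose_add)
    then have br: "bracket F Z \<in> skew_matrices" using F bracket_in_skew by blast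
    have "bracket F Z \<bullet> bracket F Z = - (Z \<bullet> bracket F (bracket F Z))"
      by (rule bracket_inner_skew[OF skew_matricesD[OF F]])
    also have "\<dots> = Z \<bullet> bracket (bracket F Z) F" by (simp add: bracket_swap[of F "bracket F Z"])
    also have "\<dots> = 0" unfolding Z_def by (rule orthL) (use br in \<open>auto simp: L_def Z_def\<close>)
    finally have comm: "F ** Z = Z ** F" by (simp add: bracket_eq_0_iff)
    then have "mat_poly p (F + Z) - mat_poly p F = (F + Z - F) ** Q (F + Z)"
      by (intro Q(3)) (simp add: matrix_mul.add_left matrix_mul.add_right)
    then have "Z ** Q (F + Z) = 0"
      using p adjoint_orbit_mat_poly[OF FZ p] by simp
    moreover have "invertible (Q (F + Z))"
      using Y U(3) by (auto simp: W_def Z_def invertible_det_nz)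
    then obtain R where "Q (F + Z) ** R = mat 1" by (auto simp: invertible_def)
    ultimately have "Z = 0"
      by (metis matrix_mul.zero_left matrix_mul_assoc matrix_mul_rid)
    then have "Y = P Y" by (simp add: Z_def)
    then show "Y \<in> L" using PL by metis
  qed
  have "f ` (adjoint_orbit F \<inter> V) = L \<inter> U"
  proof safe
    fix G assume G: "G \<in> adjoint_orbit F" "G \<in> V"
    show "f G \<in> U" using UV(2)[OF G(2)] by simp
    then show "f G \<in> L" by (rule normal) (use UV(2)[OF G(2)] G(1) in simp)
  next
    fix Y assume Y: "Y \<in> L" "Y \<in> U"
    have "\<Phi> Y = Ad (g Y) F" by (simp add: \<Phi>_Ad P_id[OF Y(1)])
    then have "\<Phi> Y \<in> adjoint_orbit F"
      using adjoint_orbit_Ad[OF adjoint_orbit_refl g_rot] by simp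
    then show "Y \<in> f ` (adjoint_orbit F \<inter> V)"
      using UV(1)[OF Y(2)] by (metis IntI image_eqI)
  qed
  moreover have "F \<in> V" using UV(1)[OF U(2)] \<Phi>0 by simp
  ultimately show thesis
    using that[of V f U \<Phi>] U homeomorphism_symD[OF U(6)] by (simp add: L_def)
qed

text \<open>
  The tangent spaces at two points of the orbit correspond under conjugation, so the charts at all
  points have the same dimension.
\<close>

theorem smooth_submanifold_adjoint_orbit:
  fixes F0 :: "real^'n^'n"
  assumes F0: "F0 \<in> skew_matrices"
  shows "smooth_submanifold (adjoint_orbit F0)"
  unfolding smooth_submanifold_def
proof (intro exI[of _ "dim ((\<lambda>X. bracket X F0) ` skew_matrices)"] ballI)
  fix F assume F: "F \<in> adjoint_orbit F0"
  have Fs: "F \<in> skew_matrices" using adjoint_orbit_skew[OF F0 F] .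
  obtain A where A: "orthogonal_matrix A" "F = Ad A F0"
    using F rotation_matrix_orthogonal unfolding adjoint_orbit_def by blast
  have AtA: "orthogonal_matrix (transpose A)" using A by simp
  have skewA: "Ad A ` skew_matrices = skew_matrices"
  proof
    show "Ad A ` skew_matrices \<subseteq> skew_matrices" using Ad_skew[OF A(1)] by auto
    show "skew_matrices \<subseteq> Ad A ` skew_matrices"
      using Ad_skew[OF AtA] Ad_transpose_cancel(2)[OF A(1)] by (metis image_eqI subsetI)
  qed
  have "(\<lambda>X. bracket X F) ` skew_matrices = (\<lambda>X. bracket X F) ` Ad A ` skew_matrices" by (simp add: skewA)
  also have "\<dots> = Ad A ` (\<lambda>X. bracket X F0) ` skew_matrices"
    by (simp add: image_image A(2) Ad_bracket[OF A(1)])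
  finally have dim: "dim ((\<lambda>X. bracket X F) ` skew_matrices) = dim ((\<lambda>X. bracket X F0) ` skew_matrices)"
    using dim_image_eq[OF linear_Ad[OF A(1)]] Ad_transpose_cancel(1)[OF A(1)] by (metis inj_on_inverseI)
  have "subspace ((\<lambda>X. bracket X F) ` skew_matrices)"
    by (rule linear_subspace_image[OF bounded_linear.linear[OF bracket.bounded_linear_left] subspace_skew_matrices])
  note S = this
  obtain U V f g where chart: "F \<in> U" "smooth_on U f" "smooth_on V g" "homeomorphism U V f g"
    "f ` (adjoint_orbit F0 \<inter> U) = (\<lambda>X. bracket X F) ` skew_matrices \<inter> V"
    by (rule adjoint_orbit_chart[OF Fs, unfolded adjoint_orbit_eq[OF F]]) blast
  show "\<exists>U V f g S. F \<in> U \<and> smooth_on U f \<and> smooth_on V g \<and> homeomorphism U V f g \<and>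
      subspace (S :: (real^'n^'n) set) \<and> dim S = dim ((\<lambda>X. bracket X F0) ` skew_matrices) \<and> f ` (adjoint_orbit F0 \<inter> U) = S \<inter> V"
    by (rule exI[of _ U], rule exI[of _ V], rule exI[of _ f], rule exI[of _ g],
        rule exI[of _ "(\<lambda>X. bracket X F) ` skew_matrices"]) (intro conjI chart S dim)
qed

section \<open>The symplectic form of the orbit\<close>

lemma so6_eq: "so6 = skew_matrices"
  by (simp add: so6_def skew_matrices_def)

text \<open>
  An invariant inner product is only constrained on skew matrices.  Precomposing with the projection to
  the skew part gives a bilinear form on all matrices, to which the product rule applies.
\<close>

definition skew_extension :: "(real^6^6 \<Rightarrow> real^6^6 \<Rightarrow> real) \<Rightarrow> real^6^6 \<Rightarrow> real^6^6 \<Rightarrow> real" where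
  "skew_extension B X Y = B ((1/2) *\<^sub>R (X - transpose X)) ((1/2) *\<^sub>R (Y - transpose Y))"

lemma skew_part:
  "(1/2) *\<^sub>R (X - transpose X) \<in> skew_matrices"
  "X \<in> skew_matrices \<Longrightarrow> (1/2) *\<^sub>R (X - transpose X) = (X :: real^'n^'n)"
  by (auto simp: skew_matrices_def transpose_scaleR transpose_diff scaleR_2[symmetric] algebra_simps)

lemma invariant_left_linear:
  "invariant_inner_product B \<Longrightarrow> X \<in> skew_matrices \<Longrightarrow> Y \<in> skew_matrices \<Longrightarrow> Z \<in> skew_matrices \<Longrightarrow>
    B (a *\<^sub>R X + b *\<^sub>R Y) Z = a * B X Z + b * B Y Z"
  by (simp add: invariant_inner_product_def so6_eq)

lemma invariant_symmetric:
  "invariant_inner_product B \<Longrightarrow> X \<in> skew_matrices \<Longrightarrow> Y \<in> skew_matrices \<Longrightarrow> B X Y = B Y X"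
  by (simp add: invariant_inner_product_def so6_eq)

lemma invariant_positive:
  assumes "invariant_inner_product B" "X \<in> skew_matrices" "B X X = 0"
  shows "X = 0"
proof (rule ccontr)
  assume "X \<noteq> 0"
  then have "B X X > 0" using assms(1,2) unfolding invariant_inner_product_def so6_eq by blast
  then show False using assms(3) by simp
qed

lemma invariant_Ad:
  "invariant_inner_product B \<Longrightarrow> rotation_matrix A \<Longrightarrow> X \<in> skew_matrices \<Longrightarrow> Y \<in> skew_matrices \<Longrightarrow>
    B (Ad A X) (Ad A Y) = B X Y"
  by (simp add: invariant_inner_product_def so6_eq SO6_def)

lemma skew_extension_eq:
  "X \<in> skew_matrices \<Longrightarrow> Y \<in> skew_matrices \<Longrightarrow> skew_extension B X Y = B X Y"
  by (simp add: skew_extension_def skew_part)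

lemma bounded_bilinear_skew_extension:
  assumes B: "invariant_inner_product B"
  shows "bounded_bilinear (skew_extension B)"
proof -
  let ?s = "\<lambda>X :: real^6^6. (1/2) *\<^sub>R (X - transpose X)"
  have s: "?s (X + Y) = 1 *\<^sub>R ?s X + 1 *\<^sub>R ?s Y" "?s (c *\<^sub>R X) = c *\<^sub>R ?s X + 0 *\<^sub>R ?s X" for X Y c
    by (simp_all add: transpose_add transpose_scaleR algebra_simps)
  have left: "skew_extension B (X + Y) Z = skew_extension B X Z + skew_extension B Y Z"
    "skew_extension B (c *\<^sub>R X) Z = c *\<^sub>R skew_extension B X Z" for X Y Z c
    unfolding skew_extension_def s by (subst invariant_left_linear[OF B]; simp add: skew_part)+
  have sym: "skew_extension B X Y = skew_extension B Y X" for X Y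
    unfolding skew_extension_def by (rule invariant_symmetric[OF B skew_part(1) skew_part(1)])
  have "bilinear (skew_extension B)"
    unfolding bilinear_def
  proof safe
    fix Z
    show "linear (\<lambda>X. skew_extension B X Z)" by (rule linearI) (rule left)+
    moreover have "skew_extension B Z = (\<lambda>X. skew_extension B X Z)"
      by (rule ext) (rule sym)
    ultimately show "linear (skew_extension B Z)" by simp
  qed
  then show ?thesis by (simp add: bilinear_conv_bounded_bilinear)
qed

text \<open>
  Derivative of the invariance under the one-parameter group of \<open>X\<close>.
\<close>

lemma invariant_bracket:
  assumes B: "invariant_inner_product B"
    and X: "X \<in> skew_matrices" and Y: "Y \<in> skew_matrices" and Z: "Z \<in> skew_matrices"
  shows "B (bracket X Y) Z = - B Y (bracket X Z)"
proof -
  let ?E = "\<lambda>t. mat_exp (t *\<^sub>R X)"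
  have rot: "rotation_matrix (?E t)" for t
    by (rule mat_exp_skew_rotation[OF skew_matricesD[OF X]])
  have "((\<lambda>t. skew_extension B (Ad (?E t) Y) (Ad (?E t) Z)) has_vector_derivative
      skew_extension B (Ad (?E 0) Y) (bracket X Z) + skew_extension B (bracket X Y) (Ad (?E 0) Z)) (at 0)"
    by (intro bounded_bilinear.has_vector_derivative[OF bounded_bilinear_skew_extension[OF B]]
        Ad_exp_has_vector_derivative skew_matricesD[OF X])
  moreover have "skew_extension B (Ad (?E t) Y) (Ad (?E t) Z) = B Y Z" for t
    using rot[of t] Y Z
    by (simp add: skew_extension_eq Ad_skew rotation_matrix_orthogonal invariant_Ad[OF B])
  ultimately have "((\<lambda>t. B Y Z) has_vector_derivative B Y (bracket X Z) + B (bracket X Y) Z) (at (0::real))"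
    by (simp add: Ad_mat_1 skew_extension_eq X Y Z bracket_in_skew)
  from vector_derivative_unique_at[OF this has_vector_derivative_const] show ?thesis by simp
qed

lemma invariant_bracket_assoc:
  assumes "invariant_inner_product B"
    "F \<in> skew_matrices" "X \<in> skew_matrices" "Y \<in> skew_matrices"
  shows "B (bracket X F) Y = - B F (bracket X Y)"
  by (rule invariant_bracket[OF assms(1,3,2,4)])

lemma invariant_minus_right:
  assumes "invariant_inner_product B" "X \<in> skew_matrices" "Y \<in> skew_matrices"
  shows "B X (- Y) = - B X Y"
proof -
  have "- Y \<in> skew_matrices" using assms(3) by (simp add: skew_matrices_def transpose_minus)
  then show ?thesis
    using bounded_bilinear.minus_right[OF bounded_bilinear_skew_extension[OF assms(1)], of X Y]
    by (simp add: skew_extension_eq assms)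
qed

text \<open>
  The form is well defined: by invariance, \<open>B F [X, Y]\<close> depends on \<open>X\<close> and \<open>Y\<close> only through \<open>[X, F]\<close>
  and \<open>[Y, F]\<close>.
\<close>

lemma KKS_bracket:
  assumes B: "invariant_inner_product B"
    and F: "F \<in> skew_matrices" and X: "X \<in> skew_matrices" and Y: "Y \<in> skew_matrices"
  shows "KKS B F (bracket X F) (bracket Y F) = B F (bracket X Y)"
proof -
  have gen: "generated_field Ad X F = bracket X F" if "X \<in> skew_matrices" for X
    by (rule generated_field_Ad[OF skew_matricesD[OF that]])
  have swap: "B F (bracket X Y) = - B F (bracket Y X)" if "X \<in> skew_matrices" "Y \<in> skew_matrices" for X Y
    using invariant_minus_right[OF B F bracket_in_skew[OF that(2,1)]] by (simp add: bracket_swap[of X Y])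
  show ?thesis
    unfolding KKS_def so6_eq
  proof (rule the_equality)
    show "\<exists>X'\<in>skew_matrices. \<exists>Y'\<in>skew_matrices. bracket X F = generated_field Ad X' F \<and>
        bracket Y F = generated_field Ad Y' F \<and> B F (bracket X Y) = B F (bracket X' Y')"
      using X Y gen by metis
  next
    fix r assume "\<exists>X'\<in>skew_matrices. \<exists>Y'\<in>skew_matrices. bracket X F = generated_field Ad X' F \<and>
        bracket Y F = generated_field Ad Y' F \<and> r = B F (bracket X' Y')"
    then obtain X' Y' where *: "X' \<in> skew_matrices" "Y' \<in> skew_matrices" "bracket X F = bracket X' F"
      "bracket Y F = bracket Y' F" "r = B F (bracket X' Y')"
      using gen by auto
    have "B F (bracket X' Y') = - B (bracket X F) Y'"
      using invariant_bracket_assoc[OF B F *(1,2)] by (simp add: *(3))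
    also have "\<dots> = B F (bracket X Y')"
      using invariant_bracket_assoc[OF B F X *(2)] by simp
    also have "\<dots> = B (bracket Y F) X"
      using invariant_bracket_assoc[OF B F *(2) X] swap[OF X *(2)] by (simp add: *(4))
    also have "\<dots> = B F (bracket X Y)"
      using invariant_bracket_assoc[OF B F Y X] swap[OF X Y] by simp
    finally show "r = B F (bracket X Y)" using *(5) by simp
  qed
qed

lemma derivative_in_tangent_space:
  assumes "smooth_map_into U \<phi> M" "x \<in> U"
  shows "frechet_derivative \<phi> (at x) v \<in> tangent_space M (\<phi> x)"
proof -
  have U: "open U" and sm: "smooth_on U \<phi>" and into: "\<phi> ` U \<subseteq> M"
    using assms(1) by (auto simp: smooth_map_into_def smooth_on_def)
  \<comment> \<open>A curve has to stay in \<open>M\<close> for all times; only times near \<open>0\<close> matter for its velocity.\<close>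
  define c where "c t = (if x + t *\<^sub>R v \<in> U then \<phi> (x + t *\<^sub>R v) else \<phi> x)" for t :: real
  have "((\<lambda>t. x + t *\<^sub>R v) has_vector_derivative v) (at 0)"
    by (auto intro!: derivative_eq_intros)
  then have "(\<phi> \<circ> (\<lambda>t. x + t *\<^sub>R v) has_derivative frechet_derivative \<phi> (at x) \<circ> (\<lambda>h. h *\<^sub>R v)) (at 0)"
    unfolding has_vector_derivative_def
    by (rule diff_chain_at) (simp add: smooth_on_has_derivative[OF sm assms(2)])
  moreover have "frechet_derivative \<phi> (at x) (h *\<^sub>R v) = h *\<^sub>R frechet_derivative \<phi> (at x) v" for h
    by (rule linear_cmul[OF has_derivative_linear[OF smooth_on_has_derivative[OF sm assms(2)]]])
  ultimately have 1: "((\<lambda>t. \<phi> (x + t *\<^sub>R v)) has_vector_derivative frechet_derivative \<phi> (at x) v) (at 0)"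
    by (simp add: o_def has_vector_derivative_def)
  have "open ((\<lambda>t :: real. x + t *\<^sub>R v) -` U)"
    by (intro open_vimage U continuous_intros)
  then have "(c has_vector_derivative frechet_derivative \<phi> (at x) v) (at 0)"
    using has_vector_derivative_transform_within_open[OF 1, of "(\<lambda>t :: real. x + t *\<^sub>R v) -` U" c] assms(2) by (auto simp: c_def)
  moreover have "c t \<in> M" for t using into assms(2) by (auto simp: c_def)
  moreover have "c 0 = \<phi> x" by (simp add: c_def)
  ultimately show ?thesis unfolding tangent_space_def curve_at_def by blast
qed

lemma derivative_skew:
  assumes sm: "smooth_on U f" and "x \<in> U" and skew: "\<And>y. y \<in> U \<Longrightarrow> f y \<in> skew_matrices"
  shows "frechet_derivative f (at x) v \<in> (skew_matrices :: (real^'n^'n) set)"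
proof -
  let ?D = "frechet_derivative f (at x)"
  note D = smooth_on_has_derivative[OF sm assms(2)]
  have "((\<lambda>y. - f y) has_derivative (\<lambda>h. transpose (?D h))) (at x)"
    by (rule has_derivative_transform_within_open[OF bounded_linear.has_derivative[OF bounded_linear_transpose D]
          smooth_on_open[OF sm] assms(2)]) (use skew in \<open>simp add: skew_matrices_def\<close>)
  from has_derivative_unique[OF this has_derivative_minus[OF D]]
  show ?thesis by (simp add: skew_matrices_def fun_eq_iff)
qed

text \<open>
  The algebra behind closedness.  \<open>X, Y, Z\<close> stand for the Lie algebra elements that generate three
  coordinate vector fields, and \<open>XY\<close> for the derivative of \<open>Y\<close> in the direction of \<open>X\<close>; the hypotheses
  express that second derivatives commute.  Invariance of \<open>B\<close> turns all terms into brackets paired with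
  \<open>F\<close>, and they cancel by the Jacobi identity.
\<close>

lemma KKS_cocycle:
  assumes B: "invariant_inner_product B"
    and skew: "F \<in> skew_matrices" "X \<in> skew_matrices" "Y \<in> skew_matrices" "Z \<in> skew_matrices"
      "XY \<in> skew_matrices" "YX \<in> skew_matrices" "YZ \<in> skew_matrices" "ZY \<in> skew_matrices"
      "ZX \<in> skew_matrices" "XZ \<in> skew_matrices"
    and XY: "bracket (XY - YX) F = bracket (bracket X Y) F"
    and YZ: "bracket (YZ - ZY) F = bracket (bracket Y Z) F"
    and ZX: "bracket (ZX - XZ) F = bracket (bracket Z X) F"
  shows "B (bracket X F) (bracket Y Z) + B F (bracket XY Z + bracket Y XZ) +
    (B (bracket Y F) (bracket Z X) + B F (bracket YZ X + bracket Z YX)) +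
    (B (bracket Z F) (bracket X Y) + B F (bracket ZX Y + bracket X ZY)) = 0"
proof -
  let ?B = "skew_extension B"
  interpret B: bounded_bilinear ?B by (rule bounded_bilinear_skew_extension[OF B])
  have sub: "P - Q \<in> skew_matrices" "P + Q \<in> skew_matrices" if "P \<in> skew_matrices" "Q \<in> skew_matrices" for P Q :: "real^6^6"
    using that subspace_skew_matrices subspace_diff subspace_add by blast+
  have ad: "?B (bracket P F) Q = - ?B F (bracket P Q)" if "P \<in> skew_matrices" "Q \<in> skew_matrices" for P Q
    using invariant_bracket_assoc[OF B skew(1) that] that by (simp add: skew_extension_eq bracket_in_skew skew)
  have J: "?B F (bracket X (bracket Y Z)) + ?B F (bracket Y (bracket Z X)) + ?B F (bracket Z (bracket X Y)) = 0"
    using bracket_jacobi[of X Y Z] by (simp add: B.add_right[symmetric] B.zero_right)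
  have pair: "?B F (bracket P R) + ?B F (bracket R Q) = - ?B F (bracket R C)"
    if "P \<in> skew_matrices" "Q \<in> skew_matrices" "R \<in> skew_matrices" "C \<in> skew_matrices"
      "bracket (P - Q) F = bracket C F" for P Q R C
  proof -
    have "?B F (bracket P R) + ?B F (bracket R Q) = ?B F (bracket (P - Q) R)"
      by (simp add: bracket.diff_left bracket_swap[of R Q] B.minus_right B.diff_right)
    also have "\<dots> = - ?B (bracket C F) R" using ad[of "P - Q" R] that sub by simp
    also have "\<dots> = ?B F (bracket C R)" using ad[of C R] that by simp
    finally show ?thesis by (simp add: bracket_swap[of C R] B.minus_right)
  qed
  have "?B (bracket X F) (bracket Y Z) + ?B F (bracket XY Z + bracket Y XZ) +
    (?B (bracket Y F) (bracket Z X) + ?B F (bracket YZ X + bracket Z YX)) +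
    (?B (bracket Z F) (bracket X Y) + ?B F (bracket ZX Y + bracket X ZY)) = 0"
    using J pair[of XY YX Z "bracket X Y"] pair[of YZ ZY X "bracket Y Z"] pair[of ZX XZ Y "bracket Z X"]
      XY YZ ZX skew
    by (simp add: ad bracket_in_skew B.add_right)
  then show ?thesis using skew by (simp add: skew_extension_eq bracket_in_skew sub)
qed

context
  fixes B :: "real^6^6 \<Rightarrow> real^6^6 \<Rightarrow> real" and F0 :: "real^6^6"
  assumes B: "invariant_inner_product B" and F0: "F0 \<in> skew_matrices"
begin

lemma tangent_orbit:
  "p \<in> adjoint_orbit F0 \<Longrightarrow> tangent_space (adjoint_orbit F0) p = (\<lambda>X. bracket X p) ` skew_matrices"
  by (rule tangent_space_adjoint_orbit[OF F0])

lemma orbit_skew: "p \<in> adjoint_orbit F0 \<Longrightarrow> p \<in> skew_matrices"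
  by (rule adjoint_orbit_skew[OF F0])

lemma KKS_lift:
  assumes q: "\<And>G X. G \<in> adjoint_orbit F0 \<Longrightarrow> bracket (orbit_lift q G (bracket X G)) G = bracket X G"
    and p: "p \<in> adjoint_orbit F0"
    and v: "v \<in> tangent_space (adjoint_orbit F0) p" and w: "w \<in> tangent_space (adjoint_orbit F0) p"
  shows "KKS B p v w = B p (bracket (orbit_lift q p v) (orbit_lift q p w))"
    and "orbit_lift q p v \<in> skew_matrices" and "bracket (orbit_lift q p v) p = v"
proof -
  have lift: "orbit_lift q p v \<in> skew_matrices \<and> bracket (orbit_lift q p v) p = v"
    if "v \<in> tangent_space (adjoint_orbit F0) p" for v
    using that q[OF p] orbit_skew[OF p]
    by (auto simp: tangent_orbit[OF p] intro!: orbit_lift_skew bracket_in_skew)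
  show "KKS B p v w = B p (bracket (orbit_lift q p v) (orbit_lift q p w))"
    using KKS_bracket[OF B orbit_skew[OF p], of "orbit_lift q p v" "orbit_lift q p w"] lift[OF v] lift[OF w] by simp
  show "orbit_lift q p v \<in> skew_matrices" "bracket (orbit_lift q p v) p = v" using lift[OF v] by auto
qed

text \<open>
  Along a smooth map into the orbit, the generating Lie algebra elements can be chosen smoothly, which
  makes the pullback of the form an explicit smooth expression.
\<close>

lemma pullback_KKS:
  assumes q: "\<And>G X. G \<in> adjoint_orbit F0 \<Longrightarrow> bracket (orbit_lift q G (bracket X G)) G = bracket X G"
    and \<phi>: "smooth_map_into U \<phi> (adjoint_orbit F0)" and x: "x \<in> U"
  defines "X \<equiv> \<lambda>v y. orbit_lift q (\<phi> y) (frechet_derivative \<phi> (at y) v)"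
  shows "pullback \<phi> (KKS B) x v w = skew_extension B (\<phi> x) (bracket (X v x) (X w x))"
    and "X v x \<in> skew_matrices" and "bracket (X v x) (\<phi> x) = frechet_derivative \<phi> (at x) v"
    and "smooth_on U (X v)"
proof -
  have p: "\<phi> x \<in> adjoint_orbit F0" and sm: "smooth_on U \<phi>" using \<phi> x by (auto simp: smooth_map_into_def)
  note t = derivative_in_tangent_space[OF \<phi> x]
  note K = KKS_lift[OF q p t t]
  show X: "X v x \<in> skew_matrices" "bracket (X v x) (\<phi> x) = frechet_derivative \<phi> (at x) v" for v
    using K(2,3) by (auto simp: X_def)
  show "pullback \<phi> (KKS B) x v w = skew_extension B (\<phi> x) (bracket (X v x) (X w x))"
    using K(1)[of v w] X(1) orbit_skew[OF p] by (simp add: pullback_def X_def skew_extension_eq bracket_in_skew)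
  show "smooth_on U (X v)"
    unfolding X_def by (intro smooth_on_orbit_lift sm smooth_on_frechet_derivative)
qed

lemma smooth_two_form_KKS: "smooth_two_form (adjoint_orbit F0) (KKS B)"
  unfolding smooth_two_form_def
proof (intro conjI ballI allI impI)
  fix p u v w a b assume p: "p \<in> adjoint_orbit F0" and
    t: "u \<in> tangent_space (adjoint_orbit F0) p" "v \<in> tangent_space (adjoint_orbit F0) p"
       "w \<in> tangent_space (adjoint_orbit F0) p"
  interpret Be: bounded_bilinear "skew_extension B" by (rule bounded_bilinear_skew_extension[OF B])
  from t obtain X Y Z where XYZ: "X \<in> skew_matrices" "Y \<in> skew_matrices" "Z \<in> skew_matrices"
    "u = bracket X p" "v = bracket Y p" "w = bracket Z p"
    by (auto simp: tangent_orbit[OF p])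
  have K: "KKS B p (bracket P p) (bracket Q p) = skew_extension B p (bracket P Q)"
    if "P \<in> skew_matrices" "Q \<in> skew_matrices" for P Q
    using KKS_bracket[OF B orbit_skew[OF p] that] that orbit_skew[OF p] by (simp add: skew_extension_eq bracket_in_skew)
  have ab: "a *\<^sub>R X + b *\<^sub>R Y \<in> skew_matrices"
    using XYZ(1,2) by (intro subspace_add[OF subspace_skew_matrices] subspace_scale[OF subspace_skew_matrices])
  have lin: "a *\<^sub>R u + b *\<^sub>R v = bracket (a *\<^sub>R X + b *\<^sub>R Y) p"
    by (simp add: XYZ bracket.add_left bracket.scaleR_left)
  show "KKS B p (a *\<^sub>R u + b *\<^sub>R v) w = a * KKS B p u w + b * KKS B p v w"
    unfolding lin unfolding XYZ(4-6) K[OF ab XYZ(3)] K[OF XYZ(1,3)] K[OF XYZ(2,3)]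
    by (simp add: bracket.add_left bracket.scaleR_left Be.add_right Be.scaleR_right)
  show "KKS B p w (a *\<^sub>R u + b *\<^sub>R v) = a * KKS B p w u + b * KKS B p w v"
    unfolding lin unfolding XYZ(4-6) K[OF XYZ(3) ab] K[OF XYZ(3,1)] K[OF XYZ(3,2)]
    by (simp add: bracket.add_right bracket.scaleR_right Be.add_right Be.scaleR_right)
  show "KKS B p u u = 0"
    using XYZ by (simp add: K) (simp add: bracket_def Be.zero_right)
next
  fix U and \<phi> :: "real^6^6 \<Rightarrow> real^6^6" and v w assume \<phi>: "smooth_map_into U \<phi> (adjoint_orbit F0)"
  obtain q where q: "\<And>G X. G \<in> adjoint_orbit F0 \<Longrightarrow> bracket (orbit_lift q G (bracket X G)) G = bracket X G"
    by (rule orbit_lift_exists[OF F0]) blast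
  have sm: "smooth_on U \<phi>" using \<phi> by (simp add: smooth_map_into_def)
  have smX: "smooth_on U (\<lambda>y. orbit_lift q (\<phi> y) (frechet_derivative \<phi> (at y) v))" for v
    by (intro smooth_on_orbit_lift sm smooth_on_frechet_derivative)
  show "smooth_on U (\<lambda>x. pullback \<phi> (KKS B) x v w)"
    by (rule smooth_on_cong[OF smooth_on_bilinear[OF bounded_bilinear_skew_extension[OF B] sm
            smooth_on_bilinear[OF bounded_bilinear_bracket smX[of v] smX[of w]]]])
      (rule pullback_KKS(1)[OF q \<phi>, symmetric])
qed

lemma closed_two_form_KKS: "closed_two_form (adjoint_orbit F0) (KKS B)"
  unfolding closed_two_form_def
proof (intro ballI allI impI)
  fix U and \<phi> :: "real^6^6 \<Rightarrow> real^6^6" and x u v w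
  assume \<phi>: "smooth_map_into U \<phi> (adjoint_orbit F0)" and x: "x \<in> U"
  obtain q where q: "\<And>G X. G \<in> adjoint_orbit F0 \<Longrightarrow> bracket (orbit_lift q G (bracket X G)) G = bracket X G"
    by (rule orbit_lift_exists[OF F0]) blast
  have sm: "smooth_on U \<phi>" using \<phi> by (simp add: smooth_map_into_def)
  have p: "\<phi> x \<in> skew_matrices" using \<phi> x orbit_skew by (auto simp: smooth_map_into_def)
  define X where "X v y = orbit_lift q (\<phi> y) (frechet_derivative \<phi> (at y) v)" for v y
  have pull: "pullback \<phi> (KKS B) y v w = skew_extension B (\<phi> y) (bracket (X v y) (X w y))"
    and X: "X v y \<in> skew_matrices" "bracket (X v y) (\<phi> y) = frechet_derivative \<phi> (at y) v"
    if "y \<in> U" for y v w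
    using pullback_KKS[OF q \<phi> that] by (auto simp: X_def)
  have smX: "smooth_on U (X v)" for v
    using pullback_KKS(4)[OF q \<phi> x] by (simp add: X_def[abs_def])
  define DX where "DX u v = frechet_derivative (X v) (at x) u" for u v
  have DXs: "DX u v \<in> skew_matrices" for u v
    unfolding DX_def by (rule derivative_skew[OF smX x X(1)])
  have dX: "(X v has_derivative (\<lambda>u. DX u v)) (at x)" for v
    using smooth_on_has_derivative[OF smX x] by (simp add: DX_def eta_contract_eq)
  let ?D = "\<lambda>v. frechet_derivative \<phi> (at x) v"
  have d\<phi>: "(\<phi> has_derivative ?D) (at x)" by (rule smooth_on_has_derivative[OF sm x])
  have second: "frechet_derivative (\<lambda>y. frechet_derivative \<phi> (at y) v) (at x) u =
      bracket (X v x) (?D u) + bracket (DX u v) (\<phi> x)" for u v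
  proof -
    have "((\<lambda>y. frechet_derivative \<phi> (at y) v) has_derivative
        (\<lambda>u. bracket (X v x) (?D u) + bracket (DX u v) (\<phi> x))) (at x)"
      by (rule has_derivative_transform_within_open[OF bounded_bilinear.FDERIV[OF bounded_bilinear_bracket dX d\<phi>]
            smooth_on_open[OF sm] x]) (rule X(2))
    then show ?thesis by (rule fun_cong[OF frechet_derivative_at, symmetric])
  qed
  have comm: "bracket (DX u v - DX v u) (\<phi> x) = bracket (bracket (X u x) (X v x)) (\<phi> x)" for u v
  proof -
    have "bracket (X v x) (?D u) + bracket (DX u v) (\<phi> x) = bracket (X u x) (?D v) + bracket (DX v u) (\<phi> x)"
      using second_derivative_symmetric[OF sm x, of v u] unfolding second .
    then have "bracket (DX u v - DX v u) (\<phi> x) = bracket (X u x) (?D v) - bracket (X v x) (?D u)"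
      by (simp add: bracket.diff_left algebra_simps)
    also have "\<dots> = bracket (bracket (X u x) (X v x)) (\<phi> x)"
      unfolding X(2)[OF x, symmetric]
      by (simp add: bracket_def matrix_mul.diff_left matrix_mul.diff_right matrix_mul_assoc)
    finally show ?thesis .
  qed
  have D: "frechet_derivative (\<lambda>y. pullback \<phi> (KKS B) y v w) (at x) u =
      B (bracket (X u x) (\<phi> x)) (bracket (X v x) (X w x)) +
      B (\<phi> x) (bracket (DX u v) (X w x) + bracket (X v x) (DX u w))" for u v w
  proof -
    have "((\<lambda>y. pullback \<phi> (KKS B) y v w) has_derivative (\<lambda>u.
        skew_extension B (\<phi> x) (bracket (X v x) (DX u w) + bracket (DX u v) (X w x)) +
        skew_extension B (?D u) (bracket (X v x) (X w x)))) (at x)"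
      by (rule has_derivative_transform_within_open[OF
            bounded_bilinear.FDERIV[OF bounded_bilinear_skew_extension[OF B] d\<phi>
              bounded_bilinear.FDERIV[OF bounded_bilinear_bracket dX dX]] smooth_on_open[OF sm] x])
        (rule pull[symmetric])
    then have "frechet_derivative (\<lambda>y. pullback \<phi> (KKS B) y v w) (at x) u =
        skew_extension B (\<phi> x) (bracket (X v x) (DX u w) + bracket (DX u v) (X w x)) +
        skew_extension B (?D u) (bracket (X v x) (X w x))"
      by (rule fun_cong[OF frechet_derivative_at, symmetric])
    moreover have "bracket (X v x) (DX u w) + bracket (DX u v) (X w x) \<in> skew_matrices"
      by (intro subspace_add[OF subspace_skew_matrices] bracket_in_skew X(1)[OF x] DXs)
    moreover have "?D u \<in> skew_matrices"
      unfolding X(2)[OF x, symmetric] by (intro bracket_in_skew X(1)[OF x] p)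
    ultimately show ?thesis
      using X(1)[OF x] p by (simp add: skew_extension_eq bracket_in_skew X(2)[OF x] add.commute)
  qed
  show "frechet_derivative (\<lambda>y. pullback \<phi> (KKS B) y v w) (at x) u +
      frechet_derivative (\<lambda>y. pullback \<phi> (KKS B) y w u) (at x) v +
      frechet_derivative (\<lambda>y. pullback \<phi> (KKS B) y u v) (at x) w = 0"
    unfolding D
    by (rule KKS_cocycle[OF B p X(1)[OF x] X(1)[OF x] X(1)[OF x] DXs DXs DXs DXs DXs DXs comm comm comm])
qed

text \<open>
  A tangent vector \<open>v\<close> is itself skew, and pairing it with the tangent vector \<open>[v, p]\<close> gives \<open>- B v v\<close>.
\<close>

lemma KKS_nondegenerate:
  assumes p: "p \<in> adjoint_orbit F0" and v: "v \<in> tangent_space (adjoint_orbit F0) p"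
    and zero: "\<And>w. w \<in> tangent_space (adjoint_orbit F0) p \<Longrightarrow> KKS B p v w = 0"
  shows "v = 0"
proof -
  obtain X where X: "X \<in> skew_matrices" "v = bracket X p"
    using v by (auto simp: tangent_orbit[OF p])
  have vs: "v \<in> skew_matrices" using X orbit_skew[OF p] by (simp add: bracket_in_skew)
  have "B v v = - B p (bracket X v)"
    using invariant_bracket_assoc[OF B orbit_skew[OF p] X(1) vs] by (simp add: X(2))
  also have "B p (bracket X v) = KKS B p v (bracket v p)"
    using KKS_bracket[OF B orbit_skew[OF p] X(1) vs] by (simp add: X(2))
  also have "\<dots> = 0"
    by (rule zero) (use vs in \<open>auto simp: tangent_orbit[OF p]\<close>)
  finally show "v = 0" using invariant_positive[OF B vs] by simp
qed

theorem symplectic_manifold_orbit: "symplectic_manifold (adjoint_orbit F0) (KKS B)"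
  unfolding symplectic_manifold_def
  using smooth_submanifold_adjoint_orbit[OF F0] smooth_two_form_KKS closed_two_form_KKS KKS_nondegenerate by blast

lemma pullback_Ad_KKS:
  assumes A: "rotation_matrix A" and \<phi>: "smooth_map_into U \<phi> (adjoint_orbit F0)" and x: "x \<in> U"
  shows "pullback (\<lambda>y. Ad A (\<phi> y)) (KKS B) x v w = pullback \<phi> (KKS B) x v w"
proof -
  have p: "\<phi> x \<in> adjoint_orbit F0" and sm: "smooth_on U \<phi>" using \<phi> x by (auto simp: smooth_map_into_def)
  have oA: "orthogonal_matrix A" using A by (rule rotation_matrix_orthogonal)
  have "((\<lambda>y. Ad A (\<phi> y)) has_derivative (\<lambda>h. Ad A (frechet_derivative \<phi> (at x) h))) (at x)"
    by (rule bounded_linear.has_derivative[OF _ smooth_on_has_derivative[OF sm x]])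
      (use linear_Ad[OF oA] linear_conv_bounded_linear in blast)
  then have D: "frechet_derivative (\<lambda>y. Ad A (\<phi> y)) (at x) h = Ad A (frechet_derivative \<phi> (at x) h)" for h
    by (rule fun_cong[OF frechet_derivative_at, symmetric])
  obtain X Y where XY: "X \<in> skew_matrices" "Y \<in> skew_matrices"
    "frechet_derivative \<phi> (at x) v = bracket X (\<phi> x)" "frechet_derivative \<phi> (at x) w = bracket Y (\<phi> x)"
    using derivative_in_tangent_space[OF \<phi> x, of v] derivative_in_tangent_space[OF \<phi> x, of w]
    unfolding tangent_orbit[OF p] by blast
  note ps = orbit_skew[OF p]
  show ?thesis
    unfolding pullback_def D XY(3,4) Ad_bracket[OF oA]
      KKS_bracket[OF B Ad_skew[OF oA ps] Ad_skew[OF oA XY(1)] Ad_skew[OF oA XY(2)]] KKS_bracket[OF B ps XY(1,2)]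
    unfolding Ad_bracket[OF oA, symmetric]
    by (rule invariant_Ad[OF B A ps bracket_in_skew[OF XY(1,2)]])
qed

end

section \<open>Two-forms and skew matrices\<close>

lemma exhaust_6: "(x :: 6) = 1 \<or> x = 2 \<or> x = 3 \<or> x = 4 \<or> x = 5 \<or> x = 6"
proof (induct x)
  case (of_int z)
  then have "0 \<le> z" "z < 6" by simp_all
  then have "z = 0 \<or> z = 1 \<or> z = 2 \<or> z = 3 \<or> z = 4 \<or> z = 5" by arith
  then show ?case by auto
qed

lemma UNIV_6: "UNIV = {1, 2, 3, 4, 5, 6 :: 6}"
  using exhaust_6 by auto

lemma forall_6: "(\<forall>i :: 6. P i) \<longleftrightarrow> P 1 \<and> P 2 \<and> P 3 \<and> P 4 \<and> P 5 \<and> P 6"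
  by (metis exhaust_6)

lemma sum_6: "(\<Sum>i\<in>UNIV. f (i :: 6)) = f 1 + f 2 + f 3 + f 4 + f 5 + f 6"
  unfolding UNIV_6 by (simp add: ac_simps)

text \<open>
  The diagonal blocks of size two with entries \<open>c\<^sub>i\<close> on and \<open>\<mp> s\<^sub>i\<close> off the diagonal: the image of the vector of
  complex numbers \<open>c\<^sub>i + \<i> s\<^sub>i\<close>, so these matrices form a commutative algebra that contains both the torus
  and its Lie algebra.
\<close>

definition torus_matrix :: "real^3 \<Rightarrow> real^3 \<Rightarrow> real^6^6" where
  "torus_matrix c s = (\<chi> k l.
     if k = 1 \<and> l = 1 \<or> k = 2 \<and> l = 2 then c $ 1 else
     if k = 3 \<and> l = 3 \<or> k = 4 \<and> l = 4 then c $ 2 else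
     if k = 5 \<and> l = 5 \<or> k = 6 \<and> l = 6 then c $ 3 else
     if k = 2 \<and> l = 1 then s $ 1 else if k = 1 \<and> l = 2 then - s $ 1 else
     if k = 4 \<and> l = 3 then s $ 2 else if k = 3 \<and> l = 4 then - s $ 2 else
     if k = 6 \<and> l = 5 then s $ 3 else if k = 5 \<and> l = 6 then - s $ 3 else 0)"

lemma torus_matrix_mul: "torus_matrix c s ** torus_matrix c' s' = torus_matrix (c * c' - s * s') (s * c' + c * s')"
  by (simp add: vec_eq_iff forall_6 sum_6 matrix_matrix_mult_def torus_matrix_def)

lemma torus_matrix_1: "torus_matrix 1 0 = mat 1"
  by (simp add: vec_eq_iff forall_6 mat_def torus_matrix_def)

lemma transpose_torus_matrix: "transpose (torus_matrix c s) = torus_matrix c (- s)"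
  by (simp add: vec_eq_iff forall_6 transpose_def torus_matrix_def)

lemma plane_rotations_torus_matrix:
  "plane_rotation 1 2 \<alpha> ** plane_rotation 3 4 \<beta> ** plane_rotation 5 6 \<gamma> =
    torus_matrix (vector [cos \<alpha>, cos \<beta>, cos \<gamma>]) (vector [sin \<alpha>, sin \<beta>, sin \<gamma>])"
  by (simp add: vec_eq_iff forall_6 sum_6 matrix_matrix_mult_def torus_matrix_def plane_rotation_def vector_3)

lemma two_form_matrix:
  fixes \<omega> :: "real^6 \<Rightarrow> real^6 \<Rightarrow> real"
  assumes "bilinear \<omega>"
  shows "\<omega> X Y = ((\<chi> i j. \<omega> (axis j 1) (axis i 1)) *v X) \<bullet> Y"
proof -
  have "\<omega> X Y = \<omega> (\<Sum>j\<in>UNIV. X $ j *\<^sub>R axis j 1) (\<Sum>i\<in>UNIV. Y $ i *\<^sub>R axis i 1)"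
    using basis_expansion[of X] basis_expansion[of Y] by (simp add: scalar_mult_eq_scaleR)
  also have "\<dots> = (\<Sum>(j, i)\<in>UNIV \<times> UNIV. \<omega> (X $ j *\<^sub>R axis j 1) (Y $ i *\<^sub>R axis i 1))"
    by (rule bilinear_sum[OF assms])
  also have "\<dots> = (\<Sum>j\<in>UNIV. \<Sum>i\<in>UNIV. X $ j * (Y $ i * \<omega> (axis j 1) (axis i 1)))"
    by (simp add: sum.cartesian_product bilinear_lmul[OF assms] bilinear_rmul[OF assms] mult.left_commute)
  also have "\<dots> = (\<Sum>i\<in>UNIV. \<Sum>j\<in>UNIV. X $ j * (Y $ i * \<omega> (axis j 1) (axis i 1)))"
    by (rule sum.swap)
  also have "\<dots> = ((\<chi> i j. \<omega> (axis j 1) (axis i 1)) *v X) \<bullet> Y"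
    by (simp add: inner_vec_def matrix_vector_mult_def sum_distrib_right sum_distrib_left mult_ac)
  finally show ?thesis .
qed

lemma matrix_eqI_inner:
  assumes "\<And>X Y. (F *v X) \<bullet> Y = (G *v X) \<bullet> Y"
  shows "F = (G :: real^'n^'n)"
  unfolding matrix_eq using assms vector_eq_rdot by blast

lemma inner_transpose_apply: "u \<bullet> (v v* A) = (A *v u) \<bullet> (v :: real^'n)"
  by (metis dot_lmul_matrix inner_commute)

lemma endo_eqI:
  assumes "\<And>X Y. \<omega> X Y = (F *v X) \<bullet> Y"
  shows "endo \<omega> = F"
  unfolding endo_def
  by (rule the_equality) (use assms in \<open>auto intro: matrix_eqI_inner\<close>)

lemma endo_apply:
  assumes "\<omega> \<in> two_forms"
  shows "\<omega> X Y = (endo \<omega> *v X) \<bullet> Y"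
proof -
  have b: "bilinear \<omega>" using assms by (simp add: two_forms_def)
  show ?thesis
    unfolding endo_eqI[OF two_form_matrix[OF b]] by (rule two_form_matrix[OF b])
qed

lemma endo_skew:
  assumes "\<omega> \<in> two_forms"
  shows "endo \<omega> \<in> skew_matrices"
proof -
  have b: "bilinear \<omega>" and alt: "\<And>X. \<omega> X X = 0" using assms by (auto simp: two_forms_def)
  have "\<omega> X Y + \<omega> Y X = 0" for X Y
  proof -
    have "\<omega> (X + Y) (X + Y) = \<omega> X X + \<omega> X Y + \<omega> Y X + \<omega> Y Y"
      by (simp add: bilinear_ladd[OF b] bilinear_radd[OF b])
    then show ?thesis by (simp add: alt)
  qed
  then have "(endo \<omega> *v X) \<bullet> Y + (endo \<omega> *v Y) \<bullet> X = 0" for X Y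
    by (simp add: endo_apply[OF assms])
  moreover have "((- endo \<omega>) *v X) \<bullet> Y = - ((endo \<omega> *v X) \<bullet> Y)" for X Y
    by (simp add: inner_vec_def matrix_vector_mult_def sum_negf)
  moreover have "(transpose (endo \<omega>) *v X) \<bullet> Y = (endo \<omega> *v Y) \<bullet> X" for X Y
    using inner_transpose_apply[of Y X "endo \<omega>"] by (simp add: inner_commute)
  ultimately have "(transpose (endo \<omega>) *v X) \<bullet> Y = ((- endo \<omega>) *v X) \<bullet> Y" for X Y
    by (metis add_eq_0_iff)
  then show ?thesis unfolding skew_matrices_def using matrix_eqI_inner by blast
qed

lemma rotate_form_inner:
  assumes "\<omega> \<in> two_forms" and A: "orthogonal_matrix A"
  shows "rotate_form A \<omega> X Y = (Ad A (endo \<omega>) *v X) \<bullet> Y"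
  by (simp add: rotate_form_def endo_apply[OF assms(1)] orthogonal_matrix_inv[OF A] Ad_orthogonal[OF A]
      matrix_vector_mul_assoc[symmetric] inner_transpose_apply)

lemma endo_rotate_form:
  "\<omega> \<in> two_forms \<Longrightarrow> orthogonal_matrix A \<Longrightarrow> endo (rotate_form A \<omega>) = Ad A (endo \<omega>)"
  by (rule endo_eqI) (rule rotate_form_inner)

lemma rotate_form_eq_iff:
  assumes "\<omega> \<in> two_forms" "orthogonal_matrix A" "orthogonal_matrix A'"
  shows "rotate_form A \<omega> = rotate_form A' \<omega> \<longleftrightarrow> endo (rotate_form A \<omega>) = endo (rotate_form A' \<omega>)"
proof
  assume "endo (rotate_form A \<omega>) = endo (rotate_form A' \<omega>)"
  then have "Ad A (endo \<omega>) = Ad A' (endo \<omega>)"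
    by (simp add: endo_rotate_form[OF assms(1,2)] endo_rotate_form[OF assms(1,3)])
  then show "rotate_form A \<omega> = rotate_form A' \<omega>"
    by (simp add: fun_eq_iff rotate_form_inner[OF assms(1,2)] rotate_form_inner[OF assms(1,3)])
qed simp

lemma coadjoint_orbit_eq:
  assumes "\<omega> \<in> two_forms"
  shows "coadjoint_orbit \<omega> = adjoint_orbit (endo \<omega>)"
  unfolding coadjoint_orbit_def form_orbit_def adjoint_orbit_def image_image SO6_def
  by (rule image_cong) (auto simp: endo_rotate_form[OF assms] rotation_matrix_orthogonal)

section \<open>The torus and its moment map\<close>

lemma torus_matrix_add:
  "torus_matrix c s + torus_matrix c' s' = torus_matrix (c + c') (s + s')"
  by (simp add: vec_eq_iff forall_6 torus_matrix_def)

lemma torus_matrix_scaleR: "t *\<^sub>R torus_matrix c s = torus_matrix (t *\<^sub>R c) (t *\<^sub>R s)"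
  by (simp add: vec_eq_iff forall_6 torus_matrix_def)

lemma torus_matrix_eq_iff: "torus_matrix c s = torus_matrix c' s' \<longleftrightarrow> c = c' \<and> s = s'"
  by (auto simp: vec_eq_iff forall_6 forall_3 torus_matrix_def)

lemma endo_wedge: "endo (wedge (cov a) (cov b)) = (\<chi> i j. (if j = a \<and> i = b then 1 else 0) - (if i = a \<and> j = b then 1 else 0))"
proof -
  have b: "bilinear (wedge (cov a) (cov b))"
    unfolding bilinear_def wedge_def by (auto intro!: linearI simp: inner_add_right algebra_simps)
  have "(\<chi> i j. wedge (cov a) (cov b) (axis j 1) (axis i 1)) =
      (\<chi> i j. (if j = a \<and> i = b then 1 else 0) - (if i = a \<and> j = b then 1 else 0))"
    by (auto simp: wedge_def cov_def vec_eq_iff inner_axis_axis)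
  then show ?thesis using endo_eqI[OF two_form_matrix[OF b]] by simp
qed

lemma torus_element_eq: "torus_element x = torus_matrix 0 x"
  by (simp add: torus_element_def endo_wedge vec_eq_iff forall_6 torus_matrix_def)

text \<open>
  The coordinates of the diagonal blocks.  On skew matrices \<open>block_sin\<close> is the moment map of the torus.
\<close>

definition block_cos :: "real^6^6 \<Rightarrow> real^3" where
  "block_cos A = vector [A $ 1 $ 1, A $ 3 $ 3, A $ 5 $ 5]"

definition block_sin :: "real^6^6 \<Rightarrow> real^3" where
  "block_sin A = vector [A $ 2 $ 1, A $ 4 $ 3, A $ 6 $ 5]"

lemma block_torus_matrix [simp]: "block_cos (torus_matrix c s) = c" "block_sin (torus_matrix c s) = s"
  by (simp_all add: block_cos_def block_sin_def torus_matrix_def vec_eq_iff forall_3 vector_3)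

lemma linear_block: "linear block_cos" "linear block_sin"
  by (auto intro!: linearI simp: block_cos_def block_sin_def vec_eq_iff forall_3 vector_3)

lemma linear_torus_blocks: "linear (\<lambda>A. torus_matrix (block_cos A) (block_sin A))"
  by (rule linearI) (simp_all add: linear_add[OF linear_block(1)] linear_add[OF linear_block(2)]
      linear_cmul[OF linear_block(1)] linear_cmul[OF linear_block(2)] torus_matrix_add torus_matrix_scaleR)

lemma torus_eq: "torus = {torus_matrix c s | c s. \<forall>i. (c $ i)\<^sup>2 + (s $ i)\<^sup>2 = 1}"
proof -
  have "\<exists>\<alpha> \<beta> \<gamma>. torus_matrix c s = plane_rotation 1 2 \<alpha> ** plane_rotation 3 4 \<beta> ** plane_rotation 5 6 \<gamma>"
    if "\<forall>i. (c $ i)\<^sup>2 + (s $ i)\<^sup>2 = 1" for c s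
  proof -
    have "\<exists>t. c $ i = cos t \<and> s $ i = sin t" for i
      using sincos_total_2pi[of "c $ i" "s $ i"] that by metis
    then obtain t where t: "\<And>i. c $ i = cos (t i)" "\<And>i. s $ i = sin (t i)" by metis
    show ?thesis
      by (rule exI[of _ "t 1"], rule exI[of _ "t 2"], rule exI[of _ "t 3"])
        (simp only: plane_rotations_torus_matrix torus_matrix_eq_iff, simp add: t vec_eq_iff forall_3 vector_3)
  qed
  moreover have "plane_rotation 1 2 \<alpha> ** plane_rotation 3 4 \<beta> ** plane_rotation 5 6 \<gamma> \<in>
      {torus_matrix c s | c s. \<forall>i. (c $ i)\<^sup>2 + (s $ i)\<^sup>2 = 1}" for \<alpha> \<beta> \<gamma>
    unfolding plane_rotations_torus_matrix
    by (rule CollectI, rule exI, rule exI, rule conjI[OF refl]) (simp add: forall_3 vector_3)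
  ultimately show ?thesis unfolding torus_def by blast
qed

lemma torus_matrix_orthogonal:
  assumes "\<forall>i. (c $ i)\<^sup>2 + (s $ i)\<^sup>2 = 1"
  shows "orthogonal_matrix (torus_matrix c s)"
proof -
  have "c * c - - s * s = 1" "- s * c + c * s = 0"
    using assms by (simp_all add: vec_eq_iff power2_eq_square)
  then show ?thesis
    by (simp add: orthogonal_matrix transpose_torus_matrix torus_matrix_mul torus_matrix_1 mult.commute)
qed

text \<open>
  Scaling the three angles joins an element of the torus to the identity.
\<close>

lemma torus_rotation:
  assumes "h \<in> torus"
  shows "rotation_matrix h"
proof -
  obtain \<alpha> \<beta> \<gamma> where h: "h = plane_rotation 1 2 \<alpha> ** plane_rotation 3 4 \<beta> ** plane_rotation 5 6 \<gamma>"
    using assms by (auto simp: torus_def)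
  define R where "R t = torus_matrix (vector [cos (t * \<alpha>), cos (t * \<beta>), cos (t * \<gamma>)])
      (vector [sin (t * \<alpha>), sin (t * \<beta>), sin (t * \<gamma>)])" for t
  have "\<forall>k l. continuous_on UNIV (\<lambda>t. R t $ k $ l)"
    unfolding forall_6 R_def torus_matrix_def by (simp add: vector_3 continuous_intros)
  then have "continuous_on UNIV (\<lambda>t. \<chi> k l. R t $ k $ l)"
    by (intro continuous_on_vec_lambda) auto
  then have "continuous_on UNIV R" by simp
  moreover have "orthogonal_matrix (R t)" for t
    unfolding R_def by (rule torus_matrix_orthogonal) (simp add: forall_3 vector_3)
  moreover have "R 0 = torus_matrix 1 0"
    unfolding R_def torus_matrix_eq_iff by (simp add: vec_eq_iff forall_3 vector_3)
  ultimately have "rotation_matrix (R 1)"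
    by (intro rotation_matrix_path) (simp_all add: torus_matrix_1)
  then show ?thesis by (simp add: R_def h plane_rotations_torus_matrix)
qed

lemma torus_matrix_in_torus: "torus_matrix c s \<in> torus \<longleftrightarrow> (\<forall>i. (c $ i)\<^sup>2 + (s $ i)\<^sup>2 = 1)"
  unfolding torus_eq by (auto simp: torus_matrix_eq_iff)

lemma torusE:
  assumes "h \<in> torus"
  obtains c s where "h = torus_matrix c s" "\<forall>i. (c $ i)\<^sup>2 + (s $ i)\<^sup>2 = 1"
  using assms unfolding torus_eq by blast

lemma transpose_in_torus: "h \<in> torus \<Longrightarrow> transpose h \<in> torus"
  by (auto elim!: torusE simp: transpose_torus_matrix torus_matrix_in_torus)

lemma matrix_lie_group_torus: "matrix_lie_group torus"
  unfolding matrix_lie_group_def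
proof (intro conjI ballI)
  show sub: "torus \<subseteq> {A. invertible A}"
    using torus_rotation by (auto simp: rotation_matrix_def invertible_det_nz)
  show "mat 1 \<in> torus"
    unfolding torus_matrix_1[symmetric] torus_matrix_in_torus by simp
  fix A assume A: "A \<in> torus"
  show "matrix_inv A \<in> torus"
    using transpose_in_torus[OF A] orthogonal_matrix_inv[OF rotation_matrix_orthogonal[OF torus_rotation[OF A]]] by simp
  fix B assume B: "B \<in> torus"
  obtain c s where c: "A = torus_matrix c s" "\<forall>i. (c $ i)\<^sup>2 + (s $ i)\<^sup>2 = 1" using A by (rule torusE)
  obtain c' s' where c': "B = torus_matrix c' s'" "\<forall>i. (c' $ i)\<^sup>2 + (s' $ i)\<^sup>2 = 1" using B by (rule torusE)
  have "(x * x' - y * y')\<^sup>2 + (y * x' + x * y')\<^sup>2 = (x\<^sup>2 + y\<^sup>2) * (x'\<^sup>2 + y'\<^sup>2)" for x x' y y' :: real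
    by (simp add: power2_eq_square algebra_simps)
  then show "A ** B \<in> torus"
    unfolding c c' torus_matrix_mul torus_matrix_in_torus using c(2) c'(2) by simp
next
  have eq: "torus = {A. A = torus_matrix (block_cos A) (block_sin A)} \<inter>
      {A. \<forall>i. (block_cos A $ i)\<^sup>2 + (block_sin A $ i)\<^sup>2 = 1}"
    unfolding torus_eq by auto
  have cont: "continuous_on UNIV f" if "linear f" for f :: "real^6^6 \<Rightarrow> 'b::real_normed_vector"
    using that linear_continuous_on linear_conv_bounded_linear by blast
  have "closed torus" unfolding eq
    by (intro closed_Int closed_Collect_eq closed_Collect_all continuous_intros cont linear_block linear_torus_blocks)
  moreover have "torus \<subseteq> {A. invertible A}"
    using torus_rotation by (auto simp: rotation_matrix_def invertible_det_nz)
  ultimately show "closedin (top_of_set {A. invertible A}) torus" by (intro closed_subset)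
qed

text \<open>
  The exponential of a torus element is the block rotation by the corresponding angles, since both solve
  the same differential equation.  Conversely, the derivative of a one-parameter group in the torus keeps
  the block form, and orthogonality of the group leaves only the skew part of each block.
\<close>

lemma lie_algebra_torus: "lie_algebra torus = range torus_element"
proof
  show "range torus_element \<subseteq> lie_algebra torus"
  proof safe
    fix x :: "real^3"
    define R where "R t = torus_matrix (\<chi> i. cos (t * x $ i)) (\<chi> i. sin (t * x $ i))" for t
    have "(R has_vector_derivative torus_element x ** R t) (at t)" for t
      unfolding R_def torus_element_eq torus_matrix_mul
    proof (rule has_vector_derivative_matrix)
      have "\<forall>i j. ((\<lambda>t. torus_matrix (\<chi> i. cos (t * x $ i)) (\<chi> i. sin (t * x $ i)) $ i $ j) has_real_derivative
        torus_matrix (0 * (\<chi> i. cos (t * x $ i)) - x * (\<chi> i. sin (t * x $ i)))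
          (x * (\<chi> i. cos (t * x $ i)) + 0 * (\<chi> i. sin (t * x $ i))) $ i $ j) (at t)"
        by (simp add: forall_6 torus_matrix_def) (auto intro!: derivative_eq_intros)
      then show "((\<lambda>t. torus_matrix (\<chi> i. cos (t * x $ i)) (\<chi> i. sin (t * x $ i)) $ i $ j) has_real_derivative
        torus_matrix (0 * (\<chi> i. cos (t * x $ i)) - x * (\<chi> i. sin (t * x $ i)))
          (x * (\<chi> i. cos (t * x $ i)) + 0 * (\<chi> i. sin (t * x $ i))) $ i $ j) (at t)" for i j
        by blast
    qed
    moreover have "R 0 = torus_matrix 1 0"
      unfolding R_def torus_matrix_eq_iff by (simp add: vec_eq_iff)
    ultimately have "R t = mat_exp (t *\<^sub>R torus_element x)" for t
      by (intro mat_exp_unique mat_exp_commute) (simp_all add: torus_matrix_1)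
    moreover have "R t \<in> torus" for t unfolding R_def torus_matrix_in_torus by simp
    ultimately show "torus_element x \<in> lie_algebra torus" by (simp add: lie_algebra_def)
  qed
  show "lie_algebra torus \<subseteq> range torus_element"
  proof
    fix X assume "X \<in> lie_algebra torus"
    then have E: "mat_exp (t *\<^sub>R X) \<in> torus" for t by (simp add: lie_algebra_def)
    have dE: "((\<lambda>t. mat_exp (t *\<^sub>R X)) has_vector_derivative X) (at 0)"
      using mat_exp_has_vector_derivative[of X 0] by simp
    let ?L = "\<lambda>A. torus_matrix (block_cos A) (block_sin A)"
    have "((\<lambda>t. ?L (mat_exp (t *\<^sub>R X))) has_vector_derivative ?L X) (at 0)"
      by (rule bounded_linear.has_vector_derivative[OF _ dE])
        (use linear_torus_blocks linear_conv_bounded_linear in blast)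
    moreover have "?L (mat_exp (t *\<^sub>R X)) = mat_exp (t *\<^sub>R X)" for t
      using E[of t] by (auto elim: torusE)
    ultimately have X: "X = ?L X" using vector_derivative_unique_at[OF dE] by simp
    have "((\<lambda>t. transpose (mat_exp (t *\<^sub>R X)) ** mat_exp (t *\<^sub>R X)) has_vector_derivative
        transpose (mat_exp (0 *\<^sub>R X)) ** X + transpose X ** mat_exp (0 *\<^sub>R X)) (at 0)"
      by (rule bounded_bilinear.has_vector_derivative[OF bounded_bilinear_matrix_mul
            transpose_has_vector_derivative[OF dE] dE])
    moreover have "transpose (mat_exp (t *\<^sub>R X)) ** mat_exp (t *\<^sub>R X) = mat 1" for t
      using torus_rotation[OF E] by (simp add: rotation_matrix_def orthogonal_matrix)
    ultimately have "((\<lambda>t. mat 1) has_vector_derivative X + transpose X) (at (0::real))" by simp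
    then have "X + transpose X = 0"
      using vector_derivative_unique_at[OF _ has_vector_derivative_const] by blast
    moreover have "X + transpose X = torus_matrix (block_cos X + block_cos X) 0"
      by (subst (1 2) X) (simp add: transpose_torus_matrix torus_matrix_add)
    moreover have "torus_matrix 0 0 = 0" by (simp add: vec_eq_iff torus_matrix_def)
    ultimately have "block_cos X + block_cos X = 0" by (metis torus_matrix_eq_iff)
    then have "block_cos X = 0" by (simp add: vec_eq_iff)
    then show "X \<in> range torus_element" using X torus_element_eq by (metis rangeI)
  qed
qed

lemma torus_element_skew: "torus_element x \<in> skew_matrices"
proof -
  have "- torus_matrix 0 x = torus_matrix 0 (- x)" by (simp add: vec_eq_iff forall_6 torus_matrix_def)
  then show ?thesis by (simp add: skew_matrices_def torus_element_eq transpose_torus_matrix)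
qed

lemma torus_element_diff: "torus_element x - torus_element y = torus_element (x - y)"
  unfolding torus_element_eq by (simp add: vec_eq_iff forall_6 torus_matrix_def)

lemma Ad_torus_element:
  assumes "h \<in> torus"
  shows "Ad h (torus_element x) = torus_element x"
proof -
  have o: "orthogonal_matrix h" using torus_rotation[OF assms] by (rule rotation_matrix_orthogonal)
  obtain c s where h: "h = torus_matrix c s" using assms by (rule torusE)
  have "h ** torus_element x = torus_element x ** h"
    unfolding h torus_element_eq torus_matrix_mul by (simp add: mult.commute)
  then have "Ad h (torus_element x) = torus_element x ** (h ** transpose h)"
    by (simp add: Ad_orthogonal[OF o] matrix_mul_assoc)
  then show ?thesis using o by (simp add: orthogonal_matrix_def)
qed

lemma torus_matrix_diagonal_conj:
  "(torus_matrix c 0 ** E ** torus_matrix c 0) $ k $ l =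
    torus_matrix c 0 $ k $ k * E $ k $ l * torus_matrix c 0 $ l $ l"
proof -
  have "\<forall>k l. torus_matrix c 0 $ k $ l = (if k = l then torus_matrix c 0 $ k $ k else 0)"
    by (simp add: forall_6 torus_matrix_def)
  then have D: "torus_matrix c 0 = (\<chi> k l. if k = l then torus_matrix c 0 $ k $ k else 0)"
    by (simp add: vec_eq_iff)
  show ?thesis
    by (subst (1 2) D) (simp add: matrix_matrix_mult_def if_distrib[of "\<lambda>x. x * _"] if_distrib[of "\<lambda>x. _ * x"]
        cong: if_cong)
qed

text \<open>
  The four sign changes of the diagonal blocks listed below fix the torus elements, but their sum kills a
  skew matrix whose diagonal blocks vanish: each of its other entries is reversed by exactly two of them.
\<close>

lemma invariant_orthogonal_torus:
  assumes B: "invariant_inner_product B" and E: "E \<in> skew_matrices" and zero: "block_sin E = 0"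
  shows "B E (torus_element x) = 0"
proof -
  interpret Be: bounded_bilinear "skew_extension B" by (rule bounded_bilinear_skew_extension[OF B])
  define h where "h c = torus_matrix (vector c) (0 :: real^3)" for c
  let ?C = "[[1, 1, 1], [- 1, 1, 1], [1, - 1, 1], [1, 1, - 1 :: real]]"
  have h: "h c \<in> torus" if "c \<in> set ?C" for c
    using that unfolding h_def torus_matrix_in_torus by (auto simp: forall_3 vector_3)
  have avg: "B E (torus_element x) = skew_extension B (Ad (h c) E) (torus_element x)" if "c \<in> set ?C" for c
  proof -
    have r: "rotation_matrix (h c)" by (rule torus_rotation[OF h[OF that]])
    have "B E (torus_element x) = B (Ad (h c) E) (Ad (h c) (torus_element x))"
      by (rule invariant_Ad[OF B r E torus_element_skew, symmetric])
    then show ?thesis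
      using Ad_torus_element[OF h[OF that]] Ad_skew[OF rotation_matrix_orthogonal[OF r] E]
      by (simp add: skew_extension_eq torus_element_skew)
  qed
  have "4 * B E (torus_element x) = skew_extension B (Ad (h [1, 1, 1]) E + Ad (h [- 1, 1, 1]) E +
      Ad (h [1, - 1, 1]) E + Ad (h [1, 1, - 1]) E) (torus_element x)"
    using avg[of "[1, 1, 1]"] avg[of "[- 1, 1, 1]"] avg[of "[1, - 1, 1]"] avg[of "[1, 1, - 1]"]
    by (simp add: Be.add_left)
  moreover have "Ad (h [1, 1, 1]) E + Ad (h [- 1, 1, 1]) E + Ad (h [1, - 1, 1]) E + Ad (h [1, 1, - 1]) E = 0"
  proof -
    have Ad: "Ad (h c) E = h c ** E ** h c" if "c \<in> set ?C" for c
      using Ad_orthogonal[OF rotation_matrix_orthogonal[OF torus_rotation[OF h[OF that]]]]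
      by (simp add: h_def transpose_torus_matrix)
    have entry: "Ad (h c) E $ k $ l = torus_matrix (vector c) 0 $ k $ k * E $ k $ l * torus_matrix (vector c) 0 $ l $ l"
      if "c \<in> set ?C" for c k l
      unfolding Ad[OF that] unfolding h_def by (rule torus_matrix_diagonal_conj)
    have skew: "E $ k $ l = - E $ l $ k" for k l
      using arg_cong[OF skew_matricesD[OF E], of "\<lambda>M. M $ l $ k"] by (simp add: transpose_def)
    have diag: "E $ k $ k = 0" for k using skew[of k k] by simp
    have blocks: "E $ 2 $ 1 = 0" "E $ 4 $ 3 = 0" "E $ 6 $ 5 = 0"
      using zero by (simp_all add: block_sin_def vec_eq_iff forall_3 vector_3)
    have blocks': "E $ 1 $ 2 = 0" "E $ 3 $ 4 = 0" "E $ 5 $ 6 = 0"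
      using blocks skew[of 1 2] skew[of 3 4] skew[of 5 6] by simp_all
    have d: "torus_matrix (vector [a, b, c]) 0 $ 1 $ 1 = a" "torus_matrix (vector [a, b, c]) 0 $ 2 $ 2 = a"
      "torus_matrix (vector [a, b, c]) 0 $ 3 $ 3 = b" "torus_matrix (vector [a, b, c]) 0 $ 4 $ 4 = b"
      "torus_matrix (vector [a, b, c]) 0 $ 5 $ 5 = c" "torus_matrix (vector [a, b, c]) 0 $ 6 $ 6 = c" for a b c
      by (simp_all add: torus_matrix_def vector_3)
    have "\<forall>k l. (Ad (h [1, 1, 1]) E + Ad (h [- 1, 1, 1]) E + Ad (h [1, - 1, 1]) E + Ad (h [1, 1, - 1]) E) $ k $ l = 0"
      unfolding vector_add_component forall_6
      by (simp only: entry list.set insert_iff d diag blocks blocks' simp_thms) simp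
    then show ?thesis by (simp add: vec_eq_iff)
  qed
  ultimately show ?thesis by (simp add: Be.zero_left)
qed

lemma torus_projection_eq:
  assumes B: "invariant_inner_product B" and F: "F \<in> skew_matrices"
  shows "torus_projection B F = torus_element (block_sin F)"
    and "B (torus_element (block_sin F)) (torus_element x) = B F (torus_element x)"
proof -
  interpret Be: bounded_bilinear "skew_extension B" by (rule bounded_bilinear_skew_extension[OF B])
  let ?\<nu> = "torus_element (block_sin F)"
  have s: "F - torus_element y \<in> skew_matrices" for y
    by (intro subspace_diff[OF subspace_skew_matrices] F torus_element_skew)
  have zero: "B (F - ?\<nu>) (torus_element x) = 0" for x
    by (rule invariant_orthogonal_torus[OF B s])
      (simp add: linear_diff[OF linear_block(2)] torus_element_eq)
  show "B ?\<nu> (torus_element x) = B F (torus_element x)"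
    using zero[of x] Be.diff_left[of F ?\<nu> "torus_element x"]
    by (simp add: skew_extension_eq s F torus_element_skew)
  show "torus_projection B F = ?\<nu>"
    unfolding torus_projection_def lie_algebra_torus
  proof (rule the_equality)
    show "?\<nu> \<in> range torus_element \<and> (\<forall>\<xi>\<in>range torus_element. B (F - ?\<nu>) \<xi> = 0)"
      using zero by auto
  next
    fix \<nu> assume *: "\<nu> \<in> range torus_element \<and> (\<forall>\<xi>\<in>range torus_element. B (F - \<nu>) \<xi> = 0)"
    then obtain y where y: "\<nu> = torus_element y" by auto
    have "skew_extension B (?\<nu> - \<nu>) (?\<nu> - \<nu>) = skew_extension B (F - \<nu>) (?\<nu> - \<nu>) - skew_extension B (F - ?\<nu>) (?\<nu> - \<nu>)"
      by (simp add: Be.diff_left)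
    also have "\<dots> = 0"
      using * zero by (simp add: y torus_element_diff skew_extension_eq s torus_element_skew)
    finally show "\<nu> = ?\<nu>"
      using invariant_positive[OF B, of "?\<nu> - \<nu>"]
      by (simp add: y torus_element_diff skew_extension_eq torus_element_skew) (metis eq_iff_diff_eq_0 torus_element_diff)
  qed
qed

lemma torus_moment_eq:
  assumes "invariant_inner_product B" "F \<in> skew_matrices"
  shows "torus_moment B F = block_sin F"
  unfolding torus_moment_def torus_projection_eq(1)[OF assms] torus_element_eq torus_matrix_eq_iff by simp

text \<open>
  On the orbit, the moment map paired with a torus element \<open>\<xi>\<close> is the linear function \<open>B p \<xi>\<close>.  Its
  derivative along \<open>[Y, p]\<close> is \<open>B [Y, p] \<xi> = B p [\<xi>, Y]\<close>, the value of the symplectic form on the vector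
  generated by \<open>\<xi>\<close> and on \<open>[Y, p]\<close>.
\<close>

theorem hamiltonian_action_torus:
  assumes B: "invariant_inner_product B" and F0: "F0 \<in> skew_matrices"
  shows "hamiltonian_action torus Ad (adjoint_orbit F0) (KKS B) (\<lambda>F. torus_covector B (torus_moment B F))"
proof -
  let ?M = "adjoint_orbit F0"
  let ?\<mu> = "\<lambda>F. torus_covector B (torus_moment B F)"
  interpret Be: bounded_bilinear "skew_extension B" by (rule bounded_bilinear_skew_extension[OF B])
  note skew = orbit_skew[OF B F0]
  have \<mu>: "?\<mu> F (torus_element x) = skew_extension B F (torus_element x)" if "F \<in> skew_matrices" for F x
    using torus_projection_eq(2)[OF B that]
    by (simp add: torus_covector_def torus_moment_eq[OF B that] skew_extension_eq that torus_element_skew)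
  have orth: "orthogonal_matrix h" if "h \<in> torus" for h
    using that torus_rotation rotation_matrix_orthogonal by blast
  have action: "smooth_action torus Ad ?M"
    unfolding smooth_action_def
  proof (intro conjI ballI allI impI)
    fix h k p assume "h \<in> torus" "k \<in> torus" "p \<in> ?M"
    then show "Ad h p \<in> ?M" "Ad (h ** k) p = Ad h (Ad k p)"
      by (auto intro: adjoint_orbit_Ad torus_rotation simp: Ad_mul_orthogonal orth)
  next
    fix p show "Ad (mat 1) p = (p :: real^6^6)" by (rule Ad_mat_1)
  next
    fix U and \<alpha> :: "(real^6^6) \<times> (real^6^6) \<Rightarrow> real^6^6" and \<phi>
    assume "smooth_map_into U \<alpha> torus \<and> smooth_map_into U \<phi> ?M"
    then have sm: "smooth_on U \<alpha>" "smooth_on U \<phi>" and into: "\<And>x. x \<in> U \<Longrightarrow> \<alpha> x \<in> torus"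
      by (auto simp: smooth_map_into_def)
    have "smooth_on U (\<lambda>x. \<alpha> x ** \<phi> x ** transpose (\<alpha> x))"
      by (intro smooth_on_bilinear[OF bounded_bilinear_matrix_mul] sm smooth_on_bounded_linear[OF bounded_linear_transpose])
    then show "smooth_on U (\<lambda>x. Ad (\<alpha> x) (\<phi> x))"
      by (rule smooth_on_cong) (simp add: Ad_orthogonal orth into)
  qed
  have moment: "moment_map torus Ad ?M (KKS B) ?\<mu>"
    unfolding moment_map_def
  proof (intro conjI ballI allI impI)
    fix p \<xi> \<eta> a b assume p: "p \<in> ?M" and "\<xi> \<in> lie_algebra torus" "\<eta> \<in> lie_algebra torus"
    then obtain x y where xy: "\<xi> = torus_element x" "\<eta> = torus_element y" by (auto simp: lie_algebra_torus)
    have comb: "a *\<^sub>R \<xi> + b *\<^sub>R \<eta> = torus_element (a *\<^sub>R x + b *\<^sub>R y)"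
      unfolding xy torus_element_eq by (simp add: torus_matrix_scaleR torus_matrix_add)
    have m: "?\<mu> p \<zeta> = skew_extension B p \<zeta>" if "\<zeta> = torus_element z" for \<zeta> z
      unfolding that by (rule \<mu>[OF skew[OF p]])
    show "?\<mu> p (a *\<^sub>R \<xi> + b *\<^sub>R \<eta>) = a * ?\<mu> p \<xi> + b * ?\<mu> p \<eta>"
      unfolding m[OF comb] m[OF xy(1)] m[OF xy(2)] by (simp add: Be.add_right Be.scaleR_right)
  next
    fix \<xi> U and \<phi> :: "real^6^6 \<Rightarrow> real^6^6"
    assume "\<xi> \<in> lie_algebra torus" and \<phi>: "smooth_map_into U \<phi> ?M"
    then obtain x where x: "\<xi> = torus_element x" by (auto simp: lie_algebra_torus)
    have "smooth_on U (\<lambda>y. skew_extension B (\<phi> y) \<xi>)"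
      using \<phi> by (intro smooth_on_bounded_linear[OF Be.bounded_linear_left]) (simp add: smooth_map_into_def)
    then show "smooth_on U (\<lambda>y. ?\<mu> (\<phi> y) \<xi>)"
      by (rule smooth_on_cong) (use \<phi> skew in \<open>auto simp: x \<mu> smooth_map_into_def\<close>)
  next
    fix h p \<xi> assume h: "h \<in> torus" and p: "p \<in> ?M" and "\<xi> \<in> lie_algebra torus"
    then obtain x where x: "\<xi> = torus_element x" by (auto simp: lie_algebra_torus)
    have r: "rotation_matrix h" using h by (rule torus_rotation)
    have "matrix_inv h \<in> torus"
      using matrix_lie_group_torus h by (auto simp: matrix_lie_group_def)
    then have inv: "Ad (matrix_inv h) \<xi> = \<xi>" unfolding x by (rule Ad_torus_element)
    have "?\<mu> (Ad h p) \<xi> = B (Ad h p) (Ad h \<xi>)"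
      using Ad_skew[OF orth[OF h] skew[OF p]]
      by (simp add: x \<mu> Ad_torus_element[OF h] skew_extension_eq torus_element_skew)
    also have "\<dots> = B p \<xi>"
      unfolding x by (rule invariant_Ad[OF B r skew[OF p] torus_element_skew])
    also have "\<dots> = ?\<mu> p (Ad (matrix_inv h) \<xi>)"
      unfolding inv by (simp add: x \<mu> skew[OF p] skew_extension_eq torus_element_skew)
    finally show "?\<mu> (Ad h p) \<xi> = ?\<mu> p (Ad (matrix_inv h) \<xi>)" .
  next
    fix \<xi> p v c assume "\<xi> \<in> lie_algebra torus" and p: "p \<in> ?M" and c: "curve_at ?M p v c"
    then obtain x where x: "\<xi> = torus_element x" by (auto simp: lie_algebra_torus)
    have \<xi>: "\<xi> \<in> skew_matrices" by (simp add: x torus_element_skew)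
    have cM: "\<And>t. c t \<in> ?M" and dc: "(c has_vector_derivative v) (at 0)"
      using c by (auto simp: curve_at_def)
    have "v \<in> tangent_space ?M p" using c by (auto simp: tangent_space_def)
    then obtain Y where Y: "Y \<in> skew_matrices" "v = bracket Y p"
      by (auto simp: tangent_orbit[OF B F0 p])
    have "KKS B p (generated_field Ad \<xi> p) v = B p (bracket \<xi> Y)"
      unfolding generated_field_Ad[OF skew_matricesD[OF \<xi>]] Y(2) by (rule KKS_bracket[OF B skew[OF p] \<xi> Y(1)])
    also have "\<dots> = B v \<xi>"
      using invariant_bracket_assoc[OF B skew[OF p] Y(1) \<xi>]
        invariant_minus_right[OF B skew[OF p] bracket_in_skew[OF Y(1) \<xi>]]
      by (simp add: Y(2) bracket_swap[of \<xi> Y])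
    also have "\<dots> = skew_extension B v \<xi>"
      using Y skew[OF p] \<xi> by (simp add: skew_extension_eq bracket_in_skew)
    finally have K: "KKS B p (generated_field Ad \<xi> p) v = skew_extension B v \<xi>" .
    have "(\<lambda>t. ?\<mu> (c t) \<xi>) = (\<lambda>t. skew_extension B (c t) \<xi>)"
      using skew[OF cM] by (simp add: x \<mu>)
    then show "((\<lambda>t. ?\<mu> (c t) \<xi>) has_vector_derivative KKS B p (generated_field Ad \<xi> p) v) (at 0)"
      unfolding K using bounded_linear.has_vector_derivative[OF Be.bounded_linear_left dc] by simp
  qed
  show ?thesis
    unfolding hamiltonian_action_def
    using matrix_lie_group_torus symplectic_manifold_orbit[OF B F0] action moment
      pullback_Ad_KKS[OF B F0 torus_rotation] by blast
qed

section \<open>Moving points of the moment image along root directions\<close>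

lemma plane_rotation_rotation:
  assumes "(i, j) \<in> {(1, 3), (2, 4), (3, 5), (4, 6)}"
  shows "rotation_matrix (plane_rotation i j \<theta>)"
proof (rule rotation_matrix_path)
  have "\<forall>k l. continuous_on UNIV (\<lambda>t. plane_rotation i j t $ k $ l)"
    unfolding forall_6 plane_rotation_def using assms by (auto simp: continuous_intros)
  then have "continuous_on UNIV (\<lambda>t. \<chi> k l. plane_rotation i j t $ k $ l)"
    by (intro continuous_on_vec_lambda) auto
  then show "continuous_on UNIV (plane_rotation i j)" by (simp add: eta_contract_eq)
  have "orthogonal_matrix (plane_rotation i j \<theta>)"
    if "(i, j) = (1, 3) \<or> (i, j) = (2, 4) \<or> (i, j) = (3, 5) \<or> (i, j) = (4, 6)" for \<theta>
    using that
    by (elim disjE; simp add: orthogonal_matrix vec_eq_iff forall_6 sum_6 matrix_matrix_mult_def transpose_def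
        plane_rotation_def mat_def power2_eq_square[symmetric])
  then show "orthogonal_matrix (plane_rotation i j \<theta>)" for \<theta> using assms by auto
  have "plane_rotation i j 0 = mat 1"
    if "(i, j) = (1, 3) \<or> (i, j) = (2, 4) \<or> (i, j) = (3, 5) \<or> (i, j) = (4, 6)"
    using that by (elim disjE; simp add: vec_eq_iff forall_6 plane_rotation_def mat_def)
  then show "plane_rotation i j 0 = mat 1" using assms by auto
qed

lemma Ad_entry:
  assumes "orthogonal_matrix (A :: real^'n^'n)"
  shows "Ad A F $ i $ j = (\<Sum>k\<in>UNIV. \<Sum>l\<in>UNIV. A $ i $ k * F $ k $ l * A $ j $ l)"
proof -
  have "Ad A F $ i $ j = (\<Sum>l\<in>UNIV. \<Sum>k\<in>UNIV. A $ i $ k * F $ k $ l * A $ j $ l)"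
    by (simp add: Ad_orthogonal[OF assms] matrix_matrix_mult_def transpose_def sum_distrib_right)
  also have "\<dots> = (\<Sum>k\<in>UNIV. \<Sum>l\<in>UNIV. A $ i $ k * F $ k $ l * A $ j $ l)"
    by (rule sum.swap)
  finally show ?thesis .
qed

text \<open>
  These rotations turn two coordinate planes into each other.  They commute with the torus elements on
  which the root \<open>x\<^sub>1 - x\<^sub>2\<close> vanishes (for \<open>\<epsilon> = 1\<close> and \<open>\<epsilon> = - 1\<close>, the roots \<open>x\<^sub>2 - x\<^sub>3\<close> and \<open>x\<^sub>2 + x\<^sub>3\<close>), so
  conjugation by them changes the moment image only in the direction of that root.  At the angle \<open>\<pi>/2\<close>
  they act on the moment image as the reflection in the root.
\<close>

definition root_rotation_12 :: "real \<Rightarrow> real^6^6" where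
  "root_rotation_12 \<theta> = plane_rotation 1 3 \<theta> ** plane_rotation 2 4 \<theta>"

definition root_rotation_23 :: "real \<Rightarrow> real \<Rightarrow> real^6^6" where
  "root_rotation_23 \<epsilon> \<theta> = plane_rotation 3 5 \<theta> ** plane_rotation 4 6 (\<epsilon> * \<theta>)"

lemma root_rotation_rotation:
  "rotation_matrix (root_rotation_12 \<theta>)" "rotation_matrix (root_rotation_23 \<epsilon> \<theta>)"
  unfolding root_rotation_12_def root_rotation_23_def
  by (intro rotation_matrix_mul plane_rotation_rotation; simp)+

lemma root_rotation_12_rows:
  "root_rotation_12 \<theta> $ 1 = (\<chi> l. if l = 1 then cos \<theta> else if l = 3 then - sin \<theta> else 0)"
  "root_rotation_12 \<theta> $ 2 = (\<chi> l. if l = 2 then cos \<theta> else if l = 4 then - sin \<theta> else 0)"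
  "root_rotation_12 \<theta> $ 3 = (\<chi> l. if l = 1 then sin \<theta> else if l = 3 then cos \<theta> else 0)"
  "root_rotation_12 \<theta> $ 4 = (\<chi> l. if l = 2 then sin \<theta> else if l = 4 then cos \<theta> else 0)"
  "root_rotation_12 \<theta> $ 5 = (\<chi> l. if l = 5 then 1 else 0)"
  "root_rotation_12 \<theta> $ 6 = (\<chi> l. if l = 6 then 1 else 0)"
  by (simp_all add: root_rotation_12_def vec_eq_iff forall_6 sum_6 matrix_matrix_mult_def plane_rotation_def)

lemma root_rotation_23_rows:
  "root_rotation_23 \<epsilon> \<theta> $ 1 = (\<chi> l. if l = 1 then 1 else 0)"
  "root_rotation_23 \<epsilon> \<theta> $ 2 = (\<chi> l. if l = 2 then 1 else 0)"
  "root_rotation_23 \<epsilon> \<theta> $ 3 = (\<chi> l. if l = 3 then cos \<theta> else if l = 5 then - sin \<theta> else 0)"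
  "root_rotation_23 \<epsilon> \<theta> $ 4 = (\<chi> l. if l = 4 then cos (\<epsilon> * \<theta>) else if l = 6 then - sin (\<epsilon> * \<theta>) else 0)"
  "root_rotation_23 \<epsilon> \<theta> $ 5 = (\<chi> l. if l = 3 then sin \<theta> else if l = 5 then cos \<theta> else 0)"
  "root_rotation_23 \<epsilon> \<theta> $ 6 = (\<chi> l. if l = 4 then sin (\<epsilon> * \<theta>) else if l = 6 then cos (\<epsilon> * \<theta>) else 0)"
  by (simp_all add: root_rotation_23_def vec_eq_iff forall_6 sum_6 matrix_matrix_mult_def plane_rotation_def)

lemma cos_sin_split: "cos \<theta> * (cos \<theta> * z) + sin \<theta> * (sin \<theta> * z) = (z :: real)"
proof -
  have "cos \<theta> * (cos \<theta> * z) + sin \<theta> * (sin \<theta> * z) = ((sin \<theta>)\<^sup>2 + (cos \<theta>)\<^sup>2) * z"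
    by (simp only: power2_eq_square distrib_right mult.assoc add.commute)
  then show ?thesis by simp
qed

lemma Ad_root_rotation_12:
  fixes F :: "real^6^6" and \<theta> :: real
  defines "G \<equiv> Ad (root_rotation_12 \<theta>) F"
  shows "G $ 2 $ 1 = cos \<theta> * (cos \<theta> * F $ 2 $ 1) - cos \<theta> * (sin \<theta> * (F $ 2 $ 3 + F $ 4 $ 1)) + sin \<theta> * (sin \<theta> * F $ 4 $ 3)"
    and "G $ 2 $ 1 + G $ 4 $ 3 = F $ 2 $ 1 + F $ 4 $ 3" and "G $ 6 $ 5 = F $ 6 $ 5"
proof -
  note E = Ad_entry[OF rotation_matrix_orthogonal[OF root_rotation_rotation(1)]]
  show 1: "G $ 2 $ 1 = cos \<theta> * (cos \<theta> * F $ 2 $ 1) - cos \<theta> * (sin \<theta> * (F $ 2 $ 3 + F $ 4 $ 1)) + sin \<theta> * (sin \<theta> * F $ 4 $ 3)"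
    and "G $ 6 $ 5 = F $ 6 $ 5"
    by (simp_all add: G_def E root_rotation_12_rows sum_6 algebra_simps)
  have 2: "G $ 4 $ 3 = sin \<theta> * (sin \<theta> * F $ 2 $ 1) + cos \<theta> * (sin \<theta> * (F $ 2 $ 3 + F $ 4 $ 1)) + cos \<theta> * (cos \<theta> * F $ 4 $ 3)"
    by (simp add: G_def E root_rotation_12_rows sum_6 algebra_simps)
  show "G $ 2 $ 1 + G $ 4 $ 3 = F $ 2 $ 1 + F $ 4 $ 3"
    unfolding 1 2 using cos_sin_split[of \<theta> "F $ 2 $ 1"] cos_sin_split[of \<theta> "F $ 4 $ 3"] by linarith
qed

lemma Ad_root_rotation_23:
  fixes F :: "real^6^6" and \<theta> \<epsilon> :: real
  assumes \<epsilon>: "\<epsilon> = 1 \<or> \<epsilon> = - 1"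
  defines "G \<equiv> Ad (root_rotation_23 \<epsilon> \<theta>) F"
  shows "G $ 4 $ 3 = cos \<theta> * (cos \<theta> * F $ 4 $ 3) - cos \<theta> * (sin \<theta> * (F $ 4 $ 5 + \<epsilon> * F $ 6 $ 3)) + \<epsilon> * (sin \<theta> * (sin \<theta> * F $ 6 $ 5))"
    and "G $ 4 $ 3 + \<epsilon> * G $ 6 $ 5 = F $ 4 $ 3 + \<epsilon> * F $ 6 $ 5" and "G $ 2 $ 1 = F $ 2 $ 1"
proof -
  note E = Ad_entry[OF rotation_matrix_orthogonal[OF root_rotation_rotation(2)]]
  have cs: "cos (\<epsilon> * \<theta>) = cos \<theta>" "sin (\<epsilon> * \<theta>) = \<epsilon> * sin \<theta>" "\<epsilon> * (\<epsilon> * x) = x" for x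
    using \<epsilon> by auto
  show 1: "G $ 4 $ 3 = cos \<theta> * (cos \<theta> * F $ 4 $ 3) - cos \<theta> * (sin \<theta> * (F $ 4 $ 5 + \<epsilon> * F $ 6 $ 3)) + \<epsilon> * (sin \<theta> * (sin \<theta> * F $ 6 $ 5))"
    and "G $ 2 $ 1 = F $ 2 $ 1"
    by (simp_all add: G_def E root_rotation_23_rows cs sum_6 algebra_simps)
  have "G $ 6 $ 5 = \<epsilon> * (sin \<theta> * (sin \<theta> * F $ 4 $ 3)) + cos \<theta> * (sin \<theta> * (\<epsilon> * F $ 4 $ 5 + F $ 6 $ 3)) + cos \<theta> * (cos \<theta> * F $ 6 $ 5)"
    by (simp add: G_def E root_rotation_23_rows cs sum_6 algebra_simps)
  then have "\<epsilon> * G $ 6 $ 5 = sin \<theta> * (sin \<theta> * F $ 4 $ 3) + cos \<theta> * (sin \<theta> * (F $ 4 $ 5 + \<epsilon> * F $ 6 $ 3)) + cos \<theta> * (cos \<theta> * (\<epsilon> * F $ 6 $ 5))"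
    using \<epsilon> by (auto simp: algebra_simps)
  then show "G $ 4 $ 3 + \<epsilon> * G $ 6 $ 5 = F $ 4 $ 3 + \<epsilon> * F $ 6 $ 5"
    using 1 cos_sin_split[of \<theta> "F $ 4 $ 3"] cos_sin_split[of \<theta> "\<epsilon> * F $ 6 $ 5"]
    by (simp add: mult.left_commute[of \<epsilon>])
qed

lemma IVT_between:
  fixes f :: "real \<Rightarrow> real"
  assumes "continuous_on UNIV f" "f a = u" "f b = v" "r \<in> closed_segment u v"
  obtains t where "f t = r"
proof -
  have "connected (range f)" using assms(1) connected_continuous_image connected_UNIV by blast
  moreover have "u \<in> range f" "v \<in> range f" using assms(2,3) by auto
  ultimately have "closed_segment u v \<subseteq> range f"
    by (simp add: closed_segment_eq_real_ivl connected_contains_Icc)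
  then show thesis using assms(4) that by auto
qed

lemma moment_segment_12:
  assumes "F \<in> adjoint_orbit F0" "r \<in> closed_segment (F $ 2 $ 1) (F $ 4 $ 3)"
  shows "vector [r, F $ 2 $ 1 + F $ 4 $ 3 - r, F $ 6 $ 5] \<in> block_sin ` adjoint_orbit F0"
proof -
  let ?G = "\<lambda>\<theta>. Ad (root_rotation_12 \<theta>) F"
  have "continuous_on UNIV (\<lambda>\<theta>. ?G \<theta> $ 2 $ 1)"
    unfolding Ad_root_rotation_12(1) by (intro continuous_intros)
  then obtain \<theta> where \<theta>: "?G \<theta> $ 2 $ 1 = r"
    by (rule IVT_between[where a = 0 and b = "pi / 2"]) (use assms(2) in \<open>auto simp: Ad_root_rotation_12(1)\<close>)
  have "block_sin (?G \<theta>) = vector [r, F $ 2 $ 1 + F $ 4 $ 3 - r, F $ 6 $ 5]"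
    using Ad_root_rotation_12(2,3)[of \<theta> F] \<theta> by (simp add: block_sin_def vec_eq_iff forall_3 vector_3)
  then show ?thesis
    using adjoint_orbit_Ad[OF assms(1) root_rotation_rotation(1)] by (metis image_eqI)
qed

lemma moment_segment_23:
  assumes \<epsilon>: "\<epsilon> = 1 \<or> \<epsilon> = - 1"
    and F: "F \<in> adjoint_orbit F0" and r: "r \<in> closed_segment (F $ 4 $ 3) (\<epsilon> * F $ 6 $ 5)"
  shows "vector [F $ 2 $ 1, r, F $ 6 $ 5 + \<epsilon> * (F $ 4 $ 3 - r)] \<in> block_sin ` adjoint_orbit F0"
proof -
  let ?G = "\<lambda>\<theta>. Ad (root_rotation_23 \<epsilon> \<theta>) F"
  have "continuous_on UNIV (\<lambda>\<theta>. ?G \<theta> $ 4 $ 3)"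
    unfolding Ad_root_rotation_23(1)[OF \<epsilon>] by (intro continuous_intros)
  then obtain \<theta> where \<theta>: "?G \<theta> $ 4 $ 3 = r"
    by (rule IVT_between[where a = 0 and b = "pi / 2"]) (use r in \<open>auto simp: Ad_root_rotation_23(1)[OF \<epsilon>]\<close>)
  have "?G \<theta> $ 6 $ 5 = F $ 6 $ 5 + \<epsilon> * (F $ 4 $ 3 - r)"
    using Ad_root_rotation_23(2)[OF \<epsilon>, of \<theta> F] \<theta> \<epsilon> by auto
  then have "block_sin (?G \<theta>) = vector [F $ 2 $ 1, r, F $ 6 $ 5 + \<epsilon> * (F $ 4 $ 3 - r)]"
    using Ad_root_rotation_23(3)[OF \<epsilon>, of \<theta> F] \<theta> by (simp add: block_sin_def vec_eq_iff forall_3 vector_3)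
  then show ?thesis
    using adjoint_orbit_Ad[OF F root_rotation_rotation(2)] by (metis image_eqI)
qed

text \<open>
  While the angle of a root rotation grows from \<open>0\<close> to \<open>\<pi>/2\<close>, the image point travels on a line from \<open>y\<close>
  to its mirror image, one of \<open>(y\<^sub>2, y\<^sub>1, y\<^sub>3)\<close>, \<open>(y\<^sub>1, y\<^sub>3, y\<^sub>2)\<close> and \<open>(y\<^sub>1, - y\<^sub>3, - y\<^sub>2)\<close>, and by continuity it
  passes through the whole segment.
\<close>

lemma moment_image_segments:
  fixes F0 :: "real^6^6"
  defines "K \<equiv> block_sin ` adjoint_orbit F0"
  assumes y: "y \<in> K"
  shows "r \<in> closed_segment (y $ 1) (y $ 2) \<Longrightarrow> vector [r, y $ 1 + y $ 2 - r, y $ 3] \<in> K"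
    and "r \<in> closed_segment (y $ 2) (y $ 3) \<Longrightarrow> vector [y $ 1, r, y $ 3 + y $ 2 - r] \<in> K"
    and "r \<in> closed_segment (y $ 2) (- y $ 3) \<Longrightarrow> vector [y $ 1, r, y $ 3 - y $ 2 + r] \<in> K"
proof -
  obtain F where F: "F \<in> adjoint_orbit F0" "y = block_sin F" using y by (auto simp: K_def)
  have yF: "y $ 1 = F $ 2 $ 1" "y $ 2 = F $ 4 $ 3" "y $ 3 = F $ 6 $ 5"
    by (simp_all add: F(2) block_sin_def vector_3)
  show "vector [r, y $ 1 + y $ 2 - r, y $ 3] \<in> K" if "r \<in> closed_segment (y $ 1) (y $ 2)"
    using moment_segment_12[OF F(1)] that by (simp add: K_def yF)
  show "vector [y $ 1, r, y $ 3 + y $ 2 - r] \<in> K" if "r \<in> closed_segment (y $ 2) (y $ 3)"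
    using moment_segment_23[OF _ F(1), of 1 r] that by (simp add: K_def yF algebra_simps)
  show "vector [y $ 1, r, y $ 3 - y $ 2 + r] \<in> K" if "r \<in> closed_segment (y $ 2) (- y $ 3)"
    using moment_segment_23[OF _ F(1), of "- 1" r] that by (simp add: K_def yF algebra_simps)
qed

section \<open>Maximising a regular linear functional\<close>

lemma inner_torus_element:
  assumes "F \<in> skew_matrices"
  shows "F \<bullet> torus_element x = 2 * (block_sin F \<bullet> x)"
proof -
  have "F $ k $ l = - F $ l $ k" for k l
    using arg_cong[OF skew_matricesD[OF assms], of "\<lambda>M. M $ l $ k"] by (simp add: transpose_def)
  from this[of 1 2] this[of 3 4] this[of 5 6] show ?thesis
    by (simp add: matrix_inner sum_6 torus_element_eq torus_matrix_def block_sin_def inner_vec_def sum_3 vector_3)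
qed

text \<open>
  The derivative of the functional along the one-parameter group of \<open>X = [F, \<xi>]\<close> is \<open>\<parallel>X\<parallel>\<^sup>2\<close>, and it
  vanishes at a maximum.
\<close>

lemma maximum_commutes:
  fixes \<xi> :: "real^'n^'n"
  assumes F: "F \<in> skew_matrices" and \<xi>: "\<xi> \<in> skew_matrices"
    and max: "\<And>G. G \<in> adjoint_orbit F \<Longrightarrow> G \<bullet> \<xi> \<le> F \<bullet> \<xi>"
  shows "bracket F \<xi> = 0"
proof -
  define X where "X = bracket F \<xi>"
  have X: "X \<in> skew_matrices" unfolding X_def by (rule bracket_in_skew[OF F \<xi>])
  let ?f = "\<lambda>t. Ad (mat_exp (t *\<^sub>R X)) F \<bullet> \<xi>"
  have "(?f has_vector_derivative bracket X F \<bullet> \<xi>) (at 0)"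
    by (rule bounded_linear.has_vector_derivative[OF bounded_linear_inner_left
          Ad_exp_has_vector_derivative[OF skew_matricesD[OF X]]])
  then have D: "(?f has_real_derivative bracket X F \<bullet> \<xi>) (at 0)"
    by (simp add: has_real_derivative_iff_has_vector_derivative)
  have "\<forall>t. \<bar>0 - t\<bar> < 1 \<longrightarrow> ?f t \<le> ?f 0"
    using max adjoint_orbit_Ad[OF adjoint_orbit_refl mat_exp_skew_rotation[OF skew_matricesD[OF X]]]
    by (simp add: Ad_mat_1)
  then have "bracket X F \<bullet> \<xi> = 0"
    using DERIV_local_max[OF D] by (metis zero_less_one)
  moreover have "bracket X F \<bullet> \<xi> = X \<bullet> X"
    using bracket_inner_skew[OF skew_matricesD[OF F], of X \<xi>] by (simp add: bracket_swap[of "bracket F \<xi>" F] X_def)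
  ultimately show ?thesis by (simp add: X_def)
qed

text \<open>
  An off-diagonal block of a matrix that commutes with the torus element \<open>x\<close> intertwines multiplication
  by \<open>\<i> x\<^sub>k\<close> and \<open>\<i> x\<^sub>l\<close>, so it vanishes as soon as \<open>x\<^sub>k\<^sup>2 \<noteq> x\<^sub>l\<^sup>2\<close>.
\<close>

lemma regular_commutant_torus:
  assumes F: "F \<in> skew_matrices" and comm: "bracket F (torus_element x) = 0"
    and reg: "(x $ 1)\<^sup>2 \<noteq> (x $ 2)\<^sup>2" "(x $ 1)\<^sup>2 \<noteq> (x $ 3)\<^sup>2" "(x $ 2)\<^sup>2 \<noteq> (x $ 3)\<^sup>2"
  shows "F = torus_element (block_sin F)"
proof -
  have skew: "F $ k $ l = - F $ l $ k" for k l
    using arg_cong[OF skew_matricesD[OF F], of "\<lambda>M. M $ l $ k"] by (simp add: transpose_def)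
  have diag: "F $ k $ k = 0" for k using skew[of k k] by simp
  have zero: "a = 0" "b = 0" if "p * a = q * b" "q * a = p * b" "p\<^sup>2 \<noteq> q\<^sup>2" for a b p q :: real
  proof -
    have "(p\<^sup>2 - q\<^sup>2) * a = p * (p * a) - q * (q * a)" by (simp add: power2_eq_square algebra_simps)
    also have "\<dots> = p * (q * b) - q * (p * b)" by (simp only: that)
    finally have a: "(p\<^sup>2 - q\<^sup>2) * a = 0" by simp
    have "(p\<^sup>2 - q\<^sup>2) * b = p * (p * b) - q * (q * b)" by (simp add: power2_eq_square algebra_simps)
    also have "\<dots> = p * (q * a) - q * (p * a)" by (simp only: that)
    finally have b: "(p\<^sup>2 - q\<^sup>2) * b = 0" by simp
    from a b that(3) show "a = 0" "b = 0" by simp_all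
  qed
  have E: "(F ** torus_element x) $ k $ l = (torus_element x ** F) $ k $ l" for k l
    using comm by (simp add: bracket_eq_0_iff)
  have col: "(F ** torus_element x) $ k $ 3 = F $ k $ 4 * x $ 2" "(F ** torus_element x) $ k $ 4 = - (F $ k $ 3 * x $ 2)"
    "(F ** torus_element x) $ k $ 5 = F $ k $ 6 * x $ 3" "(F ** torus_element x) $ k $ 6 = - (F $ k $ 5 * x $ 3)" for k
    by (simp_all add: sum_6 matrix_matrix_mult_def torus_element_eq torus_matrix_def)
  have row: "(torus_element x ** F) $ 1 $ l = - (x $ 1 * F $ 2 $ l)" "(torus_element x ** F) $ 2 $ l = x $ 1 * F $ 1 $ l"
    "(torus_element x ** F) $ 3 $ l = - (x $ 2 * F $ 4 $ l)" "(torus_element x ** F) $ 4 $ l = x $ 2 * F $ 3 $ l" for l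
    by (simp_all add: sum_6 matrix_matrix_mult_def torus_element_eq torus_matrix_def)
  have eqs: "x $ 2 * F $ 1 $ 4 = - x $ 1 * F $ 2 $ 3" "x $ 2 * F $ 1 $ 3 = x $ 1 * F $ 2 $ 4"
     "x $ 2 * F $ 2 $ 4 = x $ 1 * F $ 1 $ 3" "- x $ 2 * F $ 2 $ 3 = x $ 1 * F $ 1 $ 4"
     "x $ 3 * F $ 1 $ 6 = - x $ 1 * F $ 2 $ 5" "x $ 3 * F $ 1 $ 5 = x $ 1 * F $ 2 $ 6"
     "x $ 3 * F $ 2 $ 6 = x $ 1 * F $ 1 $ 5" "- x $ 3 * F $ 2 $ 5 = x $ 1 * F $ 1 $ 6"
     "x $ 3 * F $ 3 $ 6 = - x $ 2 * F $ 4 $ 5" "x $ 3 * F $ 3 $ 5 = x $ 2 * F $ 4 $ 6"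
     "x $ 3 * F $ 4 $ 6 = x $ 2 * F $ 3 $ 5" "- x $ 3 * F $ 4 $ 5 = x $ 2 * F $ 3 $ 6"
    using E[of 1 3] E[of 1 4] E[of 2 3] E[of 2 4] E[of 1 5] E[of 1 6] E[of 2 5] E[of 2 6]
      E[of 3 5] E[of 3 6] E[of 4 5] E[of 4 6]
    unfolding col row by (simp_all only: mult.commute minus_mult_left neg_equal_iff_equal)
  have reg': "(x $ 2)\<^sup>2 \<noteq> (- x $ 1)\<^sup>2" "(x $ 3)\<^sup>2 \<noteq> (- x $ 1)\<^sup>2" "(x $ 3)\<^sup>2 \<noteq> (- x $ 2)\<^sup>2"
    "(x $ 2)\<^sup>2 \<noteq> (x $ 1)\<^sup>2" "(x $ 3)\<^sup>2 \<noteq> (x $ 1)\<^sup>2" "(x $ 3)\<^sup>2 \<noteq> (x $ 2)\<^sup>2"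
    using reg by auto
  have off: "F $ 1 $ 4 = 0" "F $ 2 $ 3 = 0" "F $ 1 $ 3 = 0" "F $ 2 $ 4 = 0"
    "F $ 1 $ 6 = 0" "F $ 2 $ 5 = 0" "F $ 1 $ 5 = 0" "F $ 2 $ 6 = 0"
    "F $ 3 $ 6 = 0" "F $ 4 $ 5 = 0" "F $ 3 $ 5 = 0" "F $ 4 $ 6 = 0"
    using zero[OF eqs(1) _ reg'(1)] zero[OF eqs(2) _ reg'(4)] zero[OF eqs(5) _ reg'(2)] zero[OF eqs(6) _ reg'(5)]
      zero[OF eqs(9) _ reg'(3)] zero[OF eqs(10) _ reg'(6)] eqs by auto
  have off': "F $ l $ k = 0" if "F $ k $ l = 0" for k l using skew[of l k] that by simp
  show ?thesis
    by (simp add: vec_eq_iff forall_6 torus_element_eq torus_matrix_def block_sin_def vector_3 diag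
        off off[THEN off'] skew[of 1 2] skew[of 3 4] skew[of 5 6])
qed

section \<open>Invariants separating dominant torus elements\<close>

definition rows6 :: "real^6 \<Rightarrow> real^6 \<Rightarrow> real^6 \<Rightarrow> real^6 \<Rightarrow> real^6 \<Rightarrow> real^6 \<Rightarrow> real^6^6" where
  "rows6 a b c d e f = (\<chi> i. if i = 1 then a else if i = 2 then b else if i = 3 then c
     else if i = 4 then d else if i = 5 then e else f)"

definition volume6 :: "real^6 \<Rightarrow> real^6 \<Rightarrow> real^6 \<Rightarrow> real^6 \<Rightarrow> real^6 \<Rightarrow> real^6 \<Rightarrow> real" where
  "volume6 a b c d e f = det (rows6 a b c d e f)"

lemma linear_det_row:
  fixes c :: "'n::finite \<Rightarrow> real^'n"
  shows "linear (\<lambda>a. det (\<chi> i. if i = k then a else c i))"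
proof (rule linearI)
  fix a b :: "real^'n" and t :: real
  show "det (\<chi> i. if i = k then a + b else c i) = det (\<chi> i. if i = k then a else c i) + det (\<chi> i. if i = k then b else c i)"
    by (rule det_row_add)
  show "det (\<chi> i. if i = k then t *\<^sub>R a else c i) = t *\<^sub>R det (\<chi> i. if i = k then a else c i)"
    using det_row_mul[of k t "\<lambda>_. a" c] unfolding scalar_mult_eq_scaleR by simp
qed

lemma linear_volume6:
  "linear (\<lambda>a. volume6 a b c d e f)" "linear (\<lambda>b. volume6 a b c d e f)" "linear (\<lambda>c. volume6 a b c d e f)"
  "linear (\<lambda>d. volume6 a b c d e f)" "linear (\<lambda>e. volume6 a b c d e f)" "linear (\<lambda>f. volume6 a b c d e f)"
proof -
  have eq: "rows6 a b c d e f = (\<chi> i. if i = 1 then a else rows6 0 b c d e f $ i)"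
    "rows6 a b c d e f = (\<chi> i. if i = 2 then b else rows6 a 0 c d e f $ i)"
    "rows6 a b c d e f = (\<chi> i. if i = 3 then c else rows6 a b 0 d e f $ i)"
    "rows6 a b c d e f = (\<chi> i. if i = 4 then d else rows6 a b c 0 e f $ i)"
    "rows6 a b c d e f = (\<chi> i. if i = 5 then e else rows6 a b c d 0 f $ i)"
    "rows6 a b c d e f = (\<chi> i. if i = 6 then f else rows6 a b c d e 0 $ i)" for a b c d e f
    by (subst vec_eq_iff, simp add: forall_6 rows6_def)+
  show "linear (\<lambda>a. volume6 a b c d e f)" unfolding volume6_def by (subst eq(1)) (rule linear_det_row)
  show "linear (\<lambda>b. volume6 a b c d e f)" unfolding volume6_def by (subst eq(2)) (rule linear_det_row)
  show "linear (\<lambda>c. volume6 a b c d e f)" unfolding volume6_def by (subst eq(3)) (rule linear_det_row)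
  show "linear (\<lambda>d. volume6 a b c d e f)" unfolding volume6_def by (subst eq(4)) (rule linear_det_row)
  show "linear (\<lambda>e. volume6 a b c d e f)" unfolding volume6_def by (subst eq(5)) (rule linear_det_row)
  show "linear (\<lambda>f. volume6 a b c d e f)" unfolding volume6_def by (subst eq(6)) (rule linear_det_row)
qed

lemma bilinear_volume6:
  "bilinear (\<lambda>a b. volume6 a b c d e f)" "bilinear (\<lambda>c d. volume6 a b c d e f)" "bilinear (\<lambda>e f. volume6 a b c d e f)"
  unfolding bilinear_def by ((intro conjI allI; rule linear_volume6))+

lemma volume6_matrix:
  "volume6 (A *v a) (A *v b) (A *v c) (A *v d) (A *v e) (A *v f) = det A * volume6 a b c d e f"
proof -
  have row: "(M ** transpose A) $ i = A *v (M $ i)" for M and i :: 6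
    by (simp add: vec_eq_iff matrix_matrix_mult_def matrix_vector_mult_def transpose_def mult.commute)
  have "\<forall>i. rows6 (A *v a) (A *v b) (A *v c) (A *v d) (A *v e) (A *v f) $ i = (rows6 a b c d e f ** transpose A) $ i"
    unfolding forall_6 row by (simp add: rows6_def)
  then have "rows6 (A *v a) (A *v b) (A *v c) (A *v d) (A *v e) (A *v f) = rows6 a b c d e f ** transpose A"
    by (rule iffD2[OF vec_eq_iff])
  then show ?thesis by (simp add: volume6_def det_mul mult.commute)
qed

text \<open>
  Stated with the rows of one matrix, so that every reordering of the six arguments is an instance.
\<close>

lemma volume6_permute:
  fixes a b c d e f :: "real^6"
  assumes "p permutes UNIV"
  defines "M \<equiv> rows6 a b c d e f"
  shows "volume6 (M $ p 1) (M $ p 2) (M $ p 3) (M $ p 4) (M $ p 5) (M $ p 6) = of_int (sign p) * volume6 a b c d e f"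
proof -
  have "\<forall>i. rows6 (M $ p 1) (M $ p 2) (M $ p 3) (M $ p 4) (M $ p 5) (M $ p 6) $ i = (\<chi> i. M $ p i) $ i"
    unfolding forall_6 by (simp add: rows6_def)
  then have "rows6 (M $ p 1) (M $ p 2) (M $ p 3) (M $ p 4) (M $ p 5) (M $ p 6) = (\<chi> i. M $ p i)"
    by (rule iffD2[OF vec_eq_iff])
  then show ?thesis
    using det_permute_rows[OF assms(1), of M] by (simp add: volume6_def M_def)
qed

lemma volume6_swap:
  "volume6 b a c d e f = - volume6 a b c d e f"
  "volume6 a b d c e f = - volume6 a b c d e f"
  "volume6 a b c d f e = - volume6 a b c d e f"
  "volume6 c d a b e f = volume6 a b c d e f"
  "volume6 a b e f c d = volume6 a b c d e f"
proof -
  let ?t = "Transposition.transpose :: 6 \<Rightarrow> 6 \<Rightarrow> 6 \<Rightarrow> 6"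
  have tr: "?t i j permutes UNIV" for i j by (rule permutes_swap_id) auto
  note simps = rows6_def Transposition.transpose_def sign_swap_id
  show "volume6 b a c d e f = - volume6 a b c d e f"
    using volume6_permute[OF tr[of 1 2], of a b c d e f] by (simp add: simps)
  show "volume6 a b d c e f = - volume6 a b c d e f"
    using volume6_permute[OF tr[of 3 4], of a b c d e f] by (simp add: simps)
  show "volume6 a b c d f e = - volume6 a b c d e f"
    using volume6_permute[OF tr[of 5 6], of a b c d e f] by (simp add: simps)
  have sg: "sign (?t i j \<circ> ?t k l) = 1" if "i \<noteq> j" "k \<noteq> l" for i j k l
    using that by (simp add: sign_compose permutation_swap_id sign_swap_id)
  show "volume6 c d a b e f = volume6 a b c d e f"
    using volume6_permute[OF permutes_compose[OF tr[of 2 4] tr[of 1 3]], of a b c d e f] sg[of 1 3 2 4]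
    by (simp add: simps)
  show "volume6 a b e f c d = volume6 a b c d e f"
    using volume6_permute[OF permutes_compose[OF tr[of 4 6] tr[of 3 5]], of a b c d e f] sg[of 3 5 4 6]
    by (simp add: simps)
qed

lemma volume6_equal_rows:
  "volume6 a b a d e f = 0" "volume6 a b c d a f = 0" "volume6 a b c d c f = 0"
proof -
  show "volume6 a b a d e f = 0" unfolding volume6_def
    by (rule det_identical_rows[of 1 3]) (auto simp: row_def rows6_def)
  show "volume6 a b c d a f = 0" unfolding volume6_def
    by (rule det_identical_rows[of 1 5]) (auto simp: row_def rows6_def)
  show "volume6 a b c d c f = 0" unfolding volume6_def
    by (rule det_identical_rows[of 3 5]) (auto simp: row_def rows6_def)
qed

lemma volume6_standard: "volume6 (cov 1) (cov 2) (cov 3) (cov 4) (cov 5) (cov 6) = 1"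
proof -
  have "rows6 (cov 1) (cov 2) (cov 3) (cov 4) (cov 5) (cov 6) = mat 1"
    by (simp add: vec_eq_iff forall_6 rows6_def cov_def mat_def axis_def)
  then show ?thesis by (simp add: volume6_def)
qed

text \<open>
  A multiple of the Pfaffian: the volume of \<open>F \<and> F \<and> F\<close>, where \<open>F\<close> is written as the bivector
  \<open>\<Sum>i. e\<^sub>i \<and> F e\<^sub>i\<close>.  In this form its behaviour under rotations needs only the independence of such sums of
  the orthonormal frame.
\<close>

definition pfaffian_sum :: "real^6^6 \<Rightarrow> real" where
  "pfaffian_sum F = (\<Sum>i\<in>UNIV. \<Sum>j\<in>UNIV. \<Sum>k\<in>UNIV.
     volume6 (cov i) (F *v cov i) (cov j) (F *v cov j) (cov k) (F *v cov k))"

lemma orthonormal_frame_sum: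
  assumes \<Phi>: "bilinear \<Phi>" and A: "orthogonal_matrix (A :: real^6^6)" 
  shows "(\<Sum>i\<in>UNIV. \<Phi> (A *v cov i) (L *v (A *v cov i))) = (\<Sum>i\<in>UNIV. \<Phi> (cov i) (L *v cov i) :: real)"
proof -
  have Ai: "A *v cov i = (\<Sum>m\<in>UNIV. A $ m $ i *\<^sub>R cov m)" for i
    using basis_expansion[of "column i A"]
    by (simp add: cov_def matrix_vector_mult_basis scalar_mult_eq_scaleR column_def)
  have LA: "L *v (A *v cov i) = (\<Sum>n\<in>UNIV. A $ n $ i *\<^sub>R (L *v cov n))" for i
    unfolding Ai by (simp add: matrix_vector_mult_scaleR linear_sum[OF matrix_vector_mul_linear] o_def)
  have orth: "(\<Sum>i\<in>UNIV. A $ m $ i * A $ n $ i) = (if m = n then 1 else 0)" for m n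
  proof -
    have "(A ** transpose A) $ m $ n = (mat 1 :: real^6^6) $ m $ n"
      using A by (simp add: orthogonal_matrix_def)
    then show ?thesis by (simp add: matrix_matrix_mult_def transpose_def mat_def)
  qed
  have "\<Phi> (A *v cov i) (L *v (A *v cov i)) = (\<Sum>(m, n)\<in>UNIV \<times> UNIV. A $ m $ i * A $ n $ i * \<Phi> (cov m) (L *v cov n))" for i
    by (subst LA, subst Ai) (simp add: bilinear_sum[OF \<Phi>] bilinear_lmul[OF \<Phi>] bilinear_rmul[OF \<Phi>] mult_ac)
  then have "(\<Sum>i\<in>UNIV. \<Phi> (A *v cov i) (L *v (A *v cov i))) =
      (\<Sum>i\<in>UNIV. \<Sum>(m, n)\<in>UNIV \<times> UNIV. A $ m $ i * A $ n $ i * \<Phi> (cov m) (L *v cov n))"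
    by simp
  also have "\<dots> = (\<Sum>(m, n)\<in>UNIV \<times> UNIV. \<Sum>i\<in>UNIV. A $ m $ i * A $ n $ i * \<Phi> (cov m) (L *v cov n))"
    by (subst sum.swap) (simp add: case_prod_beta)
  also have "\<dots> = (\<Sum>(m, n)\<in>UNIV \<times> UNIV. (if m = n then 1 else 0) * \<Phi> (cov m) (L *v cov n))"
    by (simp add: sum_distrib_right[symmetric] orth)
  also have "\<dots> = (\<Sum>m\<in>UNIV. \<Sum>n\<in>UNIV. (if m = n then 1 else 0) * \<Phi> (cov m) (L *v cov n))"
    by (simp add: sum.cartesian_product)
  also have "\<dots> = (\<Sum>i\<in>UNIV. \<Phi> (cov i) (L *v cov i))"
    by (simp add: if_distrib[of "\<lambda>x. x * _"] cong: if_cong)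
  finally show ?thesis .
qed

text \<open>
  The standard frame is replaced by the frame \<open>A e\<^sub>i\<close> in each of the three pairs of arguments; then \<open>A\<close> can
  be taken out of the volume.
\<close>

lemma pfaffian_sum_Ad:
  assumes A: "orthogonal_matrix A"
  shows "pfaffian_sum (Ad A F) = det A * pfaffian_sum F"
proof -
  let ?L = "Ad A F"
  have L: "?L *v (A *v u) = A *v (F *v u)" for u
  proof -
    have "?L ** A = A ** F ** (transpose A ** A)" by (simp add: Ad_orthogonal[OF A] matrix_mul_assoc)
    then have "?L ** A = A ** F" using A by (simp add: orthogonal_matrix)
    then show ?thesis by (simp add: matrix_vector_mul_assoc)
  qed
  let ?e = "\<lambda>i. A *v cov i" and ?g = "\<lambda>i. ?L *v (A *v cov i)"
  have rev: "(\<Sum>k\<in>UNIV. \<Sum>j\<in>UNIV. \<Sum>i\<in>UNIV. h i j k) = (\<Sum>i\<in>UNIV. \<Sum>j\<in>UNIV. \<Sum>k\<in>UNIV. h i j k)"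
    for h :: "6 \<Rightarrow> 6 \<Rightarrow> 6 \<Rightarrow> real"
  proof -
    have "(\<Sum>k\<in>UNIV. \<Sum>j\<in>UNIV. \<Sum>i\<in>UNIV. h i j k) = (\<Sum>k\<in>UNIV. \<Sum>i\<in>UNIV. \<Sum>j\<in>UNIV. h i j k)"
      by (rule sum.cong[OF refl]) (rule sum.swap)
    also have "\<dots> = (\<Sum>i\<in>UNIV. \<Sum>k\<in>UNIV. \<Sum>j\<in>UNIV. h i j k)" by (rule sum.swap)
    also have "\<dots> = (\<Sum>i\<in>UNIV. \<Sum>j\<in>UNIV. \<Sum>k\<in>UNIV. h i j k)"
      by (rule sum.cong[OF refl]) (rule sum.swap)
    finally show ?thesis .
  qed
  have "pfaffian_sum ?L = (\<Sum>i\<in>UNIV. \<Sum>j\<in>UNIV. \<Sum>k\<in>UNIV.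
      volume6 (cov i) (?L *v cov i) (cov j) (?L *v cov j) (?e k) (?g k))"
    unfolding pfaffian_sum_def
    by (rule sum.cong[OF refl], rule sum.cong[OF refl], rule orthonormal_frame_sum[OF bilinear_volume6(3) A, symmetric])
  also have "\<dots> = (\<Sum>i\<in>UNIV. \<Sum>k\<in>UNIV. \<Sum>j\<in>UNIV.
      volume6 (cov i) (?L *v cov i) (cov j) (?L *v cov j) (?e k) (?g k))"
    by (rule sum.cong[OF refl]) (rule sum.swap)
  also have "\<dots> = (\<Sum>i\<in>UNIV. \<Sum>k\<in>UNIV. \<Sum>j\<in>UNIV.
      volume6 (cov i) (?L *v cov i) (?e j) (?g j) (?e k) (?g k))"
    by (rule sum.cong[OF refl], rule sum.cong[OF refl], rule orthonormal_frame_sum[OF bilinear_volume6(2) A, symmetric])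
  also have "\<dots> = (\<Sum>k\<in>UNIV. \<Sum>i\<in>UNIV. \<Sum>j\<in>UNIV.
      volume6 (cov i) (?L *v cov i) (?e j) (?g j) (?e k) (?g k))"
    by (rule sum.swap)
  also have "\<dots> = (\<Sum>k\<in>UNIV. \<Sum>j\<in>UNIV. \<Sum>i\<in>UNIV.
      volume6 (cov i) (?L *v cov i) (?e j) (?g j) (?e k) (?g k))"
    by (rule sum.cong[OF refl]) (rule sum.swap)
  also have "\<dots> = (\<Sum>k\<in>UNIV. \<Sum>j\<in>UNIV. \<Sum>i\<in>UNIV.
      volume6 (?e i) (?g i) (?e j) (?g j) (?e k) (?g k))"
    by (rule sum.cong[OF refl], rule sum.cong[OF refl], rule orthonormal_frame_sum[OF bilinear_volume6(1) A, symmetric])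
  also have "\<dots> = (\<Sum>i\<in>UNIV. \<Sum>j\<in>UNIV. \<Sum>k\<in>UNIV.
      volume6 (?e i) (?g i) (?e j) (?g j) (?e k) (?g k))"
    by (rule rev)
  also have "\<dots> = det A * pfaffian_sum F"
    unfolding L volume6_matrix pfaffian_sum_def by (simp add: sum_distrib_left)
  finally show ?thesis .
qed

lemma torus_element_frame_sum:
  assumes \<Phi>: "bilinear \<Phi>" and alt: "\<And>a b. \<Phi> b a = - \<Phi> a b"
  shows "(\<Sum>i\<in>UNIV. \<Phi> (cov i) (torus_element x *v cov i)) =
    2 * (x $ 1 * \<Phi> (cov 1) (cov 2) + x $ 2 * \<Phi> (cov 3) (cov 4) + x $ 3 * \<Phi> (cov 5) (cov 6) :: real)"
proof -
  have T: "torus_element x *v cov 1 = x $ 1 *\<^sub>R cov 2" "torus_element x *v cov 2 = - (x $ 1) *\<^sub>R cov 1"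
    "torus_element x *v cov 3 = x $ 2 *\<^sub>R cov 4" "torus_element x *v cov 4 = - (x $ 2) *\<^sub>R cov 3"
    "torus_element x *v cov 5 = x $ 3 *\<^sub>R cov 6" "torus_element x *v cov 6 = - (x $ 3) *\<^sub>R cov 5"
    by (simp_all add: vec_eq_iff forall_6 sum_6 matrix_vector_mult_def cov_def axis_def torus_element_eq torus_matrix_def)
  show ?thesis
    unfolding sum_6 T bilinear_rmul[OF \<Phi>]
    using alt[of "cov 1" "cov 2"] alt[of "cov 3" "cov 4"] alt[of "cov 5" "cov 6"] by simp
qed

lemma pfaffian_sum_torus_element: "pfaffian_sum (torus_element x) = 48 * (x $ 1 * x $ 2 * x $ 3)"
proof -
  have e: "volume6 (cov 1) (cov 2) (cov 5) (cov 6) (cov 3) (cov 4) = 1"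
    "volume6 (cov 3) (cov 4) (cov 1) (cov 2) (cov 5) (cov 6) = 1"
    "volume6 (cov 3) (cov 4) (cov 5) (cov 6) (cov 1) (cov 2) = 1"
    "volume6 (cov 5) (cov 6) (cov 1) (cov 2) (cov 3) (cov 4) = 1"
    "volume6 (cov 5) (cov 6) (cov 3) (cov 4) (cov 1) (cov 2) = 1"
    using volume6_standard volume6_swap(4,5) by metis+
  let ?T = "torus_element x" and ?V = volume6
  have sum3: "(\<Sum>j\<in>UNIV. c * (a * f j + a' * g j + a'' * h j)) = c * (a * (\<Sum>j\<in>UNIV. f j) + a' * (\<Sum>j\<in>UNIV. g j) + a'' * (\<Sum>j\<in>UNIV. h j))"
    for c a a' a'' :: real and f g h :: "6 \<Rightarrow> real"
    by (simp only: sum_distrib_left[symmetric] sum.distrib)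
  have "(\<Sum>j\<in>UNIV. \<Sum>k\<in>UNIV. ?V (cov i) (?T *v cov i) (cov j) (?T *v cov j) (cov k) (?T *v cov k)) =
      8 * (x $ 1 * x $ 2 * ?V (cov i) (?T *v cov i) (cov 1) (cov 2) (cov 3) (cov 4) +
           x $ 1 * x $ 3 * ?V (cov i) (?T *v cov i) (cov 1) (cov 2) (cov 5) (cov 6) +
           x $ 2 * x $ 3 * ?V (cov i) (?T *v cov i) (cov 3) (cov 4) (cov 5) (cov 6))" for i
    unfolding torus_element_frame_sum[OF bilinear_volume6(3) volume6_swap(3)] sum3
      torus_element_frame_sum[OF bilinear_volume6(2) volume6_swap(2)] volume6_equal_rows(3)
    unfolding volume6_swap(5)[of "cov i" "?T *v cov i" "cov 3" "cov 4" "cov 1" "cov 2"]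
      volume6_swap(5)[of "cov i" "?T *v cov i" "cov 5" "cov 6" "cov 1" "cov 2"]
      volume6_swap(5)[of "cov i" "?T *v cov i" "cov 5" "cov 6" "cov 3" "cov 4"]
    by (simp add: algebra_simps)
  then show ?thesis
    unfolding pfaffian_sum_def
    by (simp only: sum3 torus_element_frame_sum[OF bilinear_volume6(1) volume6_swap(1)] volume6_equal_rows e volume6_standard)
      (simp add: algebra_simps)
qed

lemma Ad_inner:
  assumes "orthogonal_matrix (A :: real^'n^'n)"
  shows "Ad A X \<bullet> Ad A Y = X \<bullet> Y"
proof -
  have "Ad A X \<bullet> Ad A Y = (A ** X) \<bullet> (Ad A Y ** A)"
    by (simp add: Ad_orthogonal[OF assms, of X] inner_matrix_mul_right)
  also have "\<dots> = X \<bullet> (transpose A ** (Ad A Y ** A))" by (rule inner_matrix_mul_left)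
  also have "transpose A ** (Ad A Y ** A) = Ad (transpose A) (Ad A Y)"
    using assms by (simp add: Ad_orthogonal matrix_mul_assoc)
  finally show ?thesis by (simp add: Ad_transpose_cancel[OF assms])
qed

lemma inner_torus_matrix: "torus_matrix c s \<bullet> torus_matrix c' s' = 2 * (c \<bullet> c' + s \<bullet> s')"
  by (simp add: matrix_inner sum_6 torus_matrix_def inner_vec_def sum_3)

definition dominant :: "real^3 \<Rightarrow> bool" where
  "dominant y \<longleftrightarrow> y $ 2 \<le> y $ 1 \<and> \<bar>y $ 3\<bar> \<le> y $ 2"

text \<open>
  The two power sums and the square of the product determine the elementary symmetric functions of
  \<open>a\<^sup>2, b\<^sup>2, c\<^sup>2\<close>, hence these numbers.  The product itself then settles the sign of \<open>c\<close>.
\<close>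

lemma power_sums_dominant_unique:
  fixes a b c a' b' c' :: real
  assumes d: "b \<le> a" "\<bar>c\<bar> \<le> b" and d': "b' \<le> a'" "\<bar>c'\<bar> \<le> b'"
    and p1: "a\<^sup>2 + b\<^sup>2 + c\<^sup>2 = a'\<^sup>2 + b'\<^sup>2 + c'\<^sup>2"
    and p2: "(a\<^sup>2)\<^sup>2 + (b\<^sup>2)\<^sup>2 + (c\<^sup>2)\<^sup>2 = (a'\<^sup>2)\<^sup>2 + (b'\<^sup>2)\<^sup>2 + (c'\<^sup>2)\<^sup>2"
    and p3: "a * b * c = a' * b' * c'"
  shows "a = a' \<and> b = b' \<and> c = c'"
proof -
  have sq: "y\<^sup>2 \<le> x\<^sup>2" if "\<bar>y\<bar> \<le> x" for x y :: real
    using that by (metis abs_ge_zero abs_le_square_iff abs_of_nonneg order_trans)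
  have nn: "0 \<le> b" "0 \<le> a" "0 \<le> b'" "0 \<le> a'" using d d' by linarith+
  have o: "c\<^sup>2 \<le> b\<^sup>2" "b\<^sup>2 \<le> a\<^sup>2" "c'\<^sup>2 \<le> b'\<^sup>2" "b'\<^sup>2 \<le> a'\<^sup>2"
    using d d' nn by (auto intro!: sq)
  have e2: "a\<^sup>2 * b\<^sup>2 + a\<^sup>2 * c\<^sup>2 + b\<^sup>2 * c\<^sup>2 = a'\<^sup>2 * b'\<^sup>2 + a'\<^sup>2 * c'\<^sup>2 + b'\<^sup>2 * c'\<^sup>2"
  proof -
    have q: "(x + y + z)\<^sup>2 = x\<^sup>2 + y\<^sup>2 + z\<^sup>2 + 2 * (x * y + x * z + y * z)" for x y z :: real
      by (simp add: power2_eq_square algebra_simps)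
    show ?thesis using q[of "a\<^sup>2" "b\<^sup>2" "c\<^sup>2"] q[of "a'\<^sup>2" "b'\<^sup>2" "c'\<^sup>2"] p1 p2 by simp
  qed
  have e3: "a\<^sup>2 * b\<^sup>2 * c\<^sup>2 = a'\<^sup>2 * b'\<^sup>2 * c'\<^sup>2"
    using p3 by (metis power_mult_distrib)
  have cubic: "(z - x) * (z - y) * (z - w) = z ^ 3 - (x + y + w) * z\<^sup>2 + (x * y + x * w + y * w) * z - x * y * w"
    for x y z w :: real by (simp add: power2_eq_square power3_eq_cube algebra_simps)
  have roots: "(z - a\<^sup>2) * (z - b\<^sup>2) * (z - c\<^sup>2) = (z - a'\<^sup>2) * (z - b'\<^sup>2) * (z - c'\<^sup>2)" for z
    unfolding cubic p1 e2 e3 ..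
  have "a\<^sup>2 = a'\<^sup>2 \<or> a\<^sup>2 = b'\<^sup>2 \<or> a\<^sup>2 = c'\<^sup>2" using roots[of "a\<^sup>2"] by auto
  moreover have "a'\<^sup>2 = a\<^sup>2 \<or> a'\<^sup>2 = b\<^sup>2 \<or> a'\<^sup>2 = c\<^sup>2" using roots[of "a'\<^sup>2"] by auto
  ultimately have a: "a\<^sup>2 = a'\<^sup>2" using o by linarith
  have s: "b\<^sup>2 + c\<^sup>2 = b'\<^sup>2 + c'\<^sup>2" using p1 a by simp
  have "a\<^sup>2 * (b\<^sup>2 + c\<^sup>2) + b\<^sup>2 * c\<^sup>2 = a'\<^sup>2 * (b'\<^sup>2 + c'\<^sup>2) + b'\<^sup>2 * c'\<^sup>2"
    using e2 by (simp add: algebra_simps)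
  then have m: "b\<^sup>2 * c\<^sup>2 = b'\<^sup>2 * c'\<^sup>2" using a s by simp
  have quad: "(z - x) * (z - y) = z\<^sup>2 - (x + y) * z + x * y" for x y z :: real
    by (simp add: power2_eq_square algebra_simps)
  have roots2: "(z - b\<^sup>2) * (z - c\<^sup>2) = (z - b'\<^sup>2) * (z - c'\<^sup>2)" for z
    unfolding quad s m ..
  have "b\<^sup>2 = b'\<^sup>2 \<or> b\<^sup>2 = c'\<^sup>2" using roots2[of "b\<^sup>2"] by auto
  moreover have "b'\<^sup>2 = b\<^sup>2 \<or> b'\<^sup>2 = c\<^sup>2" using roots2[of "b'\<^sup>2"] by auto
  ultimately have b: "b\<^sup>2 = b'\<^sup>2" using o by linarith
  have eq: "a = a'" "b = b'" using a b nn by (simp_all add: power2_eq_iff_nonneg)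
  have c: "c\<^sup>2 = c'\<^sup>2" using s b by simp
  show ?thesis
  proof (cases "b = 0")
    case True
    then show ?thesis using d d' eq by auto
  next
    case False
    then have "a * b \<noteq> 0" using d nn by auto
    then show ?thesis using p3 eq by simp
  qed
qed

text \<open>
  The norms of \<open>F\<close> and \<open>F\<^sup>2\<close> are invariant under all orthogonal matrices.  They leave the sign of the
  third coordinate open, which the Pfaffian detects because it sees the orientation.
\<close>

theorem dominant_torus_element_unique:
  assumes "torus_element y \<in> adjoint_orbit (torus_element x)" "dominant x" "dominant y"
  shows "x = y"
proof -
  obtain A where A: "rotation_matrix A" "torus_element y = Ad A (torus_element x)"
    using assms(1) by (auto simp: adjoint_orbit_def)
  have o: "orthogonal_matrix A" and det: "det A = 1" using A(1) by (auto simp: rotation_matrix_def)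
  have "torus_element y \<bullet> torus_element y = torus_element x \<bullet> torus_element x"
    unfolding A(2) by (rule Ad_inner[OF o])
  then have p1: "x \<bullet> x = y \<bullet> y" by (simp add: torus_element_eq inner_torus_matrix)
  have "(torus_element y ** torus_element y) \<bullet> (torus_element y ** torus_element y) =
      (torus_element x ** torus_element x) \<bullet> (torus_element x ** torus_element x)"
    unfolding A(2) Ad_mul[OF o, symmetric] by (rule Ad_inner[OF o])
  then have p2: "(x * x) \<bullet> (x * x) = (y * y) \<bullet> (y * y)"
    by (simp add: torus_element_eq torus_matrix_mul inner_torus_matrix)
  have p3: "x $ 1 * x $ 2 * x $ 3 = y $ 1 * y $ 2 * y $ 3"
    using pfaffian_sum_Ad[OF o, of "torus_element x"] by (simp add: A(2)[symmetric] det pfaffian_sum_torus_element)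
  have "x $ 1 = y $ 1 \<and> x $ 2 = y $ 2 \<and> x $ 3 = y $ 3"
    using assms(2,3) p1 p2 p3
    by (intro power_sums_dominant_unique) (simp_all add: dominant_def inner_vec_def sum_3 power2_eq_square)
  then show ?thesis by (simp add: vec_eq_iff forall_3)
qed

section \<open>The moment polytope\<close>

text \<open>
  The maximum lies in the torus algebra, and its mirror images under the simple reflections belong to
  the moment image as well.  That they are not better for a strictly dominant functional is precisely
  dominance of the maximum.
\<close>

lemma maximum_dominant:
  assumes F0: "F0 \<in> skew_matrices" and x: "x $ 2 < x $ 1" "\<bar>x $ 3\<bar> < x $ 2"
  obtains m where "torus_element m \<in> adjoint_orbit F0" "dominant m"
    "\<And>y. y \<in> block_sin ` adjoint_orbit F0 \<Longrightarrow> y \<bullet> x \<le> m \<bullet> x"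
proof -
  let ?M = "adjoint_orbit F0"
  have skew: "G \<in> skew_matrices" if "G \<in> ?M" for G by (rule adjoint_orbit_skew[OF F0 that])
  have "continuous_on ?M (\<lambda>G. G \<bullet> torus_element x)" by (intro continuous_intros)
  then obtain F where F: "F \<in> ?M" "\<And>G. G \<in> ?M \<Longrightarrow> G \<bullet> torus_element x \<le> F \<bullet> torus_element x"
    using continuous_attains_sup[OF compact_adjoint_orbit] adjoint_orbit_refl by (metis empty_iff)
  have "bracket F (torus_element x) = 0"
    by (rule maximum_commutes[OF skew[OF F(1)] torus_element_skew]) (use F adjoint_orbit_eq[OF F(1)] in auto)
  moreover have "(x $ 1)\<^sup>2 \<noteq> (x $ 2)\<^sup>2" "(x $ 1)\<^sup>2 \<noteq> (x $ 3)\<^sup>2" "(x $ 2)\<^sup>2 \<noteq> (x $ 3)\<^sup>2"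
    using x by (auto simp: power2_eq_iff)
  ultimately have FT: "F = torus_element (block_sin F)"
    by (rule regular_commutant_torus[OF skew[OF F(1)]])
  define m where "m = block_sin F"
  have mK: "m \<in> block_sin ` ?M" using F(1) by (simp add: m_def)
  have max: "y \<bullet> x \<le> m \<bullet> x" if "y \<in> block_sin ` ?M" for y
    using that F by (auto simp: inner_torus_element skew m_def)
  have inner3: "vector [p, q, r] \<bullet> x = p * x $ 1 + q * x $ 2 + r * x $ 3" for p q r
    by (simp add: inner_vec_def sum_3 vector_3)
  have mx: "m \<bullet> x = m $ 1 * x $ 1 + m $ 2 * x $ 2 + m $ 3 * x $ 3" by (simp add: inner_vec_def sum_3)
  note seg = moment_image_segments[OF mK]
  have "vector [m $ 2, m $ 1, m $ 3] \<bullet> x \<le> m \<bullet> x" using max[OF seg(1)[of "m $ 2"]] by simp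
  then have "0 \<le> (m $ 1 - m $ 2) * (x $ 1 - x $ 2)" unfolding inner3 mx by (simp add: algebra_simps)
  then have 1: "m $ 2 \<le> m $ 1" using x(1) by (auto simp: zero_le_mult_iff)
  have "vector [m $ 1, m $ 3, m $ 2] \<bullet> x \<le> m \<bullet> x" using max[OF seg(2)[of "m $ 3"]] by simp
  then have "0 \<le> (m $ 2 - m $ 3) * (x $ 2 - x $ 3)" unfolding inner3 mx by (simp add: algebra_simps)
  then have 2: "m $ 3 \<le> m $ 2" using x(2) by (auto simp: zero_le_mult_iff)
  have "vector [m $ 1, - m $ 3, - m $ 2] \<bullet> x \<le> m \<bullet> x" using max[OF seg(3)[of "- m $ 3"]] by simp
  then have "0 \<le> (m $ 2 + m $ 3) * (x $ 2 + x $ 3)" unfolding inner3 mx by (simp add: algebra_simps)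
  then have 3: "- m $ 3 \<le> m $ 2" using x(2) by (auto simp: zero_le_mult_iff)
  show thesis
    by (rule that[of m]) (use F(1) FT 1 2 3 max in \<open>auto simp: dominant_def m_def\<close>)
qed

text \<open>
  For dominant \<open>l\<close>, the convex hull of the Weyl group orbit of \<open>l\<close>, given by its inequalities: the Weyl
  group, generated by permutations and even sign changes, moves the three bounds for the dominant
  functionals \<open>y\<^sub>1\<close>, \<open>y\<^sub>1 + y\<^sub>2 + y\<^sub>3\<close> and \<open>y\<^sub>1 + y\<^sub>2 - y\<^sub>3\<close> to those listed.
\<close>

definition weight_polytope :: "real^3 \<Rightarrow> (real^3) set" where
  "weight_polytope l = {y. (\<forall>i. \<bar>y $ i\<bar> \<le> l $ 1) \<and>
     y $ 1 + y $ 2 + y $ 3 \<le> l $ 1 + l $ 2 + l $ 3 \<and> y $ 1 - y $ 2 - y $ 3 \<le> l $ 1 + l $ 2 + l $ 3 \<and>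
     - y $ 1 + y $ 2 - y $ 3 \<le> l $ 1 + l $ 2 + l $ 3 \<and> - y $ 1 - y $ 2 + y $ 3 \<le> l $ 1 + l $ 2 + l $ 3 \<and>
     y $ 1 + y $ 2 - y $ 3 \<le> l $ 1 + l $ 2 - l $ 3 \<and> y $ 1 - y $ 2 + y $ 3 \<le> l $ 1 + l $ 2 - l $ 3 \<and>
     - y $ 1 + y $ 2 + y $ 3 \<le> l $ 1 + l $ 2 - l $ 3 \<and> - y $ 1 - y $ 2 - y $ 3 \<le> l $ 1 + l $ 2 - l $ 3}"

lemma polytope_weight_polytope: "polytope (weight_polytope l)"
proof -
  have half: "polyhedron {y :: real^3. a * y $ 1 + b * y $ 2 + c * y $ 3 \<le> d}" for a b c d
  proof -
    have "{y :: real^3. a * y $ 1 + b * y $ 2 + c * y $ 3 \<le> d} = {y. vector [a, b, c] \<bullet> y \<le> d}"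
      by (simp add: inner_vec_def sum_3 vector_3)
    then show ?thesis by (simp add: polyhedron_halfspace_le)
  qed
  have eq: "weight_polytope l =
    {y. 1 * y $ 1 + 0 * y $ 2 + 0 * y $ 3 \<le> l $ 1} \<inter> {y. - 1 * y $ 1 + 0 * y $ 2 + 0 * y $ 3 \<le> l $ 1} \<inter>
    {y. 0 * y $ 1 + 1 * y $ 2 + 0 * y $ 3 \<le> l $ 1} \<inter> {y. 0 * y $ 1 + - 1 * y $ 2 + 0 * y $ 3 \<le> l $ 1} \<inter>
    {y. 0 * y $ 1 + 0 * y $ 2 + 1 * y $ 3 \<le> l $ 1} \<inter> {y. 0 * y $ 1 + 0 * y $ 2 + - 1 * y $ 3 \<le> l $ 1} \<inter>
    {y. 1 * y $ 1 + 1 * y $ 2 + 1 * y $ 3 \<le> l $ 1 + l $ 2 + l $ 3} \<inter>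
    {y. 1 * y $ 1 + - 1 * y $ 2 + - 1 * y $ 3 \<le> l $ 1 + l $ 2 + l $ 3} \<inter>
    {y. - 1 * y $ 1 + 1 * y $ 2 + - 1 * y $ 3 \<le> l $ 1 + l $ 2 + l $ 3} \<inter>
    {y. - 1 * y $ 1 + - 1 * y $ 2 + 1 * y $ 3 \<le> l $ 1 + l $ 2 + l $ 3} \<inter>
    {y. 1 * y $ 1 + 1 * y $ 2 + - 1 * y $ 3 \<le> l $ 1 + l $ 2 - l $ 3} \<inter>
    {y. 1 * y $ 1 + - 1 * y $ 2 + 1 * y $ 3 \<le> l $ 1 + l $ 2 - l $ 3} \<inter>
    {y. - 1 * y $ 1 + 1 * y $ 2 + 1 * y $ 3 \<le> l $ 1 + l $ 2 - l $ 3} \<inter>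
    {y. - 1 * y $ 1 + - 1 * y $ 2 + - 1 * y $ 3 \<le> l $ 1 + l $ 2 - l $ 3}"
    by (auto simp: weight_polytope_def forall_3 abs_le_iff)
  have "polyhedron (weight_polytope l)"
    unfolding eq by (intro polyhedron_Int half)
  moreover have "bounded (weight_polytope l)"
  proof -
    have "norm y \<le> 3 * l $ 1" if "y \<in> weight_polytope l" for y
    proof -
      have "norm y \<le> (\<Sum>i\<in>UNIV. \<bar>y $ i\<bar>)" by (rule norm_le_l1_cart)
      also have "\<dots> \<le> 3 * l $ 1" using that by (simp add: sum_3 weight_polytope_def forall_3)
      finally show ?thesis .
    qed
    then show ?thesis by (auto simp: bounded_iff)
  qed
  ultimately show ?thesis by (simp add: polytope_eq_bounded_polyhedron)
qed

text \<open>
  For strictly dominant functionals the maximum over the moment image is attained at the dominant point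
  \<open>l\<close>, by its uniqueness.  The three functionals that define the polytope lie on the boundary of the
  dominant chamber and are reached as limits.
\<close>

lemma moment_image_subset:
  assumes F0: "F0 \<in> skew_matrices"
  obtains l where "torus_element l \<in> adjoint_orbit F0" "dominant l"
    "block_sin ` adjoint_orbit F0 \<subseteq> weight_polytope l"
proof -
  let ?K = "block_sin ` adjoint_orbit F0"
  define rho where "rho = (vector [2, 1, 0] :: real^3)"
  have rho: "rho $ 1 = 2" "rho $ 2 = 1" "rho $ 3 = 0" by (simp_all add: rho_def vector_3)
  obtain l where l: "torus_element l \<in> adjoint_orbit F0" "dominant l" "\<And>y. y \<in> ?K \<Longrightarrow> y \<bullet> rho \<le> l \<bullet> rho"
    by (rule maximum_dominant[OF F0, of rho]) (auto simp: rho)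
  have regular: "y \<bullet> x \<le> l \<bullet> x" if x: "x $ 2 < x $ 1" "\<bar>x $ 3\<bar> < x $ 2" and y: "y \<in> ?K" for x y
  proof -
    obtain m where m: "torus_element m \<in> adjoint_orbit F0" "dominant m" "\<And>y. y \<in> ?K \<Longrightarrow> y \<bullet> x \<le> m \<bullet> x"
      by (rule maximum_dominant[OF F0 x]) blast
    have "l = m"
      by (rule dominant_torus_element_unique[OF _ l(2) m(2)]) (simp add: adjoint_orbit_eq[OF l(1)] m(1))
    then show ?thesis using m(3)[OF y] by simp
  qed
  have weight: "y \<bullet> w \<le> l \<bullet> w" if w: "dominant w" and y: "y \<in> ?K" for w y
  proof -
    have "y \<bullet> (w + e *\<^sub>R rho) \<le> l \<bullet> (w + e *\<^sub>R rho)" if "e > 0" for e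
      by (rule regular[OF _ _ y]) (use w that in \<open>auto simp: dominant_def rho\<close>)
    then have le: "y \<bullet> w \<le> l \<bullet> w + e * (l \<bullet> rho - y \<bullet> rho)" if "e > 0" for e
      using that by (simp add: inner_add_right algebra_simps)
    have "y \<bullet> w \<le> l \<bullet> w + d" if "d > 0" for d
    proof -
      \<comment> \<open>The perturbation \<open>d / (D + 1)\<close> costs at most \<open>d\<close>, also when \<open>D = 0\<close>.\<close>
      define D where "D = l \<bullet> rho - y \<bullet> rho"
      have D: "D \<ge> 0" using l(3)[OF y] by (simp add: D_def)
      have "d / (D + 1) * D \<le> d" using D that by (simp add: field_simps)
      then show ?thesis using le[of "d / (D + 1)"] D that by (simp add: D_def)
    qed
    then show ?thesis by (rule field_le_epsilon)
  qed
  have base: "y $ 1 \<le> l $ 1" "y $ 1 + y $ 2 + y $ 3 \<le> l $ 1 + l $ 2 + l $ 3" "y $ 1 + y $ 2 - y $ 3 \<le> l $ 1 + l $ 2 - l $ 3"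
    if "y \<in> ?K" for y
    using weight[OF _ that, of "vector [1, 0, 0]"] weight[OF _ that, of "vector [1, 1, 1]"]
      weight[OF _ that, of "vector [1, 1, - 1]"]
    by (simp_all add: dominant_def inner_vec_def sum_3 vector_3)
  have "y \<in> weight_polytope l" if y: "y \<in> ?K" for y
  proof -
    note seg = moment_image_segments
    have s12: "vector [z $ 2, z $ 1, z $ 3] \<in> ?K" if "z \<in> ?K" for z using seg(1)[OF that, of "z $ 2"] by simp
    have s23: "vector [z $ 1, z $ 3, z $ 2] \<in> ?K" if "z \<in> ?K" for z using seg(2)[OF that, of "z $ 3"] by simp
    have n23: "vector [z $ 1, - z $ 2, - z $ 3] \<in> ?K" if "z \<in> ?K" for z
      using s23[OF seg(3)[OF that, of "- z $ 3"]] by (simp add: vector_3)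
    have n13: "vector [- z $ 1, z $ 2, - z $ 3] \<in> ?K" if "z \<in> ?K" for z
      using s12[OF n23[OF s12[OF that]]] by (simp add: vector_3)
    have n12: "vector [- z $ 1, - z $ 2, z $ 3] \<in> ?K" if "z \<in> ?K" for z
      using s23[OF n13[OF s23[OF that]]] by (simp add: vector_3)
    note y2 = s12[OF y] and y3 = s12[OF s23[OF y]]
    show ?thesis
      unfolding weight_polytope_def forall_3 abs_le_iff
      using base[OF y] base[OF n23[OF y]] base[OF n13[OF y]] base[OF n12[OF y]]
        base(1)[OF y2] base(1)[OF y3] base(1)[OF n12[OF y2]] base(1)[OF n12[OF y3]]
      by (simp add: vector_3)
  qed
  then show thesis using that[OF l(1,2)] by blast
qed

text \<open>
  Let \<open>k\<close> have least norm among the points of \<open>K\<close> for which \<open>k - y\<close> is a nonnegative combination of the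
  simple roots.  If \<open>k \<noteq> y\<close>, some root \<open>\<alpha>\<close> that occurs in \<open>k - y\<close> has positive inner product with \<open>k - y\<close>,
  and therefore with \<open>k\<close>, as \<open>y\<close> is dominant.  Moving \<open>k\<close> a little towards its mirror image in \<open>\<alpha>\<close> stays
  in the set and decreases the norm.
\<close>

lemma dominant_descent:
  fixes K :: "(real^3) set"
  assumes K: "compact K" and l: "l \<in> K" and y: "dominant y"
    and le: "y $ 1 \<le> l $ 1" "y $ 1 + y $ 2 - y $ 3 \<le> l $ 1 + l $ 2 - l $ 3" "y $ 1 + y $ 2 + y $ 3 \<le> l $ 1 + l $ 2 + l $ 3"
    and seg: "\<And>k r. k \<in> K \<Longrightarrow> r \<in> closed_segment (k $ 1) (k $ 2) \<Longrightarrow> vector [r, k $ 1 + k $ 2 - r, k $ 3] \<in> K"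
      "\<And>k r. k \<in> K \<Longrightarrow> r \<in> closed_segment (k $ 2) (k $ 3) \<Longrightarrow> vector [k $ 1, r, k $ 3 + k $ 2 - r] \<in> K"
      "\<And>k r. k \<in> K \<Longrightarrow> r \<in> closed_segment (k $ 2) (- k $ 3) \<Longrightarrow> vector [k $ 1, r, k $ 3 - k $ 2 + r] \<in> K"
  shows "y \<in> K"
proof -
  define D where "D = K \<inter> {k. y $ 1 \<le> k $ 1} \<inter> {k. y $ 1 + y $ 2 - y $ 3 \<le> k $ 1 + k $ 2 - k $ 3} \<inter>
    {k. y $ 1 + y $ 2 + y $ 3 \<le> k $ 1 + k $ 2 + k $ 3}"
  have "compact D" unfolding D_def
    by (intro compact_Int_closed K closed_Collect_le continuous_intros)
  moreover have "D \<noteq> {}" using l le by (auto simp: D_def)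
  moreover have "continuous_on D (\<lambda>k. k \<bullet> k)" by (intro continuous_intros)
  ultimately have "\<exists>k\<in>D. \<forall>k'\<in>D. k \<bullet> k \<le> k' \<bullet> k'"
    by (rule continuous_attains_inf)
  then obtain k where k: "k \<in> D" "\<And>k'. k' \<in> D \<Longrightarrow> k \<bullet> k \<le> k' \<bullet> k'" by blast
  have sq: "z \<bullet> z = (z $ 1)\<^sup>2 + (z $ 2)\<^sup>2 + (z $ 3)\<^sup>2" for z :: "real^3"
    by (simp add: inner_vec_def sum_3 power2_eq_square)
  have kK: "k \<in> K" using k(1) by (simp add: D_def)
  \<comment> \<open>The coefficients of \<open>k - y\<close> with respect to the simple roots \<open>(1, - 1, 0)\<close>, \<open>(0, 1, - 1)\<close>, \<open>(0, 1, 1)\<close>.\<close>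
  define c1 where "c1 = k $ 1 - y $ 1"
  define c2 where "c2 = (k $ 1 + k $ 2 - k $ 3 - (y $ 1 + y $ 2 - y $ 3)) / 2"
  define c3 where "c3 = (k $ 1 + k $ 2 + k $ 3 - (y $ 1 + y $ 2 + y $ 3)) / 2"
  have c: "c1 \<ge> 0" "c2 \<ge> 0" "c3 \<ge> 0" using k(1) by (auto simp: D_def c1_def c2_def c3_def)
  have drop: "(u - e)\<^sup>2 + (v + e)\<^sup>2 < u\<^sup>2 + v\<^sup>2" if "0 < e" "e \<le> (u - v) / 2" for u v e :: real
  proof -
    have "(u - e)\<^sup>2 + (v + e)\<^sup>2 = u\<^sup>2 + v\<^sup>2 - 2 * e * ((u - v) - e)" by (simp add: power2_eq_square algebra_simps)
    moreover have "0 < 2 * e * ((u - v) - e)" using that by (intro mult_pos_pos) auto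
    ultimately show ?thesis by linarith
  qed
  have no1: "c1 = 0 \<or> k $ 1 \<le> k $ 2"
  proof (rule ccontr)
    assume "\<not> ?thesis"
    then have pos: "c1 > 0" "k $ 2 < k $ 1" using c by auto
    define e where "e = min c1 ((k $ 1 - k $ 2) / 2)"
    have e: "0 < e" "e \<le> c1" "e \<le> (k $ 1 - k $ 2) / 2" unfolding e_def using pos by (simp_all only: min_less_iff_conj min.cobounded1 min.cobounded2) auto
    define k' where "k' = (vector [k $ 1 - e, k $ 2 + e, k $ 3] :: real^3)"
    have k': "k' $ 1 = k $ 1 - e" "k' $ 2 = k $ 2 + e" "k' $ 3 = k $ 3" by (simp_all add: k'_def vector_3)
    have "k' \<in> K"
      using seg(1)[OF kK, of "k $ 1 - e"] e pos by (simp add: k'_def closed_segment_eq_real_ivl algebra_simps)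
    then have "k' \<in> D" using k(1) e by (simp add: D_def k' c1_def)
    then show False using k(2) drop[OF e(1,3)] by (fastforce simp: sq k')
  qed
  have no2: "c2 = 0 \<or> k $ 2 \<le> k $ 3"
  proof (rule ccontr)
    assume "\<not> ?thesis"
    then have pos: "c2 > 0" "k $ 3 < k $ 2" using c by auto
    define e where "e = min c2 ((k $ 2 - k $ 3) / 2)"
    have e: "0 < e" "e \<le> c2" "e \<le> (k $ 2 - k $ 3) / 2" unfolding e_def using pos by (simp_all only: min_less_iff_conj min.cobounded1 min.cobounded2) auto
    define k' where "k' = (vector [k $ 1, k $ 2 - e, k $ 3 + e] :: real^3)"
    have k': "k' $ 1 = k $ 1" "k' $ 2 = k $ 2 - e" "k' $ 3 = k $ 3 + e" by (simp_all add: k'_def vector_3)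
    have "k' \<in> K"
      using seg(2)[OF kK, of "k $ 2 - e"] e pos by (simp add: k'_def closed_segment_eq_real_ivl algebra_simps)
    then have "k' \<in> D" using k(1) e by (simp add: D_def k' c2_def)
    then show False using k(2) drop[OF e(1,3)] by (fastforce simp: sq k')
  qed
  have no3: "c3 = 0 \<or> k $ 2 \<le> - k $ 3"
  proof (rule ccontr)
    assume "\<not> ?thesis"
    then have pos: "c3 > 0" "- k $ 3 < k $ 2" using c by auto
    define e where "e = min c3 ((k $ 2 - - k $ 3) / 2)"
    have e: "0 < e" "e \<le> c3" "e \<le> (k $ 2 - - k $ 3) / 2" unfolding e_def using pos by (simp_all only: min_less_iff_conj min.cobounded1 min.cobounded2) auto
    define k' where "k' = (vector [k $ 1, k $ 2 - e, k $ 3 - e] :: real^3)"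
    have k': "k' $ 1 = k $ 1" "k' $ 2 = k $ 2 - e" "k' $ 3 = k $ 3 - e" by (simp_all add: k'_def vector_3)
    have "k' \<in> K"
      using seg(3)[OF kK, of "k $ 2 - e"] e pos by (simp add: k'_def closed_segment_eq_real_ivl algebra_simps)
    then have "k' \<in> D" using k(1) e by (simp add: D_def k' c3_def)
    moreover have "(k $ 3 - e)\<^sup>2 = (- k $ 3 + e)\<^sup>2" by (simp add: power2_eq_square algebra_simps)
    ultimately show False using k(2) drop[OF e(1,3)] by (fastforce simp: sq k')
  qed
  define d where "d = k - y"
  have d: "d $ 1 = c1" "d $ 2 = - c1 + c2 + c3" "d $ 3 = - c2 + c3"
    by (simp_all add: d_def c1_def c2_def c3_def field_simps)
  have "c1 * (d $ 1 - d $ 2) \<le> 0" "c2 * (d $ 2 - d $ 3) \<le> 0" "c3 * (d $ 2 + d $ 3) \<le> 0"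
    using no1 no2 no3 c y by (auto simp: dominant_def d_def mult_nonneg_nonpos)
  moreover have "d \<bullet> d = c1 * (d $ 1 - d $ 2) + c2 * (d $ 2 - d $ 3) + c3 * (d $ 2 + d $ 3)"
    unfolding sq d by (simp add: power2_eq_square algebra_simps)
  ultimately have "d \<bullet> d \<le> 0" by linarith
  then have "d = 0" by (metis inner_ge_zero inner_eq_zero_iff order_antisym)
  then show "y \<in> K" using kK by (simp add: d_def)
qed

text \<open>
  Permutations bring the coordinate of least absolute value to the last place and sort the others; even
  sign changes then make the first two coordinates nonnegative.
\<close>

lemma reduce_to_dominant:
  fixes P :: "real^3 \<Rightarrow> bool"
  assumes dom: "\<And>y. dominant y \<Longrightarrow> P y"
    and s12: "\<And>y. P (vector [y $ 2, y $ 1, y $ 3]) \<Longrightarrow> P y"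
    and s23: "\<And>y. P (vector [y $ 1, y $ 3, y $ 2]) \<Longrightarrow> P y"
    and n23: "\<And>y. P (vector [y $ 1, - y $ 2, - y $ 3]) \<Longrightarrow> P y"
  shows "P y"
proof -
  have n13: "P y" if "P (vector [- y $ 1, y $ 2, - y $ 3])" for y
    by (rule s12, rule n23, rule s12) (use that in \<open>simp add: vector_3\<close>)
  have n12: "P y" if "P (vector [- y $ 1, - y $ 2, y $ 3])" for y
    by (rule s23, rule n13, rule s23) (use that in \<open>simp add: vector_3\<close>)
  have sorted: "P y" if "\<bar>y $ 2\<bar> \<le> \<bar>y $ 1\<bar>" "\<bar>y $ 3\<bar> \<le> \<bar>y $ 2\<bar>" for y
  proof -
    consider "0 \<le> y $ 1" "0 \<le> y $ 2" | "0 \<le> y $ 1" "y $ 2 < 0" | "y $ 1 < 0" "0 \<le> y $ 2" | "y $ 1 < 0" "y $ 2 < 0"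
      by linarith
    then show ?thesis
    proof cases
      case 1
      then show ?thesis using that by (intro dom) (simp add: dominant_def)
    next
      case 2
      show ?thesis by (rule n23, rule dom) (use 2 that in \<open>simp add: dominant_def vector_3\<close>)
    next
      case 3
      show ?thesis by (rule n13, rule dom) (use 3 that in \<open>simp add: dominant_def vector_3\<close>)
    next
      case 4
      show ?thesis by (rule n12, rule dom) (use 4 that in \<open>simp add: dominant_def vector_3\<close>)
    qed
  qed
  have first: "P y" if "\<bar>y $ 2\<bar> \<le> \<bar>y $ 1\<bar>" "\<bar>y $ 3\<bar> \<le> \<bar>y $ 1\<bar>" for y
  proof (cases "\<bar>y $ 3\<bar> \<le> \<bar>y $ 2\<bar>")
    case True
    then show ?thesis using that sorted by blast
  next
    case False
    show ?thesis by (rule s23, rule sorted) (use False that in \<open>simp_all add: vector_3\<close>)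
  qed
  consider "\<bar>y $ 2\<bar> \<le> \<bar>y $ 1\<bar>" "\<bar>y $ 3\<bar> \<le> \<bar>y $ 1\<bar>" | "\<bar>y $ 1\<bar> \<le> \<bar>y $ 2\<bar>" "\<bar>y $ 3\<bar> \<le> \<bar>y $ 2\<bar>"
    | "\<bar>y $ 1\<bar> \<le> \<bar>y $ 3\<bar>" "\<bar>y $ 2\<bar> \<le> \<bar>y $ 3\<bar>" by linarith
  then show "P y"
  proof cases
    case 1
    then show ?thesis by (rule first)
  next
    case 2
    show ?thesis by (rule s12, rule first) (use 2 in \<open>simp_all add: vector_3\<close>)
  next
    case 3
    show ?thesis by (rule s23, rule s12, rule first) (use 3 in \<open>simp_all add: vector_3\<close>)
  qed
qed

text \<open>
  The moment image equals the weight polytope of its dominant point in the torus algebra.  The reverse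
  inclusion is first shown for dominant points and then carried over by the Weyl group.
\<close>

theorem polytope_moment_image:
  assumes F0: "F0 \<in> skew_matrices"
  shows "polytope (block_sin ` adjoint_orbit F0)"
proof -
  let ?K = "block_sin ` adjoint_orbit F0"
  obtain l where l: "torus_element l \<in> adjoint_orbit F0" "dominant l" "?K \<subseteq> weight_polytope l"
    by (rule moment_image_subset[OF F0])
  note seg = moment_image_segments[of _ F0]
  have lK: "l \<in> ?K" using l(1) by (rule rev_image_eqI) (simp add: torus_element_eq)
  have K: "compact ?K"
    by (rule compact_continuous_image[OF linear_continuous_on compact_adjoint_orbit])
      (use linear_block(2) linear_conv_bounded_linear in blast)
  have inv: "vector [z $ 2, z $ 1, z $ 3] \<in> ?K" "vector [z $ 1, z $ 3, z $ 2] \<in> ?K" "vector [z $ 1, - z $ 2, - z $ 3] \<in> ?K"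
    if "z \<in> ?K" for z
  proof -
    show "vector [z $ 2, z $ 1, z $ 3] \<in> ?K" using seg(1)[OF that, of "z $ 2"] by simp
    have s23: "vector [z $ 1, z $ 3, z $ 2] \<in> ?K" if "z \<in> ?K" for z using seg(2)[OF that, of "z $ 3"] by simp
    show "vector [z $ 1, z $ 3, z $ 2] \<in> ?K" by (rule s23[OF that])
    show "vector [z $ 1, - z $ 2, - z $ 3] \<in> ?K"
      using s23[OF seg(3)[OF that, of "- z $ 3"]] by (simp add: vector_3)
  qed
  have vec: "vector [z $ 1, z $ 2, z $ 3] = z" for z :: "real^3" by (simp add: vec_eq_iff forall_3 vector_3)
  have "y \<in> weight_polytope l \<longrightarrow> y \<in> ?K" for y
  proof (rule reduce_to_dominant[where P = "\<lambda>y. y \<in> weight_polytope l \<longrightarrow> y \<in> ?K"])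
    fix y :: "real^3" assume y: "dominant y"
    show "y \<in> weight_polytope l \<longrightarrow> y \<in> ?K"
    proof
      assume yw: "y \<in> weight_polytope l"
      have "y $ 1 \<le> l $ 1" "y $ 1 + y $ 2 - y $ 3 \<le> l $ 1 + l $ 2 - l $ 3"
        "y $ 1 + y $ 2 + y $ 3 \<le> l $ 1 + l $ 2 + l $ 3"
        using yw by (auto simp: weight_polytope_def forall_3 abs_le_iff)
      then show "y \<in> ?K"
        by (rule dominant_descent[OF K lK y]) (rule seg; assumption)+
    qed
  next
    fix y :: "real^3"
    assume "vector [y $ 2, y $ 1, y $ 3] \<in> weight_polytope l \<longrightarrow> vector [y $ 2, y $ 1, y $ 3] \<in> ?K"
    moreover have "vector [y $ 2, y $ 1, y $ 3] \<in> weight_polytope l" if "y \<in> weight_polytope l"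
      using that by (simp add: weight_polytope_def forall_3 vector_3 algebra_simps)
    ultimately show "y \<in> weight_polytope l \<longrightarrow> y \<in> ?K"
      using inv(1)[of "vector [y $ 2, y $ 1, y $ 3]"] by (auto simp: vector_3 vec)
  next
    fix y :: "real^3"
    assume "vector [y $ 1, y $ 3, y $ 2] \<in> weight_polytope l \<longrightarrow> vector [y $ 1, y $ 3, y $ 2] \<in> ?K"
    moreover have "vector [y $ 1, y $ 3, y $ 2] \<in> weight_polytope l" if "y \<in> weight_polytope l"
      using that by (simp add: weight_polytope_def forall_3 vector_3 algebra_simps)
    ultimately show "y \<in> weight_polytope l \<longrightarrow> y \<in> ?K"
      using inv(2)[of "vector [y $ 1, y $ 3, y $ 2]"] by (auto simp: vector_3 vec)
  next
    fix y :: "real^3"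
    assume "vector [y $ 1, - y $ 2, - y $ 3] \<in> weight_polytope l \<longrightarrow> vector [y $ 1, - y $ 2, - y $ 3] \<in> ?K"
    moreover have "vector [y $ 1, - y $ 2, - y $ 3] \<in> weight_polytope l" if "y \<in> weight_polytope l"
      using that by (simp add: weight_polytope_def forall_3 vector_3 algebra_simps)
    ultimately show "y \<in> weight_polytope l \<longrightarrow> y \<in> ?K"
      using inv(3)[of "vector [y $ 1, - y $ 2, - y $ 3]"] by (auto simp: vector_3 vec)
  qed
  then have "?K = weight_polytope l" using l(3) by blast
  then show ?thesis using polytope_weight_polytope by simp
qed

section \<open>Forms, cosets and the moment polytope\<close>

lemma stabilizer_iff:
  assumes \<omega>: "\<omega> \<in> two_forms" and A: "A \<in> SO6"
  shows "A \<in> stabilizer \<omega> \<longleftrightarrow> Ad A (endo \<omega>) = endo \<omega>"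
proof -
  have o: "orthogonal_matrix A" using A by (simp add: SO6_def rotation_matrix_def)
  have "rotate_form (mat 1) \<omega> = \<omega>"
    by (intro ext) (simp add: rotate_form_inner[OF \<omega> orthogonal_matrix_id] Ad_mat_1 endo_apply[OF \<omega>])
  then show ?thesis
    using A rotate_form_eq_iff[OF \<omega> o orthogonal_matrix_id]
    by (simp add: stabilizer_def endo_rotate_form[OF \<omega> o])
qed

lemma rotate_form_coset:
  assumes \<omega>: "\<omega> \<in> two_forms" and A: "A \<in> SO6" and A': "A' \<in> SO6"
  shows "rotate_form A \<omega> = rotate_form A' \<omega> \<longleftrightarrow> matrix_inv A ** A' \<in> stabilizer \<omega>"
    and "endo (rotate_form A \<omega>) = endo (rotate_form A' \<omega>) \<longleftrightarrow> matrix_inv A ** A' \<in> stabilizer \<omega>"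
proof -
  have r: "rotation_matrix A" "rotation_matrix A'" using A A' by (auto simp: SO6_def)
  have o: "orthogonal_matrix A" "orthogonal_matrix A'" "orthogonal_matrix (transpose A)"
    using r by (auto simp: rotation_matrix_def)
  have inv: "matrix_inv A = transpose A" by (rule orthogonal_matrix_inv[OF o(1)])
  have "transpose A ** A' \<in> SO6"
    using r by (simp add: SO6_def rotation_matrix_mul rotation_matrix_transpose)
  then have "matrix_inv A ** A' \<in> stabilizer \<omega> \<longleftrightarrow> Ad (transpose A) (Ad A' (endo \<omega>)) = endo \<omega>"
    by (simp add: stabilizer_iff[OF \<omega>] inv Ad_mul_orthogonal o)
  also have "\<dots> \<longleftrightarrow> Ad A (endo \<omega>) = Ad A' (endo \<omega>)"
    using Ad_transpose_cancel[OF o(1)] by metis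
  finally show "endo (rotate_form A \<omega>) = endo (rotate_form A' \<omega>) \<longleftrightarrow> matrix_inv A ** A' \<in> stabilizer \<omega>"
    by (simp add: endo_rotate_form[OF \<omega>] o)
  then show "rotate_form A \<omega> = rotate_form A' \<omega> \<longleftrightarrow> matrix_inv A ** A' \<in> stabilizer \<omega>"
    using rotate_form_eq_iff[OF \<omega> o(1,2)] by simp
qed

lemma rotate_form_fibre:
  assumes \<omega>: "\<omega> \<in> two_forms" and A: "A \<in> SO6"
  shows "{A' \<in> SO6. rotate_form A' \<omega> = rotate_form A \<omega>} = (\<lambda>g. A ** g) ` stabilizer \<omega>"
proof -
  have r: "rotation_matrix A" using A by (simp add: SO6_def)
  have inv: "matrix_inv A = transpose A" by (rule orthogonal_matrix_inv[OF rotation_matrix_orthogonal[OF r]])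
  have c: "A ** transpose A = mat 1" "transpose A ** A = mat 1" using r by (simp_all add: rotation_matrix_def orthogonal_matrix_def)
  show ?thesis
  proof safe
    fix A' assume A': "A' \<in> SO6" "rotate_form A' \<omega> = rotate_form A \<omega>"
    then have "matrix_inv A ** A' \<in> stabilizer \<omega>" using rotate_form_coset(1)[OF \<omega> A A'(1)] by simp
    moreover have "A' = A ** (matrix_inv A ** A')" by (simp add: inv matrix_mul_assoc c)
    ultimately show "A' \<in> (\<lambda>g. A ** g) ` stabilizer \<omega>" by blast
  next
    fix g assume g: "g \<in> stabilizer \<omega>"
    then have "g \<in> SO6" by (simp add: stabilizer_def)
    then show Ag: "A ** g \<in> SO6" using r by (simp add: SO6_def rotation_matrix_mul)
    have "matrix_inv A ** (A ** g) = g" by (simp add: inv matrix_mul_assoc c)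
    then show "rotate_form (A ** g) \<omega> = rotate_form A \<omega>"
      using rotate_form_coset(1)[OF \<omega> A Ag] g by simp
  qed
qed

lemma forms_biject_G_structures:
  assumes \<omega>: "\<omega> \<in> two_forms"
  shows "bij_betw (\<lambda>\<eta>. {A \<in> SO6. rotate_form A \<omega> = \<eta>}) (form_orbit \<omega>) (G_structures (stabilizer \<omega>))"
  unfolding bij_betw_def
proof
  show "inj_on (\<lambda>\<eta>. {A \<in> SO6. rotate_form A \<omega> = \<eta>}) (form_orbit \<omega>)"
    unfolding inj_on_def form_orbit_def by blast
  show "(\<lambda>\<eta>. {A \<in> SO6. rotate_form A \<omega> = \<eta>}) ` form_orbit \<omega> = G_structures (stabilizer \<omega>)"
    unfolding form_orbit_def G_structures_def image_image
    by (rule image_cong[OF refl]) (rule rotate_form_fibre[OF \<omega>])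
qed

lemma quotient_map_orbit:
  assumes \<omega>: "\<omega> \<in> two_forms"
  shows "quotient_map (top_of_set SO6) (top_of_set (coadjoint_orbit \<omega>)) (\<lambda>A. endo (rotate_form A \<omega>))"
proof (rule continuous_imp_quotient_map)
  have cont: "continuous_on SO6 (\<lambda>A. endo (rotate_form A \<omega>))"
    using continuous_on_Ad[of "endo \<omega>"] unfolding SO6_def[symmetric]
    by (rule continuous_on_eq) (simp add: SO6_def endo_rotate_form[OF \<omega>] rotation_matrix_orthogonal)
  have image: "(\<lambda>A. endo (rotate_form A \<omega>)) ` SO6 = coadjoint_orbit \<omega>"
    by (simp add: coadjoint_orbit_def form_orbit_def image_image)
  show "continuous_map (top_of_set SO6) (top_of_set (coadjoint_orbit \<omega>)) (\<lambda>A. endo (rotate_form A \<omega>))"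
    using cont image by auto
  show "compact_space (top_of_set SO6)"
    by (rule compact_space_subtopology) (simp add: SO6_def compact_rotation_matrices)
  show "Hausdorff_space (top_of_set (coadjoint_orbit \<omega>))"
    by (simp add: Hausdorff_space_subtopology)
  show "(\<lambda>A. endo (rotate_form A \<omega>)) ` topspace (top_of_set SO6) = topspace (top_of_set (coadjoint_orbit \<omega>))"
    using image by simp
qed

theorem theorem13:
  fixes \<omega> :: "real^6 \<Rightarrow> real^6 \<Rightarrow> real"
    and B :: "real^6^6 \<Rightarrow> real^6^6 \<Rightarrow> real"
  assumes "\<omega> \<in> two_forms" and "\<omega> \<noteq> (\<lambda>X Y. 0)"
    and "invariant_inner_product B"
  shows "bij_betw (\<lambda>\<eta>. {A \<in> SO6. rotate_form A \<omega> = \<eta>}) (form_orbit \<omega>) (G_structures (stabilizer \<omega>)) \<and>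
    quotient_map (top_of_set SO6) (top_of_set (coadjoint_orbit \<omega>)) (\<lambda>A. endo (rotate_form A \<omega>)) \<and>
    (\<forall>A\<in>SO6. \<forall>A'\<in>SO6. endo (rotate_form A \<omega>) = endo (rotate_form A' \<omega>) \<longleftrightarrow>
           matrix_inv A ** A' \<in> stabilizer \<omega>) \<and>
    (\<forall>F\<in>coadjoint_orbit \<omega>. tangent_space (coadjoint_orbit \<omega>) F = (\<lambda>X. generated_field Ad X F) ` so6) \<and>
    (\<forall>F\<in>coadjoint_orbit \<omega>. \<forall>X\<in>so6. \<forall>Y\<in>so6.
           KKS B F (generated_field Ad X F) (generated_field Ad Y F) = B F (bracket X Y)) \<and>
    lie_algebra torus = range torus_element \<and>
    hamiltonian_action torus Ad (coadjoint_orbit \<omega>) (KKS B)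
           (\<lambda>F. torus_covector B (torus_moment B F)) \<and>
    (\<forall>F\<in>coadjoint_orbit \<omega>. torus_element (torus_moment B F) = torus_projection B F) \<and>
    polytope (torus_moment B ` coadjoint_orbit \<omega>)"
proof (intro conjI ballI)
  note \<omega> = assms(1) and B = assms(3)
  have F0: "endo \<omega> \<in> skew_matrices" by (rule endo_skew[OF \<omega>])
  have orbit: "coadjoint_orbit \<omega> = adjoint_orbit (endo \<omega>)" by (rule coadjoint_orbit_eq[OF \<omega>])
  have skew: "F \<in> skew_matrices" if "F \<in> coadjoint_orbit \<omega>" for F
    using that adjoint_orbit_skew[OF F0] by (simp add: orbit)
  have gen: "generated_field Ad X F = bracket X F" if "X \<in> so6" for X F :: "real^6^6"
    using that by (intro generated_field_Ad) (simp add: so6_def)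
  show "bij_betw (\<lambda>\<eta>. {A \<in> SO6. rotate_form A \<omega> = \<eta>}) (form_orbit \<omega>) (G_structures (stabilizer \<omega>))"
    by (rule forms_biject_G_structures[OF \<omega>])
  show "quotient_map (top_of_set SO6) (top_of_set (coadjoint_orbit \<omega>)) (\<lambda>A. endo (rotate_form A \<omega>))"
    by (rule quotient_map_orbit[OF \<omega>])
  show "endo (rotate_form A \<omega>) = endo (rotate_form A' \<omega>) \<longleftrightarrow> matrix_inv A ** A' \<in> stabilizer \<omega>"
    if "A \<in> SO6" "A' \<in> SO6" for A A'
    by (rule rotate_form_coset(2)[OF \<omega> that])
  show "tangent_space (coadjoint_orbit \<omega>) F = (\<lambda>X. generated_field Ad X F) ` so6"
    if "F \<in> coadjoint_orbit \<omega>" for F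
  proof -
    have "tangent_space (coadjoint_orbit \<omega>) F = (\<lambda>X. bracket X F) ` so6"
      using tangent_space_adjoint_orbit[OF F0] that by (simp add: orbit so6_eq)
    also have "\<dots> = (\<lambda>X. generated_field Ad X F) ` so6"
      by (rule image_cong[OF refl]) (simp add: gen)
    finally show ?thesis .
  qed
  show "KKS B F (generated_field Ad X F) (generated_field Ad Y F) = B F (bracket X Y)"
    if "F \<in> coadjoint_orbit \<omega>" "X \<in> so6" "Y \<in> so6" for F X Y
    using KKS_bracket[OF B skew[OF that(1)]] that(2,3) by (simp add: gen so6_eq[symmetric])
  show "lie_algebra torus = range torus_element" by (rule lie_algebra_torus)
  show "hamiltonian_action torus Ad (coadjoint_orbit \<omega>) (KKS B) (\<lambda>F. torus_covector B (torus_moment B F))"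
    unfolding orbit by (rule hamiltonian_action_torus[OF B F0])
  show "torus_element (torus_moment B F) = torus_projection B F" if "F \<in> coadjoint_orbit \<omega>" for F
    by (simp add: torus_moment_eq[OF B skew[OF that]] torus_projection_eq(1)[OF B skew[OF that]])
  have "torus_moment B ` coadjoint_orbit \<omega> = block_sin ` adjoint_orbit (endo \<omega>)"
    unfolding orbit by (rule image_cong[OF refl]) (use skew in \<open>simp add: orbit torus_moment_eq[OF B]\<close>)
  then show "polytope (torus_moment B ` coadjoint_orbit \<omega>)"
    using polytope_moment_image[OF F0] by simp
qed

end
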